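(* Let $d\ge 2$, let $\Omega\subset\mathbb{R}^d$ be a domain and let $f\colon\Omega\to[-\infty,+\infty]$ be upper semicontinuous. For $x\in\Omega$ set $$V(x)=\sup\{u(x): u \text{ subharmonic on }\Omega,\ u\le f \text{ on }\Omega,\ \sup_\Omega u<+\infty\},$$ and let $W=V^*$ be the upper semicontinuous regularization of $V$ on $\Omega$. If $W$ is subharmonic on $\Omega$, then $V=W$ at every point of $\Omega$. The same conclusion holds for the restricted family: if $V$ is instead defined as the pointwise supremum of all subharmonic functions $u\le f$ on $\Omega$ that are bounded both above and below on $\Omega$, and $W=V^*$ is subharmonic, then $V=W$ on $\Omega$.
   Context: A domain is a nonempty connected open set. Subharmonic functions take values in $[-\infty,+\infty)$, and the function identically $-\infty$ is allowed as a subharmonic function. The supremum of the empty set is $-\infty$. The upper semicontinuous regularization of $V\colon\Omega\to[-\infty,+\infty]$ is $V^*(x)=\limsup_{y\to x}V(y)$, where the value $y=x$ is included, i.e. the smallest upper semicontinuous function that is $\ge V$. *)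

theory Defs
  imports "HOL-Analysis.Analysis"
begin

text \<open>
  Functions on a set \<open>S\<close> are total functions on the ambient space; none of the notions below
  depends on their values outside \<open>S\<close>.
\<close>

definition usc_on :: "'a::topological_space set \<Rightarrow> ('a \<Rightarrow> ereal) \<Rightarrow> bool" where
  "usc_on S u \<longleftrightarrow> (\<forall>x\<in>S. Limsup (at x within S) u \<le> u x)"

text \<open>The filter below, unlike \<open>at x within S\<close>, does not exclude the point \<open>x\<close> itself.\<close>

definition usc_regularization ::
    "'a::topological_space set \<Rightarrow> ('a \<Rightarrow> ereal) \<Rightarrow> 'a \<Rightarrow> ereal" where
  "usc_regularization S v x = Limsup (inf (nhds x) (principal S)) v"

text \<open>
  Normalized surface measure on the unit sphere, by the polar-coordinate construction: the measure
  of \<open>E \<subseteq> sphere 0 1\<close> is the proportion of the volume of the unit ball taken by the cone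
  \<open>{t *\<^sub>R z | 0 < t < 1, z \<in> E}\<close>. Here \<open>sgn y = y /\<^sub>R norm y\<close>, and the null set \<open>{0}\<close>,
  where \<open>sgn 0 = 0\<close>, is the only part of the ball not mapped into the sphere.
\<close>

definition sphere_measure :: "'a::euclidean_space measure" where
  "sphere_measure = distr (uniform_measure lborel (ball 0 1)) borel sgn"

text \<open>
  Mean of \<open>u\<close> over the sphere of centre \<open>x\<close> and radius \<open>r\<close>, as positive part minus negative part
  (\<open>e2ennreal\<close> sends negative values to \<open>0\<close>). If \<open>u\<close> is upper semicontinuous and \<open>< \<infinity>\<close> on
  the sphere, then it is bounded above there, so the first integral is finite and the mean is a
  well-defined element of \<open>[-\<infinity>, \<infinity>)\<close>.
\<close>

definition spherical_mean :: "('a::euclidean_space \<Rightarrow> ereal) \<Rightarrow> 'a \<Rightarrow> real \<Rightarrow> ereal" where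
  "spherical_mean u x r =
     enn2ereal (\<integral>\<^sup>+z\<in>sphere 0 1. e2ennreal (u (x + r *\<^sub>R z)) \<partial>sphere_measure) -
     enn2ereal (\<integral>\<^sup>+z\<in>sphere 0 1. e2ennreal (- u (x + r *\<^sub>R z)) \<partial>sphere_measure)"

definition subharmonic_on :: "'a::euclidean_space set \<Rightarrow> ('a \<Rightarrow> ereal) \<Rightarrow> bool" where
  "subharmonic_on S u \<longleftrightarrow>
     usc_on S u \<and>
     (\<forall>x\<in>S. u x < \<infinity>) \<and>
     (\<forall>x r. 0 < r \<longrightarrow> cball x r \<subseteq> S \<longrightarrow> u x \<le> spherical_mean u x r)"

definition minorants_bdd_above ::
    "'a::euclidean_space set \<Rightarrow> ('a \<Rightarrow> ereal) \<Rightarrow> ('a \<Rightarrow> ereal) set" where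
  "minorants_bdd_above S f =
     {u. subharmonic_on S u \<and> (\<forall>x\<in>S. u x \<le> f x) \<and> (SUP x\<in>S. u x) < \<infinity>}"

definition minorants_bdd ::
    "'a::euclidean_space set \<Rightarrow> ('a \<Rightarrow> ereal) \<Rightarrow> ('a \<Rightarrow> ereal) set" where
  "minorants_bdd S f = {u \<in> minorants_bdd_above S f. -\<infinity> < (INF x\<in>S. u x)}"

definition upper_envelope :: "('a \<Rightarrow> ereal) set \<Rightarrow> 'a \<Rightarrow> ereal" where
  "upper_envelope F x = (SUP u\<in>F. u x)"

end

theory Submission
  imports Defs
begin

text \<open>
  If \<open>W\<close> is bounded above and the family is nonempty, then \<open>W\<close> belongs to the family, since
  \<open>W \<le> f\<close> by upper semicontinuity of \<open>f\<close>, and there is nothing to prove. In general \<open>W\<close> may be unbounded, and the task is to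
  find, for given \<open>x\<^sub>0\<close> with \<open>W x\<^sub>0 > -\<infinity>\<close>, a bounded above subharmonic minorant of \<open>f\<close> whose value at
  \<open>x\<^sub>0\<close> is close to \<open>W x\<^sub>0\<close>. It is obtained by replacing a member \<open>u\<close> of the family in a small ball
  around \<open>x\<^sub>0\<close>, where \<open>W\<close> is bounded, by a function close to \<open>W\<close>, and leaving \<open>u\<close> unchanged outside.

  Let \<open>B\<close> be a ball with centre \<open>x\<^sub>0\<close>, and write \<open>P\<^sub>u\<close> and \<open>P\<^sub>W\<close> for the harmonic functions in \<open>B\<close> with
  boundary values \<open>u\<close> and \<open>W\<close>. Then \<open>g = W - P\<^sub>W + P\<^sub>u\<close> is subharmonic in \<open>B\<close>. Since \<open>P\<^sub>u \<le> P\<^sub>W\<close>, it is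
  at most \<open>W\<close>; since \<open>W \<le> P\<^sub>W\<close>, it is at most \<open>P\<^sub>u\<close>, so that its boundary values do not exceed those
  of \<open>u\<close>. Hence the function that is \<open>max u g\<close> in \<open>B\<close> and \<open>u\<close> elsewhere is subharmonic, lies between
  \<open>u\<close> and \<open>W\<close>, and belongs to the family. Its value at \<open>x\<^sub>0\<close> is at least \<open>W x\<^sub>0\<close> minus the difference of
  the means of \<open>W\<close> and \<open>u\<close> over the sphere. This is lemma \<open>subharmonic_intermediate\<close>.

  It remains to make the difference of the means small. By Choquet's lemma (\<open>choquet_sequence\<close>) there
  is an increasing sequence of members \<open>u\<^sub>n\<close> whose supremum has the regularization \<open>W\<close> near \<open>x\<^sub>0\<close>. The ball
  averages of this supremum are upper semicontinuous in the centre and dominate it; so they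
  dominate \<open>W\<close>, and letting the radius tend to zero shows that the integrals of the supremum and of
  \<open>W\<close> over a ball agree (\<open>sup_deficit_integral_le\<close>). In polar coordinates, the means of \<open>u\<^sub>n\<close> over
  almost every sphere around \<open>x\<^sub>0\<close> then converge to the mean of \<open>W\<close>
  (\<open>sphere_with_converging_deficits\<close>).

  The rest is the part of potential theory on balls that this uses, developed from the definition
  of subharmonicity by spherical means: the maximum principle, the mean value property of
  harmonic functions, the Dirichlet problem on a ball for continuous boundary values
  (\<open>dirichlet_problem_ball\<close>), and the fact that it suffices to check the sub-mean value property on
  small spheres (\<open>subharmonic_onI_local\<close>). The Dirichlet problem is solved for powers of linear
  functions by explicit polynomials, then for exponentials of linear functions, and then for all
  continuous functions by the Stone-Weierstrass theorem.
\<close>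

section \<open>Upper semicontinuous functions\<close>

text \<open>
  The limit superior in the definition of upper semicontinuity leaves out the point itself.
  Adding the point changes nothing, and then upper semicontinuity at \<open>x\<close> says that every bound
  \<open>c > u x\<close> persists near \<open>x\<close>; in this form it is stable under sums, maxima and infima.
\<close>

lemma usc_on_iff:
  "usc_on S u \<longleftrightarrow> (\<forall>x\<in>S. \<forall>c. u x < c \<longrightarrow> eventually (\<lambda>y. u y < c) (inf (nhds x) (principal S)))"
proof -
  have *: "Limsup (at x within S) u \<le> u x \<longleftrightarrow>
      (\<forall>c. u x < c \<longrightarrow> eventually (\<lambda>y. u y < c) (inf (nhds x) (principal S)))" if "x \<in> S" for x
  proof -
    have "eventually (\<lambda>y. u y < c) (at x within S) \<longleftrightarrow>
        eventually (\<lambda>y. u y < c) (inf (nhds x) (principal S))" if "u x < c" for c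
    proof -
      have "(y \<noteq> x \<longrightarrow> y \<in> S \<longrightarrow> u y < c) \<longleftrightarrow> (y \<in> S \<longrightarrow> u y < c)" for y
        using that by auto
      then show ?thesis unfolding eventually_at_filter eventually_inf_principal by simp
    qed
    then show ?thesis unfolding Limsup_le_iff by metis
  qed
  then show ?thesis unfolding usc_on_def by blast
qed

lemma usc_onD:
  fixes S :: "'a::metric_space set"
  assumes "usc_on S u" "x \<in> S" "u x < c"
  obtains d where "d > 0" "\<And>y. y \<in> S \<Longrightarrow> dist y x < d \<Longrightarrow> u y < c"
  using assms unfolding usc_on_iff eventually_inf_principal eventually_nhds_metric by blast

lemma usc_onI:
  fixes S :: "'a::metric_space set"
  assumes "\<And>x c. x \<in> S \<Longrightarrow> u x < c \<Longrightarrow> \<exists>d>0. \<forall>y\<in>S. dist y x < d \<longrightarrow> u y < c"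
  shows "usc_on S u"
  using assms unfolding usc_on_iff eventually_inf_principal eventually_nhds_metric by blast

lemma usc_on_subset:
  fixes S :: "'a::metric_space set"
  assumes "usc_on S u" "T \<subseteq> S"
  shows "usc_on T u"
proof (rule usc_onI)
  fix x c assume "x \<in> T" "u x < c"
  then obtain d where "d > 0" "\<And>y. y \<in> S \<Longrightarrow> dist y x < d \<Longrightarrow> u y < c"
    using usc_onD[OF assms(1), of x c] assms(2) by auto
  then show "\<exists>d>0. \<forall>y\<in>T. dist y x < d \<longrightarrow> u y < c" using assms(2) by auto
qed

lemma usc_on_continuous:
  fixes h :: "'a::metric_space \<Rightarrow> real"
  assumes "continuous_on S h"
  shows "usc_on S (\<lambda>x. ereal (h x))"
proof -
  have "((\<lambda>y. ereal (h y)) \<longlongrightarrow> ereal (h x)) (at x within S)" if "x \<in> S" for x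
    using assms that by (auto simp: continuous_on_def)
  then show ?thesis unfolding usc_on_def
    by (metis lim_imp_Limsup Limsup_bot at_within_eq_bot_iff bot_least order_refl trivial_limit_def)
qed

text \<open>
  A bound \<open>c > u x + v x\<close> splits into bounds \<open>c1 > u x\<close> and \<open>c2 > v x\<close> with \<open>c1 + c2 \<le> c\<close>. The
  case distinction is there because \<open>u x\<close> and \<open>v x\<close> may be \<open>-\<infinity>\<close>; the value \<open>\<infinity>\<close> has to be
  excluded, since \<open>\<infinity> + (-\<infinity>) = \<infinity>\<close> for extended reals.
\<close>

lemma usc_on_add:
  fixes S :: "'a::metric_space set"
  assumes u: "usc_on S u" and v: "usc_on S v"
    and fin: "\<And>x. x \<in> S \<Longrightarrow> u x < \<infinity>" "\<And>x. x \<in> S \<Longrightarrow> v x < \<infinity>"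
  shows "usc_on S (\<lambda>x. u x + v x)"
proof (rule usc_onI)
  fix x c assume x: "x \<in> S" and c: "u x + v x < c"
  obtain c1 c2 where c12: "u x < c1" "v x < c2" "\<And>s t. s < c1 \<Longrightarrow> t < c2 \<Longrightarrow> s + t < c"
  proof (cases c)
    case (real r)
    have "\<exists>a b. u x < ereal a \<and> v x < ereal b \<and> a + b \<le> r"
    proof (cases "u x")
      case ux: (real p)
      show ?thesis
      proof (cases "v x")
        case (real q)
        then show ?thesis using c ux \<open>c = ereal r\<close>
          by (intro exI[of _ "p + (r - p - q)/2"] exI[of _ "q + (r - p - q)/2"]) (auto simp: field_simps)
      next
        case MInf
        then show ?thesis using ux by (intro exI[of _ "p + 1"] exI[of _ "r - p - 1"]) auto
      qed (use fin[OF x] in auto)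
    next
      case MInf
      show ?thesis
      proof (cases "v x")
        case (real q)
        then show ?thesis using MInf by (intro exI[of _ "r - q - 1"] exI[of _ "q + 1"]) auto
      next
        case MInf': MInf
        then show ?thesis using MInf by (intro exI[of _ "r"] exI[of _ "0"]) auto
      qed (use fin[OF x] in auto)
    qed (use fin[OF x] in auto)
    then obtain a b where "u x < ereal a" "v x < ereal b" "a + b \<le> r" by blast
    moreover have "s + t < c" if "s < ereal a" "t < ereal b" for s t
      using that \<open>a + b \<le> r\<close> real by (cases s; cases t) auto
    ultimately show ?thesis using that by blast
  next
    case PInf
    show ?thesis using fin[OF x] by (intro that[of \<infinity> \<infinity>]) (auto simp: PInf)
  qed (use c in auto)
  obtain d1 where d1: "d1 > 0" "\<And>y. y \<in> S \<Longrightarrow> dist y x < d1 \<Longrightarrow> u y < c1" using usc_onD[OF u x c12(1)] by blast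
  obtain d2 where d2: "d2 > 0" "\<And>y. y \<in> S \<Longrightarrow> dist y x < d2 \<Longrightarrow> v y < c2" using usc_onD[OF v x c12(2)] by blast
  show "\<exists>d>0. \<forall>y\<in>S. dist y x < d \<longrightarrow> u y + v y < c"
    using d1 d2 by (intro exI[of _ "min d1 d2"]) (simp add: c12(3))
qed

lemma usc_on_INF:
  fixes S :: "'a::metric_space set"
  assumes "\<And>i. i \<in> I \<Longrightarrow> usc_on S (u i)"
  shows "usc_on S (\<lambda>x. INF i\<in>I. u i x)"
proof (rule usc_onI)
  fix x c assume x: "x \<in> S" and c: "(INF i\<in>I. u i x) < c"
  then obtain i where i: "i \<in> I" "u i x < c" by (auto simp: INF_less_iff)
  obtain d where "d > 0" "\<And>y. y \<in> S \<Longrightarrow> dist y x < d \<Longrightarrow> u i y < c"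
    using usc_onD[OF assms[OF i(1)] x i(2)] by blast
  then show "\<exists>d>0. \<forall>y\<in>S. dist y x < d \<longrightarrow> (INF i\<in>I. u i y) < c"
    using i(1) by (intro exI[of _ d]) (auto simp: INF_less_iff)
qed

lemma usc_on_max:
  fixes S :: "'a::metric_space set"
  assumes u: "usc_on S u" and v: "usc_on S v"
  shows "usc_on S (\<lambda>x. max (u x) (v x))"
proof (rule usc_onI)
  fix x c assume x: "x \<in> S" and c: "max (u x) (v x) < c"
  obtain d1 where d1: "d1 > 0" "\<And>y. y \<in> S \<Longrightarrow> dist y x < d1 \<Longrightarrow> u y < c" using usc_onD[OF u x] c by auto
  obtain d2 where d2: "d2 > 0" "\<And>y. y \<in> S \<Longrightarrow> dist y x < d2 \<Longrightarrow> v y < c" using usc_onD[OF v x] c by auto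
  show "\<exists>d>0. \<forall>y\<in>S. dist y x < d \<longrightarrow> max (u y) (v y) < c"
    by (intro exI[of _ "min d1 d2"]) (use d1 d2 in auto)
qed

lemma usc_on_measurable:
  fixes S :: "'a::metric_space set"
  assumes "usc_on S u"
  shows "u \<in> borel_measurable (restrict_space borel S)"
proof (rule borel_measurableI_less)
  fix c
  have "\<exists>U. open U \<and> {x\<in>S. u x < c} = U \<inter> S"
  proof -
    have "\<forall>x. x \<in> S \<and> u x < c \<longrightarrow> (\<exists>d>0. \<forall>y\<in>S. dist y x < d \<longrightarrow> u y < c)"
      using usc_onD[OF assms] by metis
    then obtain d where d: "\<And>x. x \<in> S \<Longrightarrow> u x < c \<Longrightarrow> d x > 0 \<and> (\<forall>y\<in>S. dist y x < d x \<longrightarrow> u y < c)"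
      by metis
    let ?U = "\<Union>x\<in>{x\<in>S. u x < c}. ball x (d x)"
    have "y \<in> ?U" if "y \<in> S" "u y < c" for y
      using d[OF that] that by (intro UN_I[of y]) auto
    moreover have "u y < c" if "y \<in> ?U" "y \<in> S" for y
    proof -
      obtain x where "x \<in> S" "u x < c" "dist y x < d x" using \<open>y \<in> ?U\<close> by (auto simp: dist_commute)
      then show ?thesis using d[of x] \<open>y \<in> S\<close> by simp
    qed
    ultimately have "{x\<in>S. u x < c} = ?U \<inter> S" by blast
    then show ?thesis by (intro exI[of _ ?U]) auto
  qed
  then obtain U where U: "open U" "{x\<in>S. u x < c} = U \<inter> S" by blast
  have "{x \<in> space (restrict_space borel S). u x < c} = S \<inter> U"
    using U(2) by (auto simp: space_restrict_space)
  then show "{x \<in> space (restrict_space borel S). u x < c} \<in> sets (restrict_space borel S)"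
    using U(1) by (auto simp: sets_restrict_space)
qed

lemma usc_on_compact_attains_sup:
  fixes S :: "'a::metric_space set"
  assumes "compact S" "S \<noteq> {}" and u: "usc_on S u"
  obtains x where "x \<in> S" "\<And>y. y \<in> S \<Longrightarrow> u y \<le> u x"
proof -
  have "\<exists>x\<in>S. \<forall>y\<in>S. u y \<le> u x"
  proof (rule ccontr)
    assume "\<not> ?thesis"
    then have "\<forall>x\<in>S. \<exists>y\<in>S. u x < u y" by (simp add: not_le)
    then obtain m where m: "\<And>x. x \<in> S \<Longrightarrow> m x \<in> S \<and> u x < u (m x)" by metis
    then have "\<forall>x\<in>S. \<exists>d>0. \<forall>y\<in>S. dist y x < d \<longrightarrow> u y < u (m x)"
      using usc_onD[OF u] by metis
    then obtain d where d: "\<And>x. x \<in> S \<Longrightarrow> d x > 0 \<and> (\<forall>y\<in>S. dist y x < d x \<longrightarrow> u y < u (m x))"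
      by metis
    have "S \<subseteq> (\<Union>x\<in>S. ball x (d x))" using d by force
    then obtain C where C: "C \<subseteq> S" "finite C" "S \<subseteq> (\<Union>x\<in>C. ball x (d x))"
      using compactE_image[OF \<open>compact S\<close>, of S "\<lambda>x. ball x (d x)"] by auto
    have "C \<noteq> {}" using C \<open>S \<noteq> {}\<close> by auto
    have "Max ((u \<circ> m) ` C) \<in> (u \<circ> m) ` C" using C \<open>C \<noteq> {}\<close> by (intro Max_in) auto
    then obtain z where z: "z \<in> C" "u (m z) = Max ((u \<circ> m) ` C)" by auto
    obtain x where x: "x \<in> C" "m z \<in> ball x (d x)" using m z C by blast
    have "m z \<in> S" "x \<in> S" "dist (m z) x < d x" using m z x C by (auto simp: dist_commute)
    then have "u (m z) < u (m x)" using d[of x] by simp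
    moreover have "u (m x) \<le> u (m z)" using z x C by simp
    ultimately show False by simp
  qed
  then show ?thesis using that by blast
qed

lemma usc_on_compact_bounded:
  fixes S :: "'a::metric_space set"
  assumes "compact S" and u: "usc_on S u" and "\<And>x. x \<in> S \<Longrightarrow> u x < \<infinity>"
  obtains M :: real where "\<And>x. x \<in> S \<Longrightarrow> u x \<le> ereal M"
proof (cases "S = {}")
  case False
  obtain x where x: "x \<in> S" "\<And>y. y \<in> S \<Longrightarrow> u y \<le> u x"
    using usc_on_compact_attains_sup[OF assms(1) False u] by blast
  show ?thesis
  proof (rule that[of "real_of_ereal (u x)"])
    fix y assume "y \<in> S"
    then show "u y \<le> ereal (real_of_ereal (u x))"
      using x(2)[of y] assms(3)[OF x(1)] by (cases "u x") auto
  qed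
qed (use that in auto)

section \<open>Polar coordinates\<close>

abbreviation ball_uniform :: "'a::euclidean_space measure" where
  "ball_uniform \<equiv> uniform_measure lborel (ball 0 1)"

text \<open>
  The law of the modulus of a uniformly distributed point of the unit ball. Together with
  \<^const>\<open>sphere_measure\<close>, the law of its direction, it gives polar coordinates without a density.
\<close>

definition radius_measure :: "'a::euclidean_space itself \<Rightarrow> real measure" where
  "radius_measure _ = distr (ball_uniform :: 'a measure) borel norm"

lemma nn_integral_lborel_affine:
  fixes f :: "'a::euclidean_space \<Rightarrow> ennreal"
  assumes "c \<noteq> 0" and [measurable]: "f \<in> borel_measurable borel"
  shows "(\<integral>\<^sup>+ x. f x \<partial>lborel) = ennreal (\<bar>c\<bar> ^ DIM('a)) * (\<integral>\<^sup>+ x. f (t + c *\<^sub>R x) \<partial>lborel)"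
  by (subst lborel_affine[OF assms(1), of t])
     (simp add: nn_integral_density nn_integral_distr nn_integral_cmult)

lemma emeasure_lborel_ball_pos: "0 < r \<Longrightarrow> emeasure lborel (ball (x::'a::euclidean_space) r) > 0"
  by (simp add: emeasure_ball ennreal_mult_less_top)

lemma emeasure_lborel_open_pos:
  fixes A :: "'a::euclidean_space set"
  assumes "open A" "A \<noteq> {}"
  shows "emeasure lborel A > 0"
proof -
  obtain x e where "e > 0" "ball x e \<subseteq> A" using assms by (metis ex_in_conv open_contains_ball)
  then show ?thesis using emeasure_lborel_ball_pos[of e x] emeasure_mono[of "ball x e" A lborel] assms
    by (auto intro: less_le_trans)
qed

lemma emeasure_ball_uniform_UNIV: "emeasure (ball_uniform :: 'a::euclidean_space measure) UNIV = 1"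
  using emeasure_lborel_ball_pos[of 1 "0::'a"] emeasure_lborel_ball_finite[of "0::'a" 1]
  by (subst emeasure_uniform_measure) (auto simp: ennreal_divide_self)

lemma finite_measure_ball_uniform: "finite_measure (ball_uniform :: 'a::euclidean_space measure)"
  by (rule finite_measureI) (use emeasure_ball_uniform_UNIV[where 'a='a] in auto)

lemma sets_sphere_measure[simp, measurable_cong]: "sets sphere_measure = sets borel"
  and space_sphere_measure[simp]: "space sphere_measure = UNIV"
  by (auto simp: sphere_measure_def)

lemma emeasure_sphere_measure_UNIV: "emeasure (sphere_measure :: 'a::euclidean_space measure) UNIV = 1"
  unfolding sphere_measure_def by (subst emeasure_distr) (simp_all add: emeasure_ball_uniform_UNIV)

lemma finite_measure_sphere_measure: "finite_measure (sphere_measure :: 'a::euclidean_space measure)"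
  by (rule finite_measureI) (use emeasure_sphere_measure_UNIV[where 'a='a] in auto)

lemma sets_radius_measure[simp, measurable_cong]: "sets (radius_measure T) = sets borel"
  and space_radius_measure[simp]: "space (radius_measure T) = UNIV"
  by (auto simp: radius_measure_def)

lemma emeasure_radius_measure_UNIV: "emeasure (radius_measure TYPE('a::euclidean_space)) UNIV = 1"
  unfolding radius_measure_def by (subst emeasure_distr) (simp_all add: emeasure_ball_uniform_UNIV)

lemma finite_measure_radius_measure: "finite_measure (radius_measure TYPE('a::euclidean_space))"
  by (rule finite_measureI) (use emeasure_radius_measure_UNIV[where 'a='a] in auto)

lemma AE_ball_uniform: "AE y in (ball_uniform :: 'a::euclidean_space measure). y \<noteq> 0 \<and> norm y < 1"
proof (rule AE_uniform_measureI)
  have "AE y in lborel. y \<noteq> (0::'a)" by (rule AE_lborel_singleton)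
  then show "AE y in lborel. y \<in> ball 0 1 \<longrightarrow> y \<noteq> (0::'a) \<and> norm y < 1" by eventually_elim auto
qed auto

lemma AE_sphere_measure: "AE z in (sphere_measure :: 'a::euclidean_space measure). z \<in> sphere 0 1"
  unfolding sphere_measure_def
  by (subst AE_distr_iff) (use AE_ball_uniform[where 'a='a] in \<open>auto simp: norm_sgn elim: eventually_mono\<close>)

lemma AE_radius_measure: "AE s in radius_measure TYPE('a::euclidean_space). 0 < s \<and> s < 1"
  unfolding radius_measure_def
  by (subst AE_distr_iff) (use AE_ball_uniform[where 'a='a] in \<open>auto elim: eventually_mono\<close>)

text \<open>
  The strictness in the maximum principle: an open half sphere is not negligible, because its cone
  contains a ball.
\<close>

lemma emeasure_sphere_halfspace_pos:
  fixes b :: "'a::euclidean_space"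
  assumes "b \<noteq> 0"
  shows "emeasure sphere_measure {z. z \<bullet> b > 0} > 0"
proof -
  have eq: "{y::'a. sgn y \<bullet> b > 0} = {y. y \<bullet> b > 0}"
    by (auto simp: sgn_div_norm zero_less_mult_iff)
  have "open (ball 0 1 \<inter> {y::'a. y \<bullet> b > 0})"
    by (intro open_Int open_ball open_Collect_less continuous_intros)
  moreover have "(1/2) *\<^sub>R sgn b \<in> ball 0 1 \<inter> {y::'a. y \<bullet> b > 0}"
    using assms by (auto simp: norm_sgn sgn_div_norm)
  ultimately have "emeasure lborel (ball 0 1 \<inter> {y::'a. y \<bullet> b > 0}) > 0"
    by (intro emeasure_lborel_open_pos) blast+
  moreover have "emeasure lborel (ball (0::'a) 1) \<noteq> \<infinity>"
    using emeasure_lborel_ball_finite[of "0::'a" 1] by simp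
  ultimately show ?thesis
    unfolding sphere_measure_def
    by (subst emeasure_distr) (simp_all add: vimage_def eq ennreal_zero_less_divide less_top)
qed

text \<open>
  The cone over \<open>E\<close> cut off at radius \<open>t\<close> is the dilation by \<open>t\<close> of the whole cone, and Lebesgue
  measure scales by \<open>t ^ DIM('a)\<close>. This product formula is what makes modulus and direction
  independent.
\<close>

lemma emeasure_cone_le:
  fixes E :: "'a::euclidean_space set"
  assumes [measurable]: "E \<in> sets borel" and t: "0 < t" "t \<le> 1"
  shows "emeasure ball_uniform {y. norm y \<le> t \<and> sgn y \<in> E} = ennreal (t ^ DIM('a)) * emeasure sphere_measure E"
proof -
  let ?B = "\<lambda>t. {y::'a. norm y \<le> t \<and> sgn y \<in> E}"
  have sph: "sphere (0::'a) 1 \<in> null_sets lborel"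
    using negligible_sphere[of "0::'a" 1] by (auto simp: negligible_iff_null_sets null_sets_completion_iff)
  have scale: "emeasure lborel (?B t) = ennreal (t ^ DIM('a)) * emeasure lborel (?B 1)" if "0 < t" for t
  proof -
    have "emeasure lborel (?B t) = (\<integral>\<^sup>+ y. indicator (?B t) y \<partial>lborel)" by simp
    also have "\<dots> = ennreal (\<bar>t\<bar> ^ DIM('a)) * (\<integral>\<^sup>+ y. indicator (?B t) (0 + t *\<^sub>R y) \<partial>lborel)"
      using that by (intro nn_integral_lborel_affine) auto
    also have "(\<lambda>y. indicator (?B t) (0 + t *\<^sub>R y) :: ennreal) = indicator (?B 1)"
      using that by (auto simp: fun_eq_iff indicator_def sgn_scaleR)
    finally show ?thesis using that by simp
  qed
  have eqv: "emeasure lborel (ball 0 1 \<inter> A) = emeasure lborel A" if "A \<in> sets borel" "A \<subseteq> cball 0 1" for A :: "'a set"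
  proof -
    have "emeasure lborel ((ball 0 1 \<inter> A) \<union> (sphere 0 1)) = emeasure lborel (ball 0 1 \<inter> A)"
      using that sph by (intro emeasure_Un_null_set) auto
    moreover have "emeasure lborel (A \<union> sphere 0 1) = emeasure lborel A"
      using that sph by (intro emeasure_Un_null_set) auto
    moreover have "(ball 0 1 \<inter> A) \<union> (sphere 0 1) = A \<union> sphere 0 1"
      using that by auto
    ultimately show ?thesis by simp
  qed
  have "?B t \<subseteq> cball 0 1" using t by auto
  then have 1: "emeasure ball_uniform (?B t) = emeasure lborel (?B t) / emeasure lborel (ball (0::'a) 1)"
    by (subst emeasure_uniform_measure) (simp_all add: eqv)
  have "emeasure sphere_measure E = emeasure ball_uniform (sgn -` E)"
    unfolding sphere_measure_def by (subst emeasure_distr) auto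
  also have "\<dots> = emeasure lborel (ball 0 1 \<inter> sgn -` E) / emeasure lborel (ball (0::'a) 1)"
    by (subst emeasure_uniform_measure) (auto intro!: measurable_sets_borel[OF borel_measurable_sgn])
  also have "ball 0 1 \<inter> sgn -` E = ball 0 1 \<inter> ?B 1" by auto
  also have "emeasure lborel \<dots> = emeasure lborel (?B 1)" by (rule eqv) auto
  finally show ?thesis using 1 t scale[OF t(1)] by (simp add: ennreal_times_divide)
qed

lemma emeasure_radius_atMost:
  assumes "0 < t" "t \<le> 1"
  shows "emeasure (radius_measure TYPE('a::euclidean_space)) {..t} = ennreal (t ^ DIM('a))"
proof -
  have "norm -` {..t} = {y::'a. norm y \<le> t \<and> sgn y \<in> UNIV}" by auto
  then show ?thesis unfolding radius_measure_def
    using emeasure_cone_le[of "UNIV :: 'a set" t] assms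
    by (subst emeasure_distr) (auto simp: emeasure_sphere_measure_UNIV)
qed

text \<open>
  Under the uniform distribution on the unit ball, modulus and direction are independent. For a
  fixed set \<open>E\<close> of directions, both sides are finite measures in the set of radii, so that it
  suffices to compare them on half lines, where \<open>emeasure_cone_le\<close> applies.
\<close>

lemma polar_product:
  "radius_measure TYPE('a) \<Otimes>\<^sub>M sphere_measure =
     distr (ball_uniform :: 'a::euclidean_space measure) (borel \<Otimes>\<^sub>M borel) (\<lambda>y. (norm y, sgn y))"
proof (rule pair_measure_eqI)
  note emeasure_uniform_measure[simp del]
  let ?\<nu> = "radius_measure TYPE('a)" and ?\<sigma> = "sphere_measure :: 'a measure" and ?\<mu> = "ball_uniform :: 'a measure"
  interpret R: finite_measure ?\<nu> by (rule finite_measure_radius_measure)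
  interpret S: finite_measure ?\<sigma> by (rule finite_measure_sphere_measure)
  interpret B: finite_measure ?\<mu> by (rule finite_measure_ball_uniform)
  show "sigma_finite_measure ?\<nu>" "sigma_finite_measure ?\<sigma>" by unfold_locales
  show "sets (?\<nu> \<Otimes>\<^sub>M ?\<sigma>) = sets (distr ?\<mu> (borel \<Otimes>\<^sub>M borel) (\<lambda>y. (norm y, sgn y)))"
    by (simp cong: sets_pair_measure_cong)
  fix A E assume A: "A \<in> sets ?\<nu>" and E: "E \<in> sets ?\<sigma>"
  have [measurable]: "A \<in> sets borel" "E \<in> sets borel" using A E by auto
  define M1 where "M1 = scale_measure (emeasure ?\<sigma> E) ?\<nu>"
  define M2 where "M2 = distr (restrict_space ?\<mu> (sgn -` E)) borel norm"
  have [measurable]: "sgn -` E \<in> sets (borel :: 'a measure)"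
    by (auto intro!: measurable_sets_borel[OF borel_measurable_sgn])
  have M2: "emeasure M2 X = emeasure ?\<mu> {y. norm y \<in> X \<and> sgn y \<in> E}" if [measurable]: "X \<in> sets borel" for X
  proof -
    have "norm -` X \<inter> space (restrict_space ?\<mu> (sgn -` E)) = {y. norm y \<in> X \<and> sgn y \<in> E}"
      by (auto simp: space_restrict_space)
    moreover have "norm \<in> measurable (restrict_space ?\<mu> (sgn -` E)) borel"
      by (rule measurable_restrict_space1) measurable
    ultimately show ?thesis unfolding M2_def
      by (subst emeasure_distr) (auto simp del: emeasure_uniform_measure intro!: emeasure_restrict_space)
  qed
  have total: "emeasure ?\<mu> {y. sgn y \<in> E} = emeasure ?\<sigma> E"
    unfolding sphere_measure_def by (subst emeasure_distr) (auto simp: vimage_def)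
  have "M1 = M2"
  proof (rule measure_eqI_lessThan)
    show "sets M1 = sets borel" "sets M2 = sets borel" by (auto simp: M1_def M2_def)
    fix t :: real
    show "emeasure M1 {t<..} < \<infinity>"
      by (simp add: M1_def ennreal_mult_less_top) (simp add: less_top[symmetric])
    have ball: "AE y in ?\<mu>. 0 < norm y \<and> norm y < 1" using AE_ball_uniform[where 'a='a] by eventually_elim auto
    consider "t \<le> 0" | "0 < t" "t < 1" | "t \<ge> 1" by linarith
    then show "emeasure M1 {t<..} = emeasure M2 {t<..}"
    proof cases
      case 1
      have "emeasure ?\<nu> {t<..} = emeasure ?\<nu> UNIV"
        by (rule emeasure_eq_AE, use AE_radius_measure[where 'a='a] in eventually_elim) (use 1 in auto)
      moreover have "emeasure ?\<mu> {y. norm y \<in> {t<..} \<and> sgn y \<in> E} = emeasure ?\<mu> {y. sgn y \<in> E}"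
        by (rule emeasure_eq_AE, use ball in eventually_elim) (use 1 in \<open>auto simp del: zero_less_norm_iff\<close>)
      ultimately show ?thesis using total by (simp add: M1_def M2 emeasure_radius_measure_UNIV)
    next
      case 3
      have "emeasure ?\<nu> {t<..} = emeasure ?\<nu> {}"
        by (rule emeasure_eq_AE, use AE_radius_measure[where 'a='a] in eventually_elim) (use 3 in auto)
      moreover have "emeasure ?\<mu> {y. norm y \<in> {t<..} \<and> sgn y \<in> E} = emeasure ?\<mu> {}"
        by (rule emeasure_eq_AE, use ball in eventually_elim) (use 3 in \<open>auto simp del: zero_less_norm_iff\<close>)
      ultimately show ?thesis by (simp add: M1_def M2)
    next
      case 2
      have "emeasure ?\<nu> {t<..} = emeasure ?\<nu> (UNIV - {..t})" by (rule arg_cong[where f="emeasure ?\<nu>"]) auto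
      also have "\<dots> = 1 - ennreal (t ^ DIM('a))"
        using 2 by (subst emeasure_Diff) (auto simp: emeasure_radius_measure_UNIV emeasure_radius_atMost)
      finally have \<nu>: "emeasure ?\<nu> {t<..} = 1 - ennreal (t ^ DIM('a))" .
      have "emeasure ?\<mu> {y. norm y \<in> {t<..} \<and> sgn y \<in> E} =
          emeasure ?\<mu> ({y. sgn y \<in> E} - {y. norm y \<le> t \<and> sgn y \<in> E})"
        by (rule arg_cong[where f="emeasure ?\<mu>"]) auto
      also have "\<dots> = emeasure ?\<sigma> E - ennreal (t ^ DIM('a)) * emeasure ?\<sigma> E"
        using 2 by (subst emeasure_Diff) (auto simp: total emeasure_cone_le ennreal_mult_eq_top_iff)
      also have "\<dots> = emeasure ?\<sigma> E * (1 - ennreal (t ^ DIM('a)))"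
        by (subst ennreal_right_diff_distrib) (auto simp: mult.commute)
      finally show ?thesis by (simp add: M1_def M2 \<nu>)
    qed
  qed
  then have "emeasure M1 A = emeasure M2 A" by simp
  then show "emeasure ?\<nu> A * emeasure ?\<sigma> E = emeasure (distr ?\<mu> (borel \<Otimes>\<^sub>M borel) (\<lambda>y. (norm y, sgn y))) (A \<times> E)"
    by (subst emeasure_distr) (auto simp: M1_def M2 vimage_def mult.commute)
qed

lemma nn_integral_polar:
  fixes f :: "'a::euclidean_space \<Rightarrow> ennreal"
  assumes [measurable]: "f \<in> borel_measurable borel"
  shows "(\<integral>\<^sup>+ y. f y \<partial>ball_uniform) =
    (\<integral>\<^sup>+ s. \<integral>\<^sup>+ z. f (s *\<^sub>R z) \<partial>sphere_measure \<partial>radius_measure TYPE('a))"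
proof -
  interpret S: finite_measure "sphere_measure :: 'a measure" by (rule finite_measure_sphere_measure)
  have "(\<integral>\<^sup>+ s. \<integral>\<^sup>+ z. f (s *\<^sub>R z) \<partial>sphere_measure \<partial>radius_measure TYPE('a)) =
      (\<integral>\<^sup>+ p. f (fst p *\<^sub>R snd p) \<partial>(radius_measure TYPE('a) \<Otimes>\<^sub>M sphere_measure))"
    by (subst S.nn_integral_fst[symmetric]) auto
  also have "\<dots> = (\<integral>\<^sup>+ y. f (norm y *\<^sub>R sgn y) \<partial>ball_uniform)"
    by (subst polar_product, subst nn_integral_distr) auto
  also have "(\<lambda>y. f (norm y *\<^sub>R sgn y)) = f"
    by (rule ext, case_tac "y = 0") (simp_all add: sgn_div_norm)
  finally show ?thesis by simp
qed

lemma integral_polar: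
  fixes f :: "'a::euclidean_space \<Rightarrow> real"
  assumes int: "integrable ball_uniform f"
  shows "(\<integral> y. f y \<partial>ball_uniform) =
    (\<integral> s. \<integral> z. f (s *\<^sub>R z) \<partial>sphere_measure \<partial>radius_measure TYPE('a))"
proof -
  have [measurable]: "f \<in> borel_measurable borel" using int by (simp add: borel_measurable_integrable cong: measurable_cong_sets)
  interpret S: finite_measure "sphere_measure :: 'a measure" by (rule finite_measure_sphere_measure)
  interpret R: finite_measure "radius_measure TYPE('a)" by (rule finite_measure_radius_measure)
  interpret P: pair_sigma_finite "radius_measure TYPE('a)" "sphere_measure :: 'a measure" ..
  \<comment> \<open>At \<open>y = 0\<close> both sides are \<open>0\<close>, because \<open>sgn 0 = 0\<close>.\<close>
  have norm_sgn_eq: "norm y *\<^sub>R sgn y = y" for y :: 'a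
    by (cases "y = 0") (simp_all add: sgn_div_norm)
  have i: "integrable (radius_measure TYPE('a) \<Otimes>\<^sub>M sphere_measure) (\<lambda>p. f (fst p *\<^sub>R snd p))"
    using int by (subst polar_product, subst integrable_distr_eq) (auto simp: norm_sgn_eq)
  have "(\<integral> s. \<integral> z. f (s *\<^sub>R z) \<partial>sphere_measure \<partial>radius_measure TYPE('a)) =
      (\<integral> p. f (fst p *\<^sub>R snd p) \<partial>(radius_measure TYPE('a) \<Otimes>\<^sub>M sphere_measure))"
    using P.integral_fst'[OF i] by simp
  also have "\<dots> = (\<integral> y. f (norm y *\<^sub>R sgn y) \<partial>ball_uniform)"
    by (subst polar_product, subst integral_distr) auto
  finally show ?thesis by (simp add: norm_sgn_eq)
qed

lemma emeasure_radius_interval_pos: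
  assumes "0 \<le> a" "a < b" "b \<le> 1"
  shows "emeasure (radius_measure TYPE('a::euclidean_space)) {a<..<b} > 0"
proof -
  let ?\<nu> = "radius_measure TYPE('a)"
  interpret R: finite_measure ?\<nu> by (rule finite_measure_radius_measure)
  define p where "p = (2*a + b)/3" define q where "q = (a + 2*b)/3"
  have pq: "0 < p" "a < p" "p < q" "q < b" "q \<le> 1" "p \<le> 1" using assms by (auto simp: p_def q_def)
  have "emeasure ?\<nu> ({..q} - {..p}) = ennreal (q ^ DIM('a)) - ennreal (p ^ DIM('a))"
    using pq R.emeasure_finite by (subst emeasure_Diff) (auto simp: emeasure_radius_atMost)
  also have "\<dots> > 0" using pq by (simp add: power_strict_mono diff_gr0_ennreal ennreal_lessI)
  finally have "0 < emeasure ?\<nu> ({..q} - {..p})" .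
  also have "\<dots> \<le> emeasure ?\<nu> {a<..<b}" by (rule emeasure_mono) (use pq in auto)
  finally show ?thesis .
qed

lemma nn_integral_ball_uniform:
  fixes f :: "'a::euclidean_space \<Rightarrow> ennreal"
  assumes "0 < r" and [measurable]: "f \<in> borel_measurable borel"
  shows "(\<integral>\<^sup>+ y. f y * indicator (ball x r) y \<partial>lborel) =
     emeasure lborel (ball x r) * (\<integral>\<^sup>+ y. f (x + r *\<^sub>R y) \<partial>ball_uniform)"
proof -
  have v: "emeasure lborel (ball (0::'a) 1) \<noteq> 0" "emeasure lborel (ball (0::'a) 1) \<noteq> \<infinity>"
    using emeasure_lborel_ball_pos[of 1 "0::'a"] emeasure_lborel_ball_finite[of "0::'a" 1] by auto
  have "(\<integral>\<^sup>+ y. f y * indicator (ball x r) y \<partial>lborel) =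
      ennreal (r ^ DIM('a)) * (\<integral>\<^sup>+ y. f (x + r *\<^sub>R y) * indicator (ball x r) (x + r *\<^sub>R y) \<partial>lborel)"
    using assms(1) by (subst nn_integral_lborel_affine[of r "\<lambda>y. f y * indicator (ball x r) y" x])
      (auto intro!: borel_measurable_times_ennreal borel_measurable_indicator)
  also have "(\<lambda>y. f (x + r *\<^sub>R y) * indicator (ball x r) (x + r *\<^sub>R y)) = (\<lambda>y. f (x + r *\<^sub>R y) * indicator (ball 0 1) y)"
    using assms(1) by (auto simp: fun_eq_iff indicator_def dist_norm)
  also have "(\<integral>\<^sup>+ y. f (x + r *\<^sub>R y) * indicator (ball 0 1) y \<partial>lborel) =
      emeasure lborel (ball (0::'a) 1) * (\<integral>\<^sup>+ y. f (x + r *\<^sub>R y) \<partial>ball_uniform)"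
    using v by (subst nn_integral_uniform_measure) (auto simp: ennreal_times_divide mult.commute[of "emeasure _ _"] ennreal_mult_divide_eq)
  also have "ennreal (r ^ DIM('a)) * (emeasure lborel (ball (0::'a) 1) * (\<integral>\<^sup>+ y. f (x + r *\<^sub>R y) \<partial>ball_uniform))
     = emeasure lborel (ball x r) * (\<integral>\<^sup>+ y. f (x + r *\<^sub>R y) \<partial>ball_uniform)"
    using assms(1) by (simp add: emeasure_ball ennreal_mult' mult_ac)
  finally show ?thesis .
qed

section \<open>Spherical means and the maximum principle\<close>

text \<open>
  The mean of \<open>M - u\<close> over a sphere. For \<open>u \<le> M\<close> this is an integral of a nonnegative function, so
  that monotone convergence, Fatou's lemma and Tonelli's theorem apply without integrability
  conditions; the spherical mean of \<open>u\<close> is recovered as \<open>M\<close> minus this number.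
\<close>

definition sphere_deficit :: "real \<Rightarrow> ('a::euclidean_space \<Rightarrow> ereal) \<Rightarrow> 'a \<Rightarrow> real \<Rightarrow> ennreal" where
  "sphere_deficit M u x r = (\<integral>\<^sup>+z\<in>sphere 0 1. e2ennreal (ereal M - u (x + r *\<^sub>R z)) \<partial>sphere_measure)"

lemma e2ennreal_diff_add:
  assumes "t \<le> ereal M" "s \<le> ereal N"
  shows "e2ennreal (ereal (M + N) - (t + s)) = e2ennreal (ereal M - t) + e2ennreal (ereal N - s)"
proof (cases t)
  case t: (real a)
  show ?thesis
  proof (cases s)
    case (real b)
    have "ennreal (M + N - (a + b)) = ennreal ((M - a) + (N - b))" by (simp add: algebra_simps)
    also have "\<dots> = ennreal (M - a) + ennreal (N - b)" using assms t real by (intro ennreal_plus) auto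
    finally show ?thesis using t real by (simp add: ereal_minus)
  qed (use assms t in auto)
next
  case MInf
  then show ?thesis using assms by (cases s) (auto simp: e2ennreal_infty)
qed (use assms in auto)

lemma le_ereal_diff_iff:
  assumes "t \<le> ereal M"
  shows "t \<le> ereal M - enn2ereal D \<longleftrightarrow> D \<le> e2ennreal (ereal M - t)"
proof (cases t)
  case t: (real a)
  show ?thesis
  proof (cases D)
    case (real d)
    then show ?thesis using assms t by (auto simp: enn2ereal_ennreal ereal_minus ennreal_le_iff)
  qed (use t in \<open>auto simp: top_unique ereal_minus\<close>)
next
  case MInf
  then show ?thesis by (auto simp: e2ennreal_infty)
qed (use assms in auto)

lemma measurable_on_sphere:
  fixes u :: "'a::euclidean_space \<Rightarrow> ereal"
  assumes u: "usc_on K u" "sphere x r \<subseteq> K" "0 < r" and g: "g \<in> borel_measurable borel"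
  shows "(\<lambda>z. (g (u (x + r *\<^sub>R z)) :: ennreal) * indicator (sphere 0 1) z) \<in> borel_measurable borel"
proof -
  have "u \<in> borel_measurable (restrict_space borel (sphere x r))"
    using usc_on_measurable usc_on_subset u by blast
  moreover have "(\<lambda>z. x + r *\<^sub>R z) \<in> measurable (restrict_space borel (sphere 0 1)) (restrict_space borel (sphere x r))"
    by (rule measurable_restrict_space2)
       (use u(3) in \<open>auto simp: space_restrict_space dist_norm intro!: measurable_restrict_space1\<close>)
  ultimately have "(\<lambda>z. u (x + r *\<^sub>R z)) \<in> borel_measurable (restrict_space borel (sphere 0 1))"
    by (rule measurable_compose[rotated])
  then have "(\<lambda>z. g (u (x + r *\<^sub>R z))) \<in> borel_measurable (restrict_space borel (sphere 0 1))"
    using g by (rule measurable_compose)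
  then show ?thesis by (subst (asm) borel_measurable_restrict_space_iff_ennreal) auto
qed

lemma emeasure_sphere_measure_sphere: "emeasure sphere_measure (sphere (0::'a::euclidean_space) 1) = 1"
proof -
  have "emeasure sphere_measure (sphere (0::'a) 1) = emeasure sphere_measure (UNIV :: 'a set)"
    by (rule emeasure_eq_AE) (use AE_sphere_measure[where 'a='a] in auto)
  then show ?thesis by (simp add: emeasure_sphere_measure_UNIV)
qed

lemma nn_integral_sphere_const:
  "(\<integral>\<^sup>+z. c * indicator (sphere 0 1) z \<partial>(sphere_measure :: 'a::euclidean_space measure)) = c"
  by (simp add: nn_integral_cmult_indicator emeasure_sphere_measure_sphere)

text \<open>
  Integrate the identity \<open>u\<^sup>+ + (M - u) + M\<^sup>- = u\<^sup>- + M\<^sup>+\<close>. All of its terms are nonnegative and the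
  integral of \<open>u\<^sup>+\<close> is finite, so that the integrals may be rearranged afterwards.
\<close>

lemma spherical_mean_eq_deficit:
  fixes u :: "'a::euclidean_space \<Rightarrow> ereal"
  assumes u: "usc_on K u" "sphere x r \<subseteq> K" "0 < r" and le: "\<And>y. y \<in> sphere x r \<Longrightarrow> u y \<le> ereal M"
  shows "spherical_mean u x r = ereal M - enn2ereal (sphere_deficit M u x r)"
proof -
  let ?s = "sphere_measure :: 'a measure"
  let ?I = "\<lambda>z. indicator (sphere (0::'a) 1) z :: ennreal"
  define P where "P = (\<integral>\<^sup>+z. e2ennreal (u (x + r *\<^sub>R z)) * ?I z \<partial>?s)"
  define N where "N = (\<integral>\<^sup>+z. e2ennreal (- u (x + r *\<^sub>R z)) * ?I z \<partial>?s)"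
  define C where "C = (\<integral>\<^sup>+z. e2ennreal (ereal M - u (x + r *\<^sub>R z)) * ?I z \<partial>?s)"
  define f1 f2 f3 where f_def: "f1 z = e2ennreal (u (x + r *\<^sub>R z)) * ?I z"
    "f2 z = e2ennreal (ereal M - u (x + r *\<^sub>R z)) * ?I z" "f3 z = e2ennreal (- u (x + r *\<^sub>R z)) * ?I z" for z
  have [measurable]: "f1 \<in> borel_measurable borel" "f2 \<in> borel_measurable borel" "f3 \<in> borel_measurable borel"
    unfolding f_def[abs_def] by (rule measurable_on_sphere[OF u]; measurable)+
  have [measurable]: "sphere (0::'a) 1 \<in> sets borel" by simp
  have PCN: "P = (\<integral>\<^sup>+z. f1 z \<partial>?s)" "C = (\<integral>\<^sup>+z. f2 z \<partial>?s)"
    "N = (\<integral>\<^sup>+z. f3 z \<partial>?s)"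
    by (simp_all add: P_def C_def N_def f_def)
  have in_sphere: "x + r *\<^sub>R z \<in> sphere x r" if "z \<in> sphere 0 1" for z
    using that u(3) by (simp add: dist_norm)
  have pw: "e2ennreal t + e2ennreal (ereal M - t) + ennreal (- M) = e2ennreal (- t) + ennreal M" if "t \<le> ereal M" for t
  proof (cases t)
    case (real a)
    then have "a \<le> M" using that by simp
    then show ?thesis using real
      by (cases "0 \<le> a"; cases "0 \<le> M")
         (auto simp: ereal_minus ennreal_neg ennreal_plus[symmetric] simp del: ennreal_plus)
  qed (use that in \<open>auto simp: e2ennreal_infty\<close>)
  have "P + C + ennreal (- M) = (\<integral>\<^sup>+z. f1 z + f2 z + ennreal (- M) * ?I z \<partial>?s)"
    by (simp add: PCN nn_integral_add nn_integral_sphere_const)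
  also have "\<dots> = (\<integral>\<^sup>+z. f3 z + ennreal M * ?I z \<partial>?s)"
    by (rule nn_integral_cong) (use pw le in_sphere in \<open>auto simp: f_def indicator_def\<close>)
  also have "\<dots> = N + ennreal M"
    by (simp add: PCN nn_integral_add nn_integral_sphere_const)
  finally have eq: "P + C + ennreal (- M) = N + ennreal M" .
  have "P \<le> (\<integral>\<^sup>+z. ennreal M * ?I z \<partial>?s)"
    unfolding P_def
    by (rule nn_integral_mono) (use le in_sphere in \<open>auto simp: indicator_def simp flip: e2ennreal_ereal intro!: e2ennreal_mono\<close>)
  then have P: "P \<le> ennreal M" by (simp add: nn_integral_sphere_const)
  then have "P \<noteq> top" by (auto simp: top_unique)
  then obtain p where p: "P = ennreal p" "0 \<le> p" by (cases P) auto
  have "enn2ereal P - enn2ereal N = ereal M - enn2ereal C"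
  proof (cases C)
    case (real c)
    then have "N \<noteq> top" using eq p by (auto simp: ennreal_add_eq_top)
    then obtain n where n: "N = ennreal n" "0 \<le> n" by (cases N) auto
    have "p + c + max 0 (- M) = n + max 0 M"
    proof -
      have "ennreal (p + c + max 0 (- M)) = ennreal (n + max 0 M)"
        using eq p n real by (simp add: ennreal_plus max_def split: if_splits) (auto simp: ennreal_neg)
      then show ?thesis using p n real by (subst (asm) ennreal_inj) auto
    qed
    then show ?thesis using p n real by (auto simp: enn2ereal_ennreal max_def split: if_splits)
  next
    case top
    then have "N + ennreal M = top" using eq by simp
    then have "N = top" by (metis ennreal_add_eq_top ennreal_neq_top)
    then show ?thesis using p top by (simp add: enn2ereal_ennreal)
  qed
  then show ?thesis unfolding spherical_mean_def P_def N_def C_def sphere_deficit_def .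
qed

lemma submean_iff_deficit:
  fixes u :: "'a::euclidean_space \<Rightarrow> ereal"
  assumes u: "usc_on K u" "cball x r \<subseteq> K" "0 < r" and le: "\<And>y. y \<in> cball x r \<Longrightarrow> u y \<le> ereal M"
  shows "u x \<le> spherical_mean u x r \<longleftrightarrow> sphere_deficit M u x r \<le> e2ennreal (ereal M - u x)"
proof -
  have "sphere x r \<subseteq> K" using u by auto
  moreover have "\<And>y. y \<in> sphere x r \<Longrightarrow> u y \<le> ereal M" using le by auto
  ultimately have "spherical_mean u x r = ereal M - enn2ereal (sphere_deficit M u x r)"
    using spherical_mean_eq_deficit[OF u(1) _ u(3)] by blast
  moreover have "u x \<le> ereal M" using le[of x] u by simp
  ultimately show ?thesis by (simp add: le_ereal_diff_iff)
qed

lemma spherical_mean_mono: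
  fixes u :: "'a::euclidean_space \<Rightarrow> ereal"
  assumes "0 < r" "\<And>y. y \<in> sphere x r \<Longrightarrow> u y \<le> v y"
  shows "spherical_mean u x r \<le> spherical_mean v x r"
  unfolding spherical_mean_def
proof (rule ereal_minus_mono)
  have in_sphere: "x + r *\<^sub>R z \<in> sphere x r" if "z \<in> sphere 0 1" for z
    using that assms(1) by (simp add: dist_norm)
  show "enn2ereal (\<integral>\<^sup>+z\<in>sphere 0 1. e2ennreal (u (x + r *\<^sub>R z)) \<partial>sphere_measure)
      \<le> enn2ereal (\<integral>\<^sup>+z\<in>sphere 0 1. e2ennreal (v (x + r *\<^sub>R z)) \<partial>sphere_measure)"
    using assms(2)[OF in_sphere]
    by (auto simp flip: less_eq_ennreal.rep_eq simp: indicator_def intro!: nn_integral_mono e2ennreal_mono)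
  show "enn2ereal (\<integral>\<^sup>+z\<in>sphere 0 1. e2ennreal (- v (x + r *\<^sub>R z)) \<partial>sphere_measure)
      \<le> enn2ereal (\<integral>\<^sup>+z\<in>sphere 0 1. e2ennreal (- u (x + r *\<^sub>R z)) \<partial>sphere_measure)"
    using assms(2)[OF in_sphere]
    by (auto simp flip: less_eq_ennreal.rep_eq simp: indicator_def intro!: nn_integral_mono e2ennreal_mono)
qed

lemma submean_max:
  fixes u :: "'a::euclidean_space \<Rightarrow> ereal"
  assumes "0 < r" "u x \<le> spherical_mean u x r" "v x \<le> spherical_mean v x r"
  shows "max (u x) (v x) \<le> spherical_mean (\<lambda>y. max (u y) (v y)) x r"
proof (rule max.boundedI)
  show "u x \<le> spherical_mean (\<lambda>y. max (u y) (v y)) x r"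
    using assms(2) by (rule order_trans) (rule spherical_mean_mono[OF assms(1)], simp)
  show "v x \<le> spherical_mean (\<lambda>y. max (u y) (v y)) x r"
    using assms(3) by (rule order_trans) (rule spherical_mean_mono[OF assms(1)], simp)
qed

lemma submean_add:
  fixes u :: "'a::euclidean_space \<Rightarrow> ereal"
  assumes u: "usc_on (cball x r) u" "\<And>y. y \<in> cball x r \<Longrightarrow> u y < \<infinity>" "u x \<le> spherical_mean u x r"
    and v: "usc_on (cball x r) v" "\<And>y. y \<in> cball x r \<Longrightarrow> v y < \<infinity>" "v x \<le> spherical_mean v x r"
    and r: "0 < r"
  shows "u x + v x \<le> spherical_mean (\<lambda>y. u y + v y) x r"
proof -
  obtain M where M: "\<And>y. y \<in> cball x r \<Longrightarrow> u y \<le> ereal M"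
    using usc_on_compact_bounded[OF compact_cball u(1,2)] by blast
  obtain N where N: "\<And>y. y \<in> cball x r \<Longrightarrow> v y \<le> ereal N"
    using usc_on_compact_bounded[OF compact_cball v(1,2)] by blast
  have MN: "u y + v y \<le> ereal (M + N)" if "y \<in> cball x r" for y
    using add_mono[OF M[OF that] N[OF that]] by simp
  have in_sphere: "x + r *\<^sub>R z \<in> cball x r" if "z \<in> sphere 0 1" for z
    using that r by (simp add: dist_norm)
  have sub: "sphere x r \<subseteq> cball x r" and x: "x \<in> cball x r" using r by auto
  have [measurable]: "(\<lambda>z. e2ennreal (ereal M - u (x + r *\<^sub>R z)) * indicator (sphere 0 1) z) \<in> borel_measurable borel"
    by (rule measurable_on_sphere[OF u(1) sub r]) measurable
  have [measurable]: "(\<lambda>z. e2ennreal (ereal N - v (x + r *\<^sub>R z)) * indicator (sphere 0 1) z) \<in> borel_measurable borel"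
    by (rule measurable_on_sphere[OF v(1) sub r]) measurable
  have "sphere_deficit (M + N) (\<lambda>y. u y + v y) x r = sphere_deficit M u x r + sphere_deficit N v x r"
    unfolding sphere_deficit_def
    by (subst nn_integral_add[symmetric], measurable, rule nn_integral_cong)
       (use M N in_sphere in \<open>auto simp: indicator_def e2ennreal_diff_add\<close>)
  also have "\<dots> \<le> e2ennreal (ereal M - u x) + e2ennreal (ereal N - v x)"
    using submean_iff_deficit[OF u(1) order_refl r M] submean_iff_deficit[OF v(1) order_refl r N] u(3) v(3)
    by (intro add_mono) auto
  also have "\<dots> = e2ennreal (ereal (M + N) - (u x + v x))"
    using M[OF x] N[OF x] by (simp add: e2ennreal_diff_add)
  finally show ?thesis
    using submean_iff_deficit[OF usc_on_add[OF u(1) v(1) u(2) v(2)] order_refl r MN] by simp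
qed

abbreviation sphere_integral :: "('a::euclidean_space \<Rightarrow> real) \<Rightarrow> 'a \<Rightarrow> real \<Rightarrow> real" where
  "sphere_integral h x r \<equiv> LINT z:sphere 0 1|sphere_measure. h (x + r *\<^sub>R z)"

text \<open>
  Harmonicity up to the boundary, expressed by the property that survives uniform limits. All
  spheres in \<open>K\<close> are included, also one that touches the boundary: for a ball \<open>K\<close> this gives the
  value at the centre as the mean of the boundary values.
\<close>

definition mean_value_on :: "'a::euclidean_space set \<Rightarrow> ('a \<Rightarrow> real) \<Rightarrow> bool" where
  "mean_value_on K h \<longleftrightarrow> continuous_on K h \<and>
     (\<forall>x r. 0 < r \<longrightarrow> cball x r \<subseteq> K \<longrightarrow> (sphere_integral h x r) = h x)"

lemma set_integrable_sphere:
  fixes h :: "'a::euclidean_space \<Rightarrow> real"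
  assumes "continuous_on (sphere x r) h" "0 < r"
  shows "set_integrable sphere_measure (sphere 0 1) (\<lambda>z. h (x + r *\<^sub>R z))"
proof -
  interpret S: finite_measure "sphere_measure :: 'a measure" by (rule finite_measure_sphere_measure)
  have c: "continuous_on (sphere 0 1) (\<lambda>z. h (x + r *\<^sub>R z))"
    by (rule continuous_on_compose2[OF assms(1)]) (use assms(2) in \<open>auto intro!: continuous_intros simp: dist_norm\<close>)
  have "bounded ((\<lambda>z. h (x + r *\<^sub>R z)) ` sphere 0 1)"
    by (rule compact_imp_bounded[OF compact_continuous_image[OF c compact_sphere]])
  then obtain B where B: "\<And>z. z \<in> sphere 0 1 \<Longrightarrow> norm (h (x + r *\<^sub>R z)) \<le> B"
    unfolding bounded_iff by blast
  have "(\<lambda>z. indicator (sphere 0 1) z *\<^sub>R h (x + r *\<^sub>R z)) \<in> borel_measurable borel"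
    by (rule borel_measurable_continuous_on_indicator[OF _ c]) auto
  then show ?thesis unfolding set_integrable_def
    using B by (intro S.integrable_const_bound[of _ "max 0 B"])
      (auto simp: indicator_def max.coboundedI2 intro!: AE_I2)
qed

lemma set_integral_sphere_const:
  "(LINT z:sphere 0 1|(sphere_measure :: 'a::euclidean_space measure). (c::real)) = c"
  by (subst set_integral_const)
     (auto simp: emeasure_sphere_measure_sphere measure_def)

lemma sphere_deficit_continuous:
  fixes h :: "'a::euclidean_space \<Rightarrow> real"
  assumes "continuous_on (sphere x r) h" "0 < r" "\<And>y. y \<in> sphere x r \<Longrightarrow> h y \<le> M"
  shows "sphere_deficit M (\<lambda>y. ereal (h y)) x r = ennreal (M - (sphere_integral h x r))"
    and "(sphere_integral h x r) \<le> M"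
proof -
  let ?s = "sphere_measure :: 'a measure"
  have in_sphere: "x + r *\<^sub>R z \<in> sphere x r" if "z \<in> sphere 0 1" for z
    using that assms(2) by (simp add: dist_norm)
  have "continuous_on (sphere x r) (\<lambda>y. M - h y)" using assms(1) by (intro continuous_intros)
  then have i: "set_integrable ?s (sphere 0 1) (\<lambda>z. M - h (x + r *\<^sub>R z))"
    using set_integrable_sphere assms(2) by blast
  have eq: "(LINT z:sphere 0 1|?s. M - h (x + r *\<^sub>R z)) = M - (LINT z:sphere 0 1|?s. h (x + r *\<^sub>R z))"
    using set_integrable_sphere[OF assms(1,2)] set_integrable_sphere[of x r "\<lambda>_. M"] assms(2)
    by (subst set_integral_diff) (auto simp: set_integral_sphere_const)
  have "sphere_deficit M (\<lambda>y. ereal (h y)) x r = (\<integral>\<^sup>+z. ennreal (indicator (sphere 0 1) z *\<^sub>R (M - h (x + r *\<^sub>R z))) \<partial>?s)"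
    unfolding sphere_deficit_def by (rule nn_integral_cong) (auto simp: indicator_def ereal_minus)
  also have "\<dots> = ennreal (LINT z:sphere 0 1|?s. M - h (x + r *\<^sub>R z))"
    unfolding set_lebesgue_integral_def
    by (rule nn_integral_eq_integral) (use i assms(3) in_sphere in \<open>auto simp: set_integrable_def indicator_def\<close>)
  finally show "sphere_deficit M (\<lambda>y. ereal (h y)) x r = ennreal (M - (sphere_integral h x r))"
    using eq by simp
  have "0 \<le> (LINT z:sphere 0 1|?s. M - h (x + r *\<^sub>R z))"
    unfolding set_lebesgue_integral_def
    by (rule integral_nonneg_AE) (use assms(3) in_sphere in \<open>auto simp: indicator_def\<close>)
  then show "(sphere_integral h x r) \<le> M" using eq by simp
qed

lemma spherical_mean_continuous:
  fixes h :: "'a::euclidean_space \<Rightarrow> real"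
  assumes h: "continuous_on (sphere x r) h" "0 < r"
  shows "spherical_mean (\<lambda>y. ereal (h y)) x r = ereal (sphere_integral h x r)"
proof -
  have "bounded (h ` sphere x r)"
    by (rule compact_imp_bounded[OF compact_continuous_image[OF h(1) compact_sphere]])
  then obtain M where M: "\<And>y. y \<in> sphere x r \<Longrightarrow> h y \<le> M"
    unfolding bounded_iff by (metis abs_le_D1 imageI real_norm_def)
  show ?thesis
    using spherical_mean_eq_deficit[OF usc_on_continuous[OF h(1)] order_refl h(2), of M] M
      sphere_deficit_continuous[OF h, of M]
    by (auto simp: enn2ereal_ennreal)
qed

lemma mean_value_on_spherical_mean:
  assumes "mean_value_on K h" "0 < r" "cball x r \<subseteq> K"
  shows "spherical_mean (\<lambda>y. ereal (h y)) x r = ereal (h x)"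
  using assms spherical_mean_continuous[of x r h] sphere_cball[of x r]
  unfolding mean_value_on_def by (metis continuous_on_subset order_trans)

lemma mean_value_on_linear:
  fixes h g :: "'a::euclidean_space \<Rightarrow> real"
  assumes h: "mean_value_on K h" and g: "mean_value_on K g"
  shows "mean_value_on K (\<lambda>x. a * h x + b * g x)"
  unfolding mean_value_on_def
proof (intro conjI allI impI)
  show "continuous_on K (\<lambda>x. a * h x + b * g x)"
    using assms by (auto simp: mean_value_on_def intro!: continuous_intros)
  fix x :: 'a and r :: real assume r: "0 < r" "cball x r \<subseteq> K"
  have "continuous_on (sphere x r) h" "continuous_on (sphere x r) g"
    using order_trans[OF sphere_cball r(2)] assms unfolding mean_value_on_def
    by (blast intro: continuous_on_subset)+
  then have "set_integrable sphere_measure (sphere 0 1) (\<lambda>z. h (x + r *\<^sub>R z))"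
    "set_integrable sphere_measure (sphere 0 1) (\<lambda>z. g (x + r *\<^sub>R z))"
    using set_integrable_sphere r(1) by blast+
  then show "(LINT z:sphere 0 1|sphere_measure. a * h (x + r *\<^sub>R z) + b * g (x + r *\<^sub>R z)) = a * h x + b * g x"
    using h g r by (subst set_integral_add) (auto simp: mean_value_on_def)
qed

lemma mean_value_on_uminus: "mean_value_on K h \<Longrightarrow> mean_value_on K (\<lambda>x. - h x)"
  using mean_value_on_linear[of K h h "-1" 0] by simp

text \<open>
  Among the points where the maximum is attained, take one that is extremal in a fixed direction
  \<open>b\<close>. If it were interior, a small sphere around it would carry the value of the maximum in the
  mean, hence almost everywhere; but half of this sphere lies strictly further in the direction
  \<open>b\<close>, and that half has positive measure. One sphere per point suffices for this, so that the
  principle applies to functions that are known to be subharmonic only locally.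
\<close>

lemma submean_maximum_principle:
  fixes u :: "'a::euclidean_space \<Rightarrow> ereal"
  assumes u: "usc_on (cball a R) u" "\<And>x. x \<in> cball a R \<Longrightarrow> u x < \<infinity>"
    and sub: "\<And>x. x \<in> ball a R \<Longrightarrow> \<exists>r>0. cball x r \<subseteq> cball a R \<and> u x \<le> spherical_mean u x r"
    and bd: "\<And>x. x \<in> sphere a R \<Longrightarrow> u x \<le> c"
    and y: "y \<in> cball a R"
  shows "u y \<le> c"
proof (rule ccontr)
  assume "\<not> u y \<le> c"
  obtain x0 where x0: "x0 \<in> cball a R" "\<And>x. x \<in> cball a R \<Longrightarrow> u x \<le> u x0"
    using usc_on_compact_attains_sup[OF compact_cball _ u(1)] y by blast
  have "c < u x0" using \<open>\<not> u y \<le> c\<close> x0(2)[OF y] by auto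
  then obtain m where m: "u x0 = ereal m" using u(2)[OF x0(1)] by (cases "u x0") auto
  obtain b :: 'a where b: "b \<in> Basis" using nonempty_Basis by blast
  define N where "N = {x \<in> cball a R. u x0 \<le> u x}"
  have "closed N"
  proof -
    have "open (- N)"
      unfolding open_contains_ball
    proof
      fix x assume "x \<in> - N"
      show "\<exists>e>0. ball x e \<subseteq> - N"
      proof (cases "x \<in> cball a R")
        case False
        then have "x \<in> - cball a R" by simp
        then obtain e where "e > 0" "ball x e \<subseteq> - cball a R"
          by (meson closed_cball open_Compl open_contains_ball)
        then show ?thesis by (intro exI[of _ e]) (auto simp: N_def)
      next
        case True
        then have "u x < u x0" using \<open>x \<in> - N\<close> by (auto simp: N_def)
        then obtain d where "d > 0" "\<And>y. y \<in> cball a R \<Longrightarrow> dist y x < d \<Longrightarrow> u y < u x0"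
          using usc_onD[OF u(1) True] by blast
        then have "ball x d \<subseteq> - N" by (force simp: N_def dist_commute)
        then show ?thesis using \<open>d > 0\<close> by blast
      qed
    qed
    then show ?thesis by (simp add: closed_def)
  qed
  moreover have "bounded N" using bounded_cball by (rule bounded_subset) (auto simp: N_def)
  ultimately have "compact N" by (simp add: compact_eq_bounded_closed)
  moreover have "N \<noteq> {}" using x0 by (auto simp: N_def)
  ultimately obtain p where p: "p \<in> N" "\<And>x. x \<in> N \<Longrightarrow> x \<bullet> b \<le> p \<bullet> b"
    using continuous_attains_sup[of N "\<lambda>x. x \<bullet> b"] continuous_on_inner[OF continuous_on_id continuous_on_const]
    by blast
  have up: "u p = ereal m" using p(1) x0 m by (auto simp: N_def intro: antisym)
  have "p \<in> ball a R"
  proof -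
    have "p \<notin> sphere a R" using bd[of p] up m \<open>c < u x0\<close> by auto
    then show ?thesis using p(1) by (auto simp: N_def)
  qed
  then obtain r where r: "r > 0" "cball p r \<subseteq> cball a R" "u p \<le> spherical_mean u p r" using sub by blast
  have le: "\<And>y. y \<in> cball p r \<Longrightarrow> u y \<le> ereal m" using x0(2) m r(2) by auto
  have "sphere_deficit m u p r \<le> e2ennreal (ereal m - u p)"
    using submean_iff_deficit[OF u(1) r(2,1) le] r(3) by simp
  then have "sphere_deficit m u p r = 0" using up by (simp add: ereal_minus e2ennreal_neg)
  then have "AE z in sphere_measure. e2ennreal (ereal m - u (p + r *\<^sub>R z)) * indicator (sphere 0 1) z = 0"
    unfolding sphere_deficit_def
    using measurable_on_sphere[OF u(1) order_trans[OF sphere_cball r(2)] r(1), of "\<lambda>t. e2ennreal (ereal m - t)"]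
    by (subst (asm) nn_integral_0_iff_AE) simp_all
  then have "AE z in sphere_measure. \<not> z \<bullet> b > 0"
    using AE_sphere_measure
  proof eventually_elim
    case (elim z)
    have in_c: "p + r *\<^sub>R z \<in> cball a R" using elim(2) r by (intro subsetD[OF r(2)]) (simp add: dist_norm)
    have "\<not> u (p + r *\<^sub>R z) < ereal m"
    proof
      assume "u (p + r *\<^sub>R z) < ereal m"
      then have "e2ennreal (ereal m - u (p + r *\<^sub>R z)) \<noteq> 0"
        by (cases "u (p + r *\<^sub>R z)") (auto simp: ereal_minus e2ennreal_infty)
      then show False using elim by auto
    qed
    then have "p + r *\<^sub>R z \<in> N" using in_c m by (simp add: N_def)
    from p(2)[OF this] show ?case using r(1) by (simp add: inner_left_distrib not_less mult_le_0_iff)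
  qed
  then have "emeasure sphere_measure {z. z \<bullet> b > 0} = 0"
    by (subst (asm) AE_iff_measurable[of "{z. z \<bullet> b > 0}"]) auto
  moreover have "b \<noteq> 0" using b by auto
  ultimately show False using emeasure_sphere_halfspace_pos[of b] by simp
qed

lemma submean_le_mean_value:
  fixes u :: "'a::euclidean_space \<Rightarrow> ereal"
  assumes u: "usc_on (cball a R) u" "\<And>x. x \<in> cball a R \<Longrightarrow> u x < \<infinity>"
    and sub: "\<And>x. x \<in> ball a R \<Longrightarrow> \<exists>r>0. cball x r \<subseteq> cball a R \<and> u x \<le> spherical_mean u x r"
    and h: "mean_value_on (cball a R) h"
    and bd: "\<And>x. x \<in> sphere a R \<Longrightarrow> u x \<le> ereal (h x)"
    and y: "y \<in> cball a R"
  shows "u y \<le> ereal (h y)"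
proof -
  let ?h = "\<lambda>x. ereal (- h x)"
  have h': "mean_value_on (cball a R) (\<lambda>x. - h x)" using h by (rule mean_value_on_uminus)
  have ch: "usc_on (cball a R) ?h"
    using h' by (intro usc_on_continuous) (simp add: mean_value_on_def)
  have "u y + ?h y \<le> 0"
  proof (rule submean_maximum_principle[where a=a and R=R and u="\<lambda>x. u x + ?h x" and c=0])
    show "usc_on (cball a R) (\<lambda>x. u x + ?h x)" by (rule usc_on_add[OF u(1) ch u(2)]) auto
    show "u x + ?h x < \<infinity>" if "x \<in> cball a R" for x using u(2)[OF that] by (cases "u x") auto
    show "\<exists>r>0. cball x r \<subseteq> cball a R \<and> u x + ?h x \<le> spherical_mean (\<lambda>x. u x + ?h x) x r" if x: "x \<in> ball a R" for x
    proof -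
      obtain r where r: "r > 0" "cball x r \<subseteq> cball a R" "u x \<le> spherical_mean u x r" using sub[OF x] by blast
      have "u x + ?h x \<le> spherical_mean (\<lambda>x. u x + ?h x) x r"
        by (rule submean_add)
           (use r u usc_on_subset[OF u(1) r(2)] usc_on_subset[OF ch r(2)] mean_value_on_spherical_mean[OF h' r(1,2)] in auto)
      then show ?thesis using r by blast
    qed
    show "u x + ?h x \<le> 0" if "x \<in> sphere a R" for x
      using bd[OF that] by (cases "u x") auto
  qed (rule y)
  then show ?thesis by (cases "u y") auto
qed

section \<open>The mean value property of harmonic functions\<close>

text \<open>
  \<open>G\<close> is the gradient of \<open>F\<close> and \<open>G' x\<close> is its second derivative at \<open>x\<close>, a linear map whose trace
  is the Laplacian.
\<close>

definition has_laplacian :: "('a::euclidean_space \<Rightarrow> real) \<Rightarrow> ('a \<Rightarrow> real) \<Rightarrow> bool" where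
  "has_laplacian F L \<longleftrightarrow> (\<exists>G G'.
     (\<forall>x. (F has_derivative (\<lambda>v. v \<bullet> G x)) (at x)) \<and>
     (\<forall>x. (G has_derivative G' x) (at x)) \<and>
     (\<forall>v. continuous_on UNIV (\<lambda>x. G' x v)) \<and>
     (\<forall>x. L x = (\<Sum>i\<in>Basis. G' x i \<bullet> i)))"

lemma has_laplacianE:
  assumes "has_laplacian F L"
  obtains G G' where "\<And>x. (F has_derivative (\<lambda>v. v \<bullet> G x)) (at x)" "\<And>x. (G has_derivative G' x) (at x)"
    "\<And>v. continuous_on UNIV (\<lambda>x. G' x v)" "\<And>x. L x = (\<Sum>i\<in>Basis. G' x i \<bullet> i)"
  using assms unfolding has_laplacian_def by blast

lemma integrable_continuous_vanishing:
  fixes f :: "'a::euclidean_space \<Rightarrow> real"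
  assumes "continuous_on UNIV f" "\<And>x. norm x > R \<Longrightarrow> f x = 0"
  shows "integrable lborel f"
proof -
  have "integrable lborel (\<lambda>x. indicator (cball 0 R) x *\<^sub>R f x)"
    using assms(1) by (intro borel_integrable_compact compact_cball) (auto intro: continuous_on_subset)
  also have "(\<lambda>x. indicator (cball 0 R) x *\<^sub>R f x) = f"
    using assms(2) by (auto simp: fun_eq_iff indicator_def not_le)
  finally show ?thesis .
qed

text \<open>
  By translation invariance the difference quotients of \<open>f\<close> in the direction \<open>e\<close> have integral zero.
  They converge to \<open>f'\<close>, and by the mean value theorem they are dominated by a constant on a
  bounded set.
\<close>

lemma integral_directional_derivative_zero:
  fixes f :: "'a::euclidean_space \<Rightarrow> real"
  assumes f: "continuous_on UNIV f" and f': "continuous_on UNIV f'"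
    and der: "\<And>x. ((\<lambda>t. f (x + t *\<^sub>R e)) has_real_derivative f' x) (at 0)"
    and R: "0 \<le> R" "\<And>x. norm x > R \<Longrightarrow> f x = 0" "\<And>x. norm x > R \<Longrightarrow> f' x = 0"
  shows "integral\<^sup>L lborel f' = 0"
proof -
  have [measurable]: "f \<in> borel_measurable borel" "f' \<in> borel_measurable borel"
    using f f' by (auto intro: borel_measurable_continuous_onI)
  have int: "integrable lborel f"
    using f R(2) by (rule integrable_continuous_vanishing)
  have der': "((\<lambda>t. f (x + t *\<^sub>R e)) has_real_derivative f' (x + s *\<^sub>R e)) (at s)" for x s
    using der[of "x + s *\<^sub>R e"] DERIV_shift[of "\<lambda>t. f (x + t *\<^sub>R e)" "f' (x + s *\<^sub>R e)" 0 s]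
    by (simp add: algebra_simps)
  obtain B where B: "\<And>x. \<bar>f' x\<bar> \<le> B" "0 \<le> B"
  proof -
    have "bounded (f' ` cball 0 R)"
      by (rule compact_imp_bounded[OF compact_continuous_image]) (use f' in \<open>auto intro: continuous_on_subset\<close>)
    then obtain b where b: "\<And>x. x \<in> cball 0 R \<Longrightarrow> \<bar>f' x\<bar> \<le> b" unfolding bounded_iff real_norm_def by blast
    have "\<bar>f' x\<bar> \<le> max b 0" for x
      using b[of x] R(3)[of x] by (cases "norm x \<le> R") auto
    then show ?thesis using that by (meson max.cobounded2)
  qed
  define h where "h n = 1 / real (Suc n)" for n
  have h: "0 < h n" "h n \<le> 1" for n by (auto simp: h_def)
  define s where "s n x = (f (x + h n *\<^sub>R e) - f x) / h n" for n x
  have "(\<lambda>n. integral\<^sup>L lborel (s n)) \<longlonglongrightarrow> integral\<^sup>L lborel f'"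
  proof (rule integral_dominated_convergence[where w="\<lambda>x. indicator (cball 0 (R + norm e)) x *\<^sub>R B"])
    show "f' \<in> borel_measurable lborel" "\<And>n. s n \<in> borel_measurable lborel" unfolding s_def by measurable
    show "integrable lborel (\<lambda>x::'a. indicator (cball 0 (R + norm e)) x *\<^sub>R B)"
      by (intro borel_integrable_compact compact_cball continuous_on_const)
    show "AE x in lborel. (\<lambda>n. s n x) \<longlonglongrightarrow> f' x"
    proof (rule AE_I2)
      fix x
      have "filterlim h (at 0) sequentially"
        unfolding filterlim_at h_def using LIMSEQ_inverse_real_of_nat
        by (auto simp: inverse_eq_divide)
      moreover have "((\<lambda>t. (f (x + t *\<^sub>R e) - f x) / t) \<longlongrightarrow> f' x) (at 0)"
        using der[of x] by (simp add: has_field_derivative_iff)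
      ultimately show "(\<lambda>n. s n x) \<longlonglongrightarrow> f' x" unfolding s_def by (rule filterlim_compose[rotated])
    qed
    show "AE x in lborel. norm (s n x) \<le> indicator (cball 0 (R + norm e)) x *\<^sub>R B" for n
    proof (rule AE_I2)
      fix x
      obtain \<xi> where \<xi>: "f (x + h n *\<^sub>R e) - f (x + 0 *\<^sub>R e) = (h n - 0) * f' (x + \<xi> *\<^sub>R e)"
        using MVT2[of 0 "h n" "\<lambda>t. f (x + t *\<^sub>R e)" "\<lambda>t. f' (x + t *\<^sub>R e)"] der' h[of n] by auto
      then have "s n x = f' (x + \<xi> *\<^sub>R e)" using h[of n] by (simp add: s_def)
      then have 1: "\<bar>s n x\<bar> \<le> B" using B(1)[of "x + \<xi> *\<^sub>R e"] by simp
      have 2: "s n x = 0" if "norm x > R + norm e"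
      proof -
        have "norm x \<le> norm (x + h n *\<^sub>R e) + norm (h n *\<^sub>R e)"
          by (metis add_diff_cancel norm_triangle_ineq4)
        also have "norm (h n *\<^sub>R e) \<le> norm e"
          using h[of n] by (simp add: mult_left_le_one_le)
        finally have "norm (x + h n *\<^sub>R e) > R" using that by simp
        moreover have "norm x > R" using that norm_ge_zero[of e] by linarith
        ultimately show ?thesis using R(2) by (simp add: s_def)
      qed
      show "norm (s n x) \<le> indicator (cball 0 (R + norm e)) x *\<^sub>R B"
        using 1 2 by (auto simp: indicator_def not_le)
    qed
  qed
  moreover have "integral\<^sup>L lborel (s n) = 0" for n
  proof -
    have "integrable (distr lborel borel ((+) (h n *\<^sub>R e))) f" by (subst lborel_distr_plus) (rule int)
    then have i2: "integrable lborel (\<lambda>x. f (x + h n *\<^sub>R e))"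
      by (subst (asm) integrable_distr_eq) (auto simp: add.commute)
    have "(\<integral>x. f (x + h n *\<^sub>R e) \<partial>lborel) = integral\<^sup>L (distr lborel borel ((+) (h n *\<^sub>R e))) f"
      by (subst integral_distr) (auto simp: add.commute)
    also have "\<dots> = integral\<^sup>L lborel f" by (subst lborel_distr_plus) simp
    finally show ?thesis using int i2 unfolding s_def by simp
  qed
  ultimately show ?thesis by (simp add: LIMSEQ_const_iff)
qed

text \<open>
  The divergence of the compactly supported field \<open>w (x \<bullet> x) *\<^sub>R G (t *\<^sub>R x)\<close> integrates to zero. If
  \<open>G\<close> is the gradient of a harmonic function, then \<open>G\<close> is free of divergence, and only the
  derivative of the radial weight contributes.
\<close>

lemma integral_radial_weight_gradient_zero:
  fixes G :: "'a::euclidean_space \<Rightarrow> 'a"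
  assumes F: "\<And>x. (G has_derivative G' x) (at x)"
    "\<And>v. continuous_on UNIV (\<lambda>x. G' x v)" "\<And>x. (\<Sum>i\<in>Basis. G' x i \<bullet> i) = (0::real)"
    and w: "\<And>q. (w has_real_derivative w' q) (at q)" "continuous_on UNIV w'"
      "\<And>q. q \<ge> 1 \<Longrightarrow> w q = 0" "\<And>q. q \<ge> 1 \<Longrightarrow> w' q = 0"
  shows "(\<integral>x. w' (x \<bullet> x) * (x \<bullet> G (t *\<^sub>R x)) \<partial>lborel) = (0::real)"
proof -
  have cG: "continuous_on UNIV G" using F(1) by (meson continuous_at_imp_continuous_on has_derivative_continuous)
  have cw: "continuous_on UNIV w" using w(1) by (meson DERIV_isCont continuous_at_imp_continuous_on)
  note cont = continuous_on_compose2[OF cG] continuous_on_compose2[OF cw] continuous_on_compose2[OF w(2)]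
    continuous_on_compose2[OF F(2)]
  have out: "x \<bullet> x \<ge> 1" if "norm x > 1" for x :: 'a
    using that by (simp add: dot_square_norm one_le_power)
  define X where "X i x = 2 * (x \<bullet> i) * w' (x \<bullet> x) * (G (t *\<^sub>R x) \<bullet> i) + w (x \<bullet> x) * (t * (G' (t *\<^sub>R x) i \<bullet> i))" for i x
  have cX: "continuous_on UNIV (X i)" for i
    unfolding X_def by (intro continuous_intros cont) auto
  have X0: "X i x = 0" if "norm x > 1" for i x
    unfolding X_def using w(3,4)[OF out[OF that]] by simp
  have zero: "integral\<^sup>L lborel (X i) = 0" if i: "i \<in> Basis" for i
  proof (rule integral_directional_derivative_zero[where e=i and R=1 and f="\<lambda>x. w (x \<bullet> x) * (G (t *\<^sub>R x) \<bullet> i)"])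
    show "continuous_on UNIV (\<lambda>x. w (x \<bullet> x) * (G (t *\<^sub>R x) \<bullet> i))" by (intro continuous_intros cont) auto
    show "((\<lambda>s. w ((x + s *\<^sub>R i) \<bullet> (x + s *\<^sub>R i)) * (G (t *\<^sub>R (x + s *\<^sub>R i)) \<bullet> i)) has_real_derivative X i x) (at 0)" for x
    proof -
      have lin: "linear (G' (t *\<^sub>R x))" using F(1) by (rule has_derivative_linear)
      have "((\<lambda>s. w ((x + s *\<^sub>R i) \<bullet> (x + s *\<^sub>R i))) has_real_derivative w' (x \<bullet> x) * (2 * (x \<bullet> i))) (at 0)"
      proof (rule DERIV_chain2[where f=w])
        show "(w has_real_derivative w' (x \<bullet> x)) (at ((x + 0 *\<^sub>R i) \<bullet> (x + 0 *\<^sub>R i)))" using w(1) by simp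
        show "((\<lambda>s. (x + s *\<^sub>R i) \<bullet> (x + s *\<^sub>R i)) has_real_derivative 2 * (x \<bullet> i)) (at 0)"
          unfolding has_field_derivative_def
          by (auto intro!: derivative_eq_intros simp: fun_eq_iff inner_commute)
      qed
      moreover have "((\<lambda>s. G (t *\<^sub>R (x + s *\<^sub>R i)) \<bullet> i) has_real_derivative t * (G' (t *\<^sub>R x) i \<bullet> i)) (at 0)"
      proof -
        have "((\<lambda>s. G (t *\<^sub>R (x + s *\<^sub>R i))) has_derivative (\<lambda>s. G' (t *\<^sub>R x) (t *\<^sub>R s *\<^sub>R i))) (at 0)"
        proof (rule has_derivative_compose[where g=G and f="\<lambda>s. t *\<^sub>R (x + s *\<^sub>R i)"
            and f'="\<lambda>s. t *\<^sub>R s *\<^sub>R i" and g'="G' (t *\<^sub>R x)"])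
          show "(G has_derivative G' (t *\<^sub>R x)) (at (t *\<^sub>R (x + 0 *\<^sub>R i)))" using F(1) by simp
          show "((\<lambda>s. t *\<^sub>R (x + s *\<^sub>R i)) has_derivative (\<lambda>s. t *\<^sub>R s *\<^sub>R i)) (at 0)"
            by (auto intro!: derivative_eq_intros)
        qed
        then have "((\<lambda>s. G (t *\<^sub>R (x + s *\<^sub>R i)) \<bullet> i) has_derivative (\<lambda>s. G' (t *\<^sub>R x) (t *\<^sub>R s *\<^sub>R i) \<bullet> i)) (at 0)"
          by (rule has_derivative_inner_left)
        moreover have "(\<lambda>s. G' (t *\<^sub>R x) (t *\<^sub>R s *\<^sub>R i) \<bullet> i) = (*) (t * (G' (t *\<^sub>R x) i \<bullet> i))"
          by (auto simp: fun_eq_iff linear_scale[OF lin])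
        ultimately show ?thesis by (simp add: has_field_derivative_def)
      qed
      ultimately show ?thesis
        by (rule DERIV_cong[OF DERIV_mult]) (simp add: X_def algebra_simps)
    qed
    show "w (x \<bullet> x) * (G (t *\<^sub>R x) \<bullet> i) = 0" if "norm x > 1" for x
      using w(3)[OF out[OF that]] by simp
  qed (use cX X0 in auto)
  have "(\<Sum>i\<in>Basis. X i x) = 2 * (w' (x \<bullet> x) * (x \<bullet> G (t *\<^sub>R x)))" for x
  proof -
    have "(\<Sum>i\<in>Basis. X i x) = 2 * w' (x \<bullet> x) * (\<Sum>i\<in>Basis. (x \<bullet> i) * (G (t *\<^sub>R x) \<bullet> i))
        + w (x \<bullet> x) * t * (\<Sum>i\<in>Basis. G' (t *\<^sub>R x) i \<bullet> i)"
      unfolding X_def by (simp add: sum.distrib sum_distrib_left mult_ac)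
    then show ?thesis by (simp add: F(3) euclidean_inner[symmetric])
  qed
  then have "(\<integral>x. 2 * (w' (x \<bullet> x) * (x \<bullet> G (t *\<^sub>R x))) \<partial>lborel) = (\<integral>x. (\<Sum>i\<in>Basis. X i x) \<partial>lborel)" by simp
  also have "\<dots> = (\<Sum>i\<in>Basis. integral\<^sup>L lborel (X i))"
    by (rule Bochner_Integration.integral_sum) (rule integrable_continuous_vanishing[OF cX X0])
  also have "\<dots> = 0" using zero by simp
  finally show ?thesis by simp
qed

text \<open>
  Since \<open>F x - F 0\<close> is the integral of \<open>x \<bullet> G (t *\<^sub>R x)\<close> over \<open>0 \<le> t \<le> 1\<close>, Fubini's theorem reduces the
  claim to the previous lemma for each \<open>t\<close>.
\<close>

lemma integral_radial_weight_harmonic: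
  fixes F :: "'a::euclidean_space \<Rightarrow> real"
  assumes F: "has_laplacian F (\<lambda>_. 0)"
    and w: "\<And>q. (w has_real_derivative w' q) (at q)" "continuous_on UNIV w'"
      "\<And>q. q \<ge> 1 \<Longrightarrow> w q = 0" "\<And>q. q \<ge> 1 \<Longrightarrow> w' q = 0"
  shows "(\<integral>x. w' (x \<bullet> x) * (F x - F 0) \<partial>lborel) = 0"
proof -
  obtain G G' where G: "\<And>x. (F has_derivative (\<lambda>v. v \<bullet> G x)) (at x)" "\<And>x. (G has_derivative G' x) (at x)"
    "\<And>v. continuous_on UNIV (\<lambda>x. G' x v)" "\<And>x. 0 = (\<Sum>i\<in>Basis. G' x i \<bullet> i)"
    using has_laplacianE[OF F] by blast
  have cG: "continuous_on UNIV G" using G(2) by (meson continuous_at_imp_continuous_on has_derivative_continuous)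
  note cont = continuous_on_compose2[OF cG] continuous_on_compose2[OF w(2)]
  define f where "f t x = indicator {0..1} t *\<^sub>R (w' (x \<bullet> x) * (x \<bullet> G (t *\<^sub>R x)))" for t :: real and x
  have "integrable lborel (\<lambda>p. indicator ({0..1} \<times> cball 0 1) p *\<^sub>R (w' (snd p \<bullet> snd p) * (snd p \<bullet> G (fst p *\<^sub>R snd p))))"
    by (intro borel_integrable_compact compact_Times compact_cball compact_Icc continuous_intros cont) auto
  also have "(\<lambda>p. indicator ({0..1} \<times> cball 0 1) p *\<^sub>R (w' (snd p \<bullet> snd p) * (snd p \<bullet> G (fst p *\<^sub>R snd p)))) = case_prod f"
  proof -
    have "w' (x \<bullet> x) = 0" if "norm x > 1" for x :: 'a
      using that by (intro w(4)) (simp add: dot_square_norm one_le_power)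
    then show ?thesis by (auto simp: fun_eq_iff f_def indicator_def not_le)
  qed
  finally have i: "integrable (lborel \<Otimes>\<^sub>M lborel) (case_prod f)" by (simp add: lborel_prod)
  have ftc: "(\<integral>t. f t x \<partial>lborel) = w' (x \<bullet> x) * (F x - F 0)" for x
  proof -
    have "integral\<^sup>L lborel (\<lambda>t. indicator {0..1} t *\<^sub>R (w' (x \<bullet> x) * (x \<bullet> G (t *\<^sub>R x)))) =
        w' (x \<bullet> x) * F (1 *\<^sub>R x) - w' (x \<bullet> x) * F (0 *\<^sub>R x)"
    proof (rule integral_FTC_atLeastAtMost)
      show "continuous_on {0..1} (\<lambda>t. w' (x \<bullet> x) * (x \<bullet> G (t *\<^sub>R x)))" by (intro continuous_intros cont) auto
      fix t
      have "((\<lambda>t. F (t *\<^sub>R x)) has_derivative (\<lambda>s. (s *\<^sub>R x) \<bullet> G (t *\<^sub>R x))) (at t)"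
        by (rule has_derivative_compose[OF _ G(1), where f="\<lambda>t. t *\<^sub>R x" and f'="\<lambda>s. s *\<^sub>R x"]) (auto intro!: derivative_eq_intros)
      then have "((\<lambda>t. F (t *\<^sub>R x)) has_real_derivative x \<bullet> G (t *\<^sub>R x)) (at t)"
        by (simp add: has_field_derivative_def mult_commute_abs)
      then have "((\<lambda>t. w' (x \<bullet> x) * F (t *\<^sub>R x)) has_real_derivative w' (x \<bullet> x) * (x \<bullet> G (t *\<^sub>R x))) (at t)"
        by (rule DERIV_cmult)
      then show "((\<lambda>t. w' (x \<bullet> x) * F (t *\<^sub>R x)) has_vector_derivative w' (x \<bullet> x) * (x \<bullet> G (t *\<^sub>R x))) (at t within {0..1})"
        by (simp add: has_real_derivative_iff_has_vector_derivative has_vector_derivative_at_within)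
    qed simp
    then show ?thesis by (simp add: f_def algebra_simps)
  qed
  have "(\<integral>x. w' (x \<bullet> x) * (F x - F 0) \<partial>lborel) = (\<integral>x. (\<integral>t. f t x \<partial>lborel) \<partial>lborel)" by (simp add: ftc)
  also have "\<dots> = (\<integral>t. (\<integral>x. f t x \<partial>lborel) \<partial>lborel)" by (rule lborel_pair.Fubini_integral[OF i])
  also have "\<dots> = 0"
    unfolding f_def using integral_radial_weight_gradient_zero[OF G(2,3) G(4)[symmetric] w] by simp
  finally show ?thesis .
qed

lemma integral_ball_uniform_vanishing:
  fixes f :: "'a::euclidean_space \<Rightarrow> real"
  assumes [measurable]: "f \<in> borel_measurable borel" and "\<And>x. x \<notin> ball 0 1 \<Longrightarrow> f x = 0"
  shows "integral\<^sup>L ball_uniform f = integral\<^sup>L lborel f / measure lborel (ball (0::'a) 1)"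
    and "integrable lborel f \<Longrightarrow> integrable ball_uniform f"
proof -
  let ?c = "measure lborel (ball (0::'a) 1)"
  have c: "?c > 0" by simp
  have e: "emeasure lborel (ball (0::'a) 1) = ennreal ?c"
    using emeasure_lborel_ball_finite[of "0::'a" 1] by (subst emeasure_eq_ennreal_measure) auto
  have d: "ball_uniform = density lborel (\<lambda>x::'a. ennreal (indicator (ball 0 1) x / ?c))"
    unfolding uniform_measure_def e using c
    by (intro arg_cong[where f="density lborel"]) (auto simp: fun_eq_iff indicator_def divide_ennreal ennreal_1[symmetric] simp del: ennreal_1)
  have eq: "(indicator (ball 0 1) x / ?c) *\<^sub>R f x = f x / ?c" for x
    using assms(2)[of x] by (auto simp: indicator_def)
  show "integral\<^sup>L ball_uniform f = integral\<^sup>L lborel f / ?c"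
    unfolding d using c by (subst integral_density) (auto simp: eq simp del: real_scaleR_def intro!: borel_measurable_divide borel_measurable_indicator)
  show "integrable ball_uniform f" if "integrable lborel f"
    unfolding d using c that by (subst integrable_density) (auto simp: eq simp del: real_scaleR_def intro!: borel_measurable_divide borel_measurable_indicator)
qed

lemma continuous_spherical_integral:
  fixes F :: "'a::euclidean_space \<Rightarrow> real"
  assumes F: "continuous_on UNIV F"
  shows "continuous_on UNIV (\<lambda>s. \<integral>z. F (s *\<^sub>R z) \<partial>sphere_measure)"
proof (rule continuous_at_imp_continuous_on, rule ballI, unfold continuous_at_sequentially comp_def, intro allI impI)
  fix s :: real and X :: "nat \<Rightarrow> real" assume X: "X \<longlonglongrightarrow> s"
  interpret S: finite_measure "sphere_measure :: 'a measure" by (rule finite_measure_sphere_measure)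
  have [measurable]: "F \<in> borel_measurable borel" using F by (auto intro: borel_measurable_continuous_onI)
  obtain b where b: "\<And>n. norm (X n) \<le> b" using convergent_imp_Bseq[of X] X unfolding Bseq_def convergent_def by blast
  have "bounded (F ` cball 0 b)"
    by (rule compact_imp_bounded[OF compact_continuous_image]) (use F in \<open>auto intro: continuous_on_subset\<close>)
  then obtain B where B: "\<forall>x\<in>cball 0 b. \<bar>F x\<bar> \<le> B" unfolding bounded_iff real_norm_def by blast
  show "(\<lambda>n. \<integral>z. F (X n *\<^sub>R z) \<partial>sphere_measure) \<longlonglongrightarrow> (\<integral>z. F (s *\<^sub>R z) \<partial>sphere_measure)"
  proof (rule integral_dominated_convergence[where w="\<lambda>_. B"])
    show "AE z in sphere_measure. (\<lambda>n. F (X n *\<^sub>R z)) \<longlonglongrightarrow> F (s *\<^sub>R z)"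
    proof (rule AE_I2)
      fix z
      have "isCont F (s *\<^sub>R z)" using F by (simp add: continuous_on_eq_continuous_at)
      moreover have "(\<lambda>n. X n *\<^sub>R z) \<longlonglongrightarrow> s *\<^sub>R z" using X by (intro tendsto_intros)
      ultimately show "(\<lambda>n. F (X n *\<^sub>R z)) \<longlonglongrightarrow> F (s *\<^sub>R z)" by (rule isCont_tendsto_compose)
    qed
    show "AE z in sphere_measure. norm (F (X n *\<^sub>R z)) \<le> B" for n
      using AE_sphere_measure by eventually_elim (use B b[of n] in auto)
  qed auto
qed

text \<open>
  The second difference of \<open>q \<mapsto> max 0 (- q)\<close>: a tent over \<open>{a..c}\<close>. Up to a constant factor it is the derivative of an
  explicit combination of squares of positive parts that vanishes on \<open>{c..}\<close>; so it may serve as \<open>w'\<close> in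
  \<open>integral_radial_weight_harmonic\<close>, where it isolates a thin shell of radii.
\<close>

definition hat :: "real \<Rightarrow> real \<Rightarrow> real \<Rightarrow> real" where
  "hat a c q = max 0 (c - q) - 2 * max 0 ((a + c) / 2 - q) + max 0 (a - q)"

lemma hat_pos: "a < q \<Longrightarrow> q < c \<Longrightarrow> hat a c q > 0"
  by (auto simp: hat_def max_def field_simps)

lemma hat_zero: "a < c \<Longrightarrow> q \<le> a \<or> c \<le> q \<Longrightarrow> hat a c q = 0"
  by (auto simp: hat_def max_def field_simps)

lemma has_derivative_pos_part_square:
  "((\<lambda>q. (max 0 (c - q))\<^sup>2) has_real_derivative - 2 * max 0 (c - q)) (at (q::real))"
proof (cases "q = c")
  case False
  show ?thesis
  proof (cases "q < c")
    case True
    have "((\<lambda>q. (c - q)\<^sup>2) has_real_derivative - 2 * max 0 (c - q)) (at q)"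
      using True by (auto intro!: derivative_eq_intros)
    then show ?thesis
      by (rule has_field_derivative_transform_within_open[where S="{..<c}"]) (use True in auto)
  next
    case f: False
    have "((\<lambda>q. 0) has_real_derivative - 2 * max 0 (c - q)) (at q)"
      using f by (auto intro!: derivative_eq_intros)
    then show ?thesis
      by (rule has_field_derivative_transform_within_open[where S="{c<..}"]) (use f False in auto)
  qed
next
  case True
  have "((\<lambda>h. (max 0 (- h))\<^sup>2 / h) \<longlongrightarrow> 0) (at (0::real))"
  proof (rule tendsto_0_le[where K=1])
    show "((\<lambda>h::real. h) \<longlongrightarrow> 0) (at 0)" by (rule tendsto_ident_at)
    show "\<forall>\<^sub>F h::real in at 0. norm ((max 0 (- h))\<^sup>2 / h) \<le> norm h * 1"
      by (rule always_eventually) (auto simp: max_def power2_eq_square)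
  qed
  then show ?thesis using True by (simp add: DERIV_def)
qed

text \<open>
  Let \<open>m s\<close> be the mean of \<open>F - F 0\<close> over the sphere of radius \<open>s\<close>. In polar coordinates,
  \<open>integral_radial_weight_harmonic\<close> says that \<open>m\<close> integrates to zero against every tent function of
  \<open>s\<^sup>2\<close> supported in the unit interval. As \<open>m\<close> is continuous
  and every interval of radii has positive measure, \<open>m\<close> vanishes on \<open>{0<..<1}\<close>, and by continuity
  at \<open>1\<close>.
\<close>

lemma has_laplacian_0_mean_value_origin:
  fixes F :: "'a::euclidean_space \<Rightarrow> real"
  assumes F: "has_laplacian F (\<lambda>_. 0)"
  shows "(\<integral>z. F z \<partial>sphere_measure) = F 0"
proof -
  interpret S: finite_measure "sphere_measure :: 'a measure" by (rule finite_measure_sphere_measure)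
  interpret R: finite_measure "radius_measure TYPE('a)" by (rule finite_measure_radius_measure)
  have cF: "continuous_on UNIV F"
    using has_laplacianE[OF F] by (metis continuous_at_imp_continuous_on has_derivative_continuous)
  define m where "m s = (\<integral>z. F (s *\<^sub>R z) - F 0 \<partial>sphere_measure)" for s
  have cm: "continuous_on UNIV m"
    unfolding m_def using continuous_spherical_integral[of "\<lambda>x. F x - F 0"] cF by (simp add: continuous_intros)
  have hat_int: "(\<integral>s. hat a c (s\<^sup>2) * m s \<partial>radius_measure TYPE('a)) = 0" if ac: "0 \<le> a" "a < c" "c \<le> 1" for a c
  proof -
    define w where "w q = (max 0 (c - q))\<^sup>2 - 2 * (max 0 ((a + c) / 2 - q))\<^sup>2 + (max 0 (a - q))\<^sup>2" for q
    have "(w has_real_derivative - 2 * hat a c q) (at q)" for q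
      unfolding w_def by (rule derivative_eq_intros has_derivative_pos_part_square refl)+ (simp add: hat_def)
    moreover have "continuous_on UNIV (\<lambda>q. - 2 * hat a c q)" unfolding hat_def by (intro continuous_intros)
    moreover have "w q = 0" if "q \<ge> 1" for q using that ac by (simp add: w_def max_def)
    moreover have "- 2 * hat a c q = 0" if "q \<ge> 1" for q using that ac by (simp add: hat_zero)
    ultimately have "(\<integral>x. (- 2 * hat a c (x \<bullet> x)) * (F x - F 0) \<partial>lborel) = 0"
      by (rule integral_radial_weight_harmonic[OF F])
    then have 0: "(\<integral>x. hat a c (x \<bullet> x) * (F x - F 0) \<partial>lborel) = 0" by (simp add: mult.assoc)
    have cf: "continuous_on UNIV (\<lambda>x. hat a c (x \<bullet> x) * (F x - F 0))"
      unfolding hat_def by (intro continuous_intros cF)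
    have v: "hat a c (x \<bullet> x) * (F x - F 0) = 0" if "x \<notin> ball 0 1" for x
      using that ac hat_zero[of a c "x \<bullet> x"] by (auto simp: dot_square_norm not_less intro: order_trans[OF _ one_le_power])
    have int: "integrable lborel (\<lambda>x. hat a c (x \<bullet> x) * (F x - F 0))"
      by (rule integrable_continuous_vanishing[OF cf, of 1]) (rule v, simp)
    have "0 = (\<integral>x. hat a c (x \<bullet> x) * (F x - F 0) \<partial>ball_uniform)"
      using integral_ball_uniform_vanishing(1)[of "\<lambda>x. hat a c (x \<bullet> x) * (F x - F 0)"] v 0 cf
      by (simp add: borel_measurable_continuous_onI)
    also have "\<dots> = (\<integral>s. \<integral>z. hat a c ((s *\<^sub>R z) \<bullet> (s *\<^sub>R z)) * (F (s *\<^sub>R z) - F 0) \<partial>sphere_measure \<partial>radius_measure TYPE('a))"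
      by (rule integral_polar, rule integral_ball_uniform_vanishing(2))
         (use v int cf in \<open>auto intro: borel_measurable_continuous_onI\<close>)
    also have "\<dots> = (\<integral>s. hat a c (s\<^sup>2) * m s \<partial>radius_measure TYPE('a))"
    proof (rule Bochner_Integration.integral_cong[OF refl])
      fix s
      have [measurable]: "F \<in> borel_measurable borel" using cF by (rule borel_measurable_continuous_onI)
      have [measurable]: "(\<lambda>x. hat a c (x \<bullet> x) * (F x - F 0)) \<in> borel_measurable borel"
        using cf by (rule borel_measurable_continuous_onI)
      have "(\<integral>z. hat a c ((s *\<^sub>R z) \<bullet> (s *\<^sub>R z)) * (F (s *\<^sub>R z) - F 0) \<partial>sphere_measure)
          = (\<integral>z. hat a c (s\<^sup>2) * (F (s *\<^sub>R z) - F 0) \<partial>sphere_measure)"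
      proof (rule integral_cong_AE)
        show "AE z in sphere_measure. hat a c ((s *\<^sub>R z) \<bullet> (s *\<^sub>R z)) * (F (s *\<^sub>R z) - F 0) = hat a c (s\<^sup>2) * (F (s *\<^sub>R z) - F 0)"
          using AE_sphere_measure by eventually_elim (simp add: dot_square_norm power2_eq_square)
        show "(\<lambda>z. hat a c ((s *\<^sub>R z) \<bullet> (s *\<^sub>R z)) * (F (s *\<^sub>R z) - F 0)) \<in> borel_measurable sphere_measure"
          using measurable_compose[of "\<lambda>z. s *\<^sub>R z" borel borel "\<lambda>x. hat a c (x \<bullet> x) * (F x - F 0)" borel]
          by simp
      qed auto
      then show "(\<integral>z. hat a c ((s *\<^sub>R z) \<bullet> (s *\<^sub>R z)) * (F (s *\<^sub>R z) - F 0) \<partial>sphere_measure) = hat a c (s\<^sup>2) * m s"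
        by (simp add: m_def)
    qed
    finally show ?thesis by simp
  qed
  have m0: "m s0 = 0" if s0: "0 < s0" "s0 < 1" for s0
  proof (rule ccontr)
    assume ne: "m s0 \<noteq> 0"
    \<comment> \<open>The sign makes \<open>k\<close> positive near \<open>s0\<close>; a tent supported there gives a positive integral.\<close>
    define k where "k s = m s * sgn (m s0)" for s
    have ck: "continuous_on UNIV k" unfolding k_def by (intro continuous_intros cm)
    have "k s0 > 0" using ne by (auto simp: k_def sgn_if)
    have "open {s. k s > 0}" using ck by (intro open_Collect_less) auto
    then have "open ({s. k s > 0} \<inter> {0<..<1})" by auto
    moreover have "s0 \<in> {s. k s > 0} \<inter> {0<..<1}" using \<open>k s0 > 0\<close> s0 by auto
    ultimately obtain e where e: "e > 0" "ball s0 e \<subseteq> {s. k s > 0} \<inter> {0<..<1}"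
      using open_contains_ball by blast
    define \<alpha> \<beta> where "\<alpha> = s0 - e/2" and "\<beta> = s0 + e/2"
    have ab: "s \<in> {\<alpha>..\<beta>} \<Longrightarrow> 0 < k s \<and> 0 < s \<and> s < 1" for s
      using e by (auto simp: \<alpha>_def \<beta>_def subset_iff dist_real_def abs_if)
    have lt: "\<alpha> < \<beta>" using e by (simp add: \<alpha>_def \<beta>_def)
    have ab': "0 < \<alpha>" "\<beta> < 1" using ab[of \<alpha>] ab[of \<beta>] lt by auto
    define f where "f s = hat (\<alpha>\<^sup>2) (\<beta>\<^sup>2) (s\<^sup>2) * k s" for s
    have sq: "\<alpha>\<^sup>2 < \<beta>\<^sup>2" "0 \<le> \<alpha>\<^sup>2" "\<beta>\<^sup>2 \<le> 1"
      using lt ab' by (auto intro: power_strict_mono simp: power_le_one)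
    have int0: "integral\<^sup>L (radius_measure TYPE('a)) f = 0"
      unfolding f_def k_def using hat_int[OF sq(2,1,3)] by (simp add: mult.assoc[symmetric])
    have nn: "0 \<le> f s" if "0 < s" for s
    proof (cases "\<alpha> < s \<and> s < \<beta>")
      case True
      then have "hat (\<alpha>\<^sup>2) (\<beta>\<^sup>2) (s\<^sup>2) > 0" using ab' by (intro hat_pos power_strict_mono) auto
      then show ?thesis using ab[of s] True by (simp add: f_def)
    next
      case False
      then have "s\<^sup>2 \<le> \<alpha>\<^sup>2 \<or> \<beta>\<^sup>2 \<le> s\<^sup>2" using ab' lt that by (auto simp: not_less intro!: power_mono)
      then show ?thesis using hat_zero[OF sq(1)] by (simp add: f_def)
    qed
    have cf: "continuous_on UNIV f" unfolding f_def hat_def by (intro continuous_intros ck)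
    then have [measurable]: "f \<in> borel_measurable borel" by (rule borel_measurable_continuous_onI)
    have "bounded (f ` {0..1})"
      by (rule compact_imp_bounded[OF compact_continuous_image]) (use cf in \<open>auto intro: continuous_on_subset\<close>)
    then obtain B where B: "\<forall>x\<in>{0..1}. \<bar>f x\<bar> \<le> B" unfolding bounded_iff real_norm_def by blast
    have "AE s in radius_measure TYPE('a). norm (f s) \<le> B"
      using AE_radius_measure by eventually_elim (use B in auto)
    then have "integrable (radius_measure TYPE('a)) f"
      by (rule R.integrable_const_bound) simp
    moreover have "AE s in radius_measure TYPE('a). 0 \<le> f s"
      using AE_radius_measure by eventually_elim (use nn in auto)
    ultimately have "AE s in radius_measure TYPE('a). f s = 0"
      using integral_nonneg_eq_0_iff_AE int0 by blast
    then have "AE s in radius_measure TYPE('a). \<not> s \<in> {\<alpha><..<\<beta>}"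
    proof eventually_elim
      case (elim s)
      show ?case
      proof
        assume s: "s \<in> {\<alpha><..<\<beta>}"
        then have "hat (\<alpha>\<^sup>2) (\<beta>\<^sup>2) (s\<^sup>2) > 0" using ab' by (intro hat_pos power_strict_mono) auto
        then show False using elim ab[of s] s by (simp add: f_def)
      qed
    qed
    then have "emeasure (radius_measure TYPE('a)) {\<alpha><..<\<beta>} = 0"
      by (subst (asm) AE_iff_measurable[of "{\<alpha><..<\<beta>}"]) auto
    then show False using emeasure_radius_interval_pos[of \<alpha> \<beta>, where 'a='a] ab' lt by simp
  qed
  have "m 1 = 0"
  proof -
    have "(m \<longlongrightarrow> m 1) (at 1)" using cm by (simp add: continuous_on_def)
    then have "(m \<longlongrightarrow> m 1) (at_left 1)" by (rule tendsto_within_subset) simp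
    moreover have "\<forall>\<^sub>F s in at_left 1. m s = 0"
      by (rule eventually_at_leftI[of 0]) (use m0 in auto)
    ultimately have "((\<lambda>_. 0) \<longlongrightarrow> m 1) (at_left (1::real))"
      by (rule Lim_transform_eventually)
    then show ?thesis by (simp add: tendsto_const_iff)
  qed
  moreover have "m 1 = (\<integral>z. F z \<partial>sphere_measure) - F 0"
  proof -
    have [measurable]: "F \<in> borel_measurable borel" using cF by (rule borel_measurable_continuous_onI)
    have "bounded (F ` cball 0 1)"
      by (rule compact_imp_bounded[OF compact_continuous_image]) (use cF in \<open>auto intro: continuous_on_subset\<close>)
    then obtain B where B: "\<forall>x\<in>cball 0 1. \<bar>F x\<bar> \<le> B" unfolding bounded_iff real_norm_def by blast
    have "AE z in sphere_measure. norm (F z) \<le> B"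
      using AE_sphere_measure by eventually_elim (use B in auto)
    then have "integrable sphere_measure F" by (rule S.integrable_const_bound) simp
    moreover have "measure sphere_measure (UNIV :: 'a set) = 1"
      by (simp add: measure_def emeasure_sphere_measure_UNIV)
    ultimately show ?thesis by (simp add: m_def)
  qed
  ultimately show ?thesis by simp
qed

lemma has_laplacian_affine:
  fixes F :: "'a::euclidean_space \<Rightarrow> real"
  assumes "has_laplacian F L"
  shows "has_laplacian (\<lambda>y. F (x + r *\<^sub>R y)) (\<lambda>y. r\<^sup>2 * L (x + r *\<^sub>R y))"
proof -
  obtain G G' where G: "\<And>x. (F has_derivative (\<lambda>v. v \<bullet> G x)) (at x)" "\<And>x. (G has_derivative G' x) (at x)"
    "\<And>v. continuous_on UNIV (\<lambda>x. G' x v)" "\<And>x. L x = (\<Sum>i\<in>Basis. G' x i \<bullet> i)"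
    using has_laplacianE[OF assms] by blast
  have aff: "((\<lambda>y. x + r *\<^sub>R y) has_derivative (\<lambda>v. r *\<^sub>R v)) (at y)" for y
    by (auto intro!: derivative_eq_intros)
  have "((\<lambda>y. F (x + r *\<^sub>R y)) has_derivative (\<lambda>v. v \<bullet> (r *\<^sub>R G (x + r *\<^sub>R y)))) (at y)" for y
    using has_derivative_compose[OF aff G(1)] by simp
  moreover have "((\<lambda>y. r *\<^sub>R G (x + r *\<^sub>R y)) has_derivative (\<lambda>v. r\<^sup>2 *\<^sub>R G' (x + r *\<^sub>R y) v)) (at y)" for y
  proof -
    have "((\<lambda>y. r *\<^sub>R G (x + r *\<^sub>R y)) has_derivative (\<lambda>v. r *\<^sub>R G' (x + r *\<^sub>R y) (r *\<^sub>R v))) (at y)"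
      by (rule has_derivative_scaleR_right[OF has_derivative_compose[OF aff G(2)]])
    then show ?thesis
      by (simp add: linear_scale[OF has_derivative_linear[OF G(2)]] power2_eq_square)
  qed
  moreover have "continuous_on UNIV (\<lambda>y. r\<^sup>2 *\<^sub>R G' (x + r *\<^sub>R y) v)" for v
    by (intro continuous_intros continuous_on_compose2[OF G(3)]) auto
  moreover have "r\<^sup>2 * L (x + r *\<^sub>R y) = (\<Sum>i\<in>Basis. (r\<^sup>2 *\<^sub>R G' (x + r *\<^sub>R y) i) \<bullet> i)" for y
    by (simp add: G(4) sum_distrib_left)
  ultimately show ?thesis unfolding has_laplacian_def
    by (intro exI[of _ "\<lambda>y. r *\<^sub>R G (x + r *\<^sub>R y)"] exI[of _ "\<lambda>y v. r\<^sup>2 *\<^sub>R G' (x + r *\<^sub>R y) v"] conjI allI)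
qed

lemma has_laplacian_0_mean_value_on:
  fixes F :: "'a::euclidean_space \<Rightarrow> real"
  assumes F: "has_laplacian F (\<lambda>_. 0)"
  shows "mean_value_on K F"
  unfolding mean_value_on_def
proof (intro conjI allI impI)
  have cF: "continuous_on UNIV F"
    using has_laplacianE[OF F] by (metis continuous_at_imp_continuous_on has_derivative_continuous)
  then show "continuous_on K F" by (rule continuous_on_subset) simp
  fix x r
  have [measurable]: "F \<in> borel_measurable borel" using cF by (rule borel_measurable_continuous_onI)
  have "(\<integral>z. F (x + r *\<^sub>R z) \<partial>sphere_measure) = F x"
    using has_laplacian_0_mean_value_origin[OF has_laplacian_affine[OF F, of x r, simplified]] by simp
  moreover have "(sphere_integral F x r) = (\<integral>z. F (x + r *\<^sub>R z) \<partial>sphere_measure)"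
    unfolding set_lebesgue_integral_def
  proof (rule integral_cong_AE)
    show "(\<lambda>z. indicator (sphere 0 1) z *\<^sub>R F (x + r *\<^sub>R z)) \<in> borel_measurable sphere_measure"
      by (intro borel_measurable_scaleR borel_measurable_indicator) auto
    show "AE z in sphere_measure. indicator (sphere 0 1) z *\<^sub>R F (x + r *\<^sub>R z) = F (x + r *\<^sub>R z)"
      using AE_sphere_measure by eventually_elim simp
  qed simp
  ultimately show "(sphere_integral F x r) = F x" by simp
qed

section \<open>The Dirichlet problem on a ball\<close>

text \<open>
  The boundary functions on the unit sphere that extend harmonically to the ball. This set is a
  linear space, closed under uniform limits by the maximum principle; so it is everything as soon
  as it contains a dense set. The functions \<open>exp (a \<bullet> x)\<close> span an algebra that separates points, and
  their power series reduces them to the powers of \<open>a \<bullet> x\<close>.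
\<close>

definition dirichlet_solvable :: "('a::euclidean_space \<Rightarrow> real) \<Rightarrow> bool" where
  "dirichlet_solvable \<phi> \<longleftrightarrow> (\<exists>h. mean_value_on (cball 0 1) h \<and> (\<forall>x\<in>sphere 0 1. h x = \<phi> x))"

lemma mean_value_on_le:
  fixes h :: "'a::euclidean_space \<Rightarrow> real"
  assumes h: "mean_value_on (cball a R) h" and bd: "\<And>x. x \<in> sphere a R \<Longrightarrow> h x \<le> c"
    and y: "y \<in> cball a R"
  shows "h y \<le> c"
proof -
  have "ereal (h y) \<le> ereal c"
  proof (rule submean_maximum_principle[OF _ _ _ _ y])
    show "usc_on (cball a R) (\<lambda>x. ereal (h x))"
      using h by (intro usc_on_continuous) (simp add: mean_value_on_def)
    fix x assume x: "x \<in> ball a R"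
    then obtain r where "r > 0" "cball x r \<subseteq> ball a R"
      using open_contains_cball open_ball by blast
    then have r: "r > 0" "cball x r \<subseteq> cball a R" using ball_subset_cball[of a R] by blast+
    then show "\<exists>r>0. cball x r \<subseteq> cball a R \<and> ereal (h x) \<le> spherical_mean (\<lambda>x. ereal (h x)) x r"
      using mean_value_on_spherical_mean[OF h r] by (intro exI[of _ r]) auto
  qed (use bd in auto)
  then show ?thesis by simp
qed

lemma dirichlet_solvable_cong:
  "dirichlet_solvable \<phi> \<Longrightarrow> (\<And>x. x \<in> sphere 0 1 \<Longrightarrow> \<phi> x = \<psi> x) \<Longrightarrow> dirichlet_solvable \<psi>"
  unfolding dirichlet_solvable_def by auto

lemma dirichlet_solvable_linear:
  assumes "dirichlet_solvable \<phi>" "dirichlet_solvable \<psi>"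
  shows "dirichlet_solvable (\<lambda>x. a * \<phi> x + b * \<psi> x)"
proof -
  obtain h g where "mean_value_on (cball 0 1) h" "\<forall>x\<in>sphere 0 1. h x = \<phi> x"
    "mean_value_on (cball 0 1) g" "\<forall>x\<in>sphere 0 1. g x = \<psi> x"
    using assms unfolding dirichlet_solvable_def by blast
  then show ?thesis unfolding dirichlet_solvable_def
    by (intro exI[of _ "\<lambda>x. a * h x + b * g x"]) (auto intro: mean_value_on_linear)
qed

lemma dirichlet_solvable_harmonic: "has_laplacian F (\<lambda>_. 0) \<Longrightarrow> dirichlet_solvable F"
  unfolding dirichlet_solvable_def using has_laplacian_0_mean_value_on by blast

text \<open>
  Both sides of the mean value identity are continuous for uniform convergence.
\<close>

lemma mean_value_on_uniform_limit:
  fixes h :: "nat \<Rightarrow> 'a::euclidean_space \<Rightarrow> real"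
  assumes h: "\<And>n. mean_value_on K (h n)" and lim: "uniform_limit K h H sequentially"
  shows "mean_value_on K H"
  unfolding mean_value_on_def
proof (intro conjI allI impI)
  show cH: "continuous_on K H"
    by (rule uniform_limit_theorem[OF _ lim]) (use h in \<open>auto simp: mean_value_on_def\<close>)
  fix x r assume r: "0 < r" "cball x r \<subseteq> K"
  have sK: "sphere x r \<subseteq> K" using sphere_cball r(2) by (rule order_trans)
  have xK: "x \<in> K" using r by auto
  have ch: "continuous_on K (h n)" for n using h by (simp add: mean_value_on_def)
  let ?I = "\<lambda>f. sphere_integral f x r"
  have mono: "?I f - ?I g \<le> e" if c: "continuous_on K f" "continuous_on K g" and "\<And>y. y \<in> K \<Longrightarrow> f y - g y \<le> e" for f g :: "'a \<Rightarrow> real" and e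
  proof -
    have c': "continuous_on (sphere x r) f" "continuous_on (sphere x r) g"
      using c sK by (auto intro: continuous_on_subset)
    have "?I f - ?I g = ?I (\<lambda>y. f y - g y)"
      using set_integral_diff(2)[OF set_integrable_sphere[OF c'(1) r(1)] set_integrable_sphere[OF c'(2) r(1)]] by simp
    also have "\<dots> \<le> e"
      by (rule sphere_deficit_continuous(2)[OF _ r(1)]) (use c' that(3) sK in \<open>auto intro!: continuous_intros\<close>)
    finally show ?thesis .
  qed
  have "\<bar>?I H - H x\<bar> \<le> 2 * e" if "e > 0" for e
  proof -
    have "\<forall>\<^sub>F n in sequentially. \<forall>y\<in>K. dist (h n y) (H y) < e" using lim that by (rule uniform_limitD)
    then obtain n where "\<forall>y\<in>K. dist (h n y) (H y) < e"
      using eventually_happens'[OF sequentially_bot] by blast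
    then have e: "\<And>y. y \<in> K \<Longrightarrow> \<bar>h n y - H y\<bar> < e" by (simp add: dist_real_def)
    have "?I (h n) - ?I H \<le> e" "?I H - ?I (h n) \<le> e"
      by (rule mono; use ch cH e in \<open>force simp: abs_less_iff\<close>)+
    moreover have "?I (h n) = h n x" using h r by (simp add: mean_value_on_def)
    ultimately show ?thesis using e[OF xK] by (simp add: abs_le_iff abs_less_iff)
  qed
  then have "\<bar>?I H - H x\<bar> \<le> e" if "e > 0" for e using that by (metis field_sum_of_halves half_gt_zero mult_2)
  then have "\<bar>?I H - H x\<bar> \<le> 0" by (rule field_le_epsilon) simp
  then show "?I H = H x" by simp
qed

lemma dirichlet_solvable_uniform_limit:
  fixes \<phi> :: "nat \<Rightarrow> 'a::euclidean_space \<Rightarrow> real"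
  assumes D: "\<And>n. dirichlet_solvable (\<phi> n)" and lim: "uniform_limit (sphere 0 1) \<phi> \<psi> sequentially"
  shows "dirichlet_solvable \<psi>"
proof -
  obtain h where h: "\<And>n. mean_value_on (cball 0 1) (h n)" "\<And>n x. x \<in> sphere 0 1 \<Longrightarrow> h n x = \<phi> n x"
    using D unfolding dirichlet_solvable_def by metis
  have "uniformly_Cauchy_on (cball 0 1) h"
    unfolding uniformly_Cauchy_on_def
  proof (intro allI impI)
    fix e :: real assume "e > 0"
    then have "e / 4 > 0" by simp
    from uniform_limitD[OF lim this] obtain M where M: "\<And>n x. n \<ge> M \<Longrightarrow> x \<in> sphere 0 1 \<Longrightarrow> \<bar>\<phi> n x - \<psi> x\<bar> < e / 4"
      unfolding eventually_sequentially dist_real_def by blast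
    have "h m y - h n y \<le> e / 2" if mn: "m \<ge> M" "n \<ge> M" and y: "y \<in> cball 0 1" for m n y
    proof (rule mean_value_on_le[where h="\<lambda>y. h m y - h n y", OF _ _ y])
      show "mean_value_on (cball 0 1) (\<lambda>y. h m y - h n y)"
        using mean_value_on_linear[OF h(1)[of m] h(1)[of n], of 1 "-1"] by simp
      fix x :: 'a assume x: "x \<in> sphere 0 1"
      show "h m x - h n x \<le> e / 2"
        using M[OF mn(1) x] M[OF mn(2) x] h(2)[OF x, of m] h(2)[OF x, of n] by linarith
    qed
    then have "dist (h m y) (h n y) < e" if "m \<ge> M" "n \<ge> M" "y \<in> cball 0 1" for m n y
      using that \<open>e > 0\<close> by (simp add: dist_real_def abs_le_iff) (smt (verit) field_sum_of_halves)
    then show "\<exists>M. \<forall>x\<in>cball 0 1. \<forall>m\<ge>M. \<forall>n\<ge>M. dist (h m x) (h n x) < e" by blast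
  qed
  then obtain H where H: "uniform_limit (cball 0 1) h H sequentially"
    using Cauchy_uniformly_convergent uniformly_convergent_on_def by blast
  have "mean_value_on (cball 0 1) H" by (rule mean_value_on_uniform_limit[OF h(1) H])
  moreover have "H x = \<psi> x" if x: "x \<in> sphere 0 1" for x
  proof -
    have "(\<lambda>n. h n x) \<longlonglongrightarrow> H x" using x by (intro tendsto_uniform_limitI[OF H]) auto
    moreover have "(\<lambda>n. h n x) \<longlonglongrightarrow> \<psi> x" using tendsto_uniform_limitI[OF lim x] h(2)[OF x] by simp
    ultimately show ?thesis by (rule LIMSEQ_unique)
  qed
  ultimately show ?thesis unfolding dirichlet_solvable_def by blast
qed

lemma has_laplacian_linear:
  assumes "has_laplacian F L" "has_laplacian H K"
  shows "has_laplacian (\<lambda>x. c * F x + d * H x) (\<lambda>x. c * L x + d * K x)"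
proof -
  obtain G G' where G: "\<And>x. (F has_derivative (\<lambda>v. v \<bullet> G x)) (at x)" "\<And>x. (G has_derivative G' x) (at x)"
    "\<And>v. continuous_on UNIV (\<lambda>x. G' x v)" "\<And>x. L x = (\<Sum>i\<in>Basis. G' x i \<bullet> i)"
    using has_laplacianE[OF assms(1)] by blast
  obtain J J' where J: "\<And>x. (H has_derivative (\<lambda>v. v \<bullet> J x)) (at x)" "\<And>x. (J has_derivative J' x) (at x)"
    "\<And>v. continuous_on UNIV (\<lambda>x. J' x v)" "\<And>x. K x = (\<Sum>i\<in>Basis. J' x i \<bullet> i)"
    using has_laplacianE[OF assms(2)] by blast
  show ?thesis unfolding has_laplacian_def
  proof (intro exI[of _ "\<lambda>x. c *\<^sub>R G x + d *\<^sub>R J x"] exI[of _ "\<lambda>x v. c *\<^sub>R G' x v + d *\<^sub>R J' x v"] conjI allI)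
    show "((\<lambda>x. c * F x + d * H x) has_derivative (\<lambda>v. v \<bullet> (c *\<^sub>R G x + d *\<^sub>R J x))) (at x)" for x
      by (auto intro!: derivative_eq_intros G(1) J(1) simp: inner_add_right)
    show "((\<lambda>x. c *\<^sub>R G x + d *\<^sub>R J x) has_derivative (\<lambda>v. c *\<^sub>R G' x v + d *\<^sub>R J' x v)) (at x)" for x
      by (intro derivative_intros G(2) J(2))
    show "continuous_on UNIV (\<lambda>x. c *\<^sub>R G' x v + d *\<^sub>R J' x v)" for v by (intro continuous_intros G(3) J(3))
    show "c * L x + d * K x = (\<Sum>i\<in>Basis. (c *\<^sub>R G' x i + d *\<^sub>R J' x i) \<bullet> i)" for x
      by (simp add: G(4) J(4) inner_add_left sum.distrib sum_distrib_left)
  qed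
qed

text \<open>
  With \<open>q = x \<bullet> x\<close> and \<open>s = a \<bullet> x\<close>, the Laplacian of \<open>q ^ j * s ^ m\<close> is a combination of
  \<open>q ^ (j - 1) * s ^ m\<close> and \<open>q ^ j * s ^ (m - 2)\<close>. Wherever the truncated subtraction of exponents would
  matter, the coefficient vanishes.
\<close>

lemma has_laplacian_radial_times_linear_power:
  fixes a :: "'a::euclidean_space"
  shows "has_laplacian (\<lambda>x. (x \<bullet> x) ^ j * (a \<bullet> x) ^ m)
    (\<lambda>x. 2 * real j * (2 * real j + 2 * real m + real DIM('a) - 2) * (x \<bullet> x) ^ (j - 1) * (a \<bullet> x) ^ m +
       real m * (real m - 1) * (a \<bullet> a) * (x \<bullet> x) ^ j * (a \<bullet> x) ^ (m - 2))"
  unfolding has_laplacian_def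
proof (intro exI conjI allI)
  define q s where "q x = x \<bullet> x" and "s x = a \<bullet> x" for x
  let ?G = "\<lambda>x. (2 * real j * (x \<bullet> x) ^ (j - 1) * (a \<bullet> x) ^ m) *\<^sub>R x + (real m * (x \<bullet> x) ^ j * (a \<bullet> x) ^ (m - 1)) *\<^sub>R a"
  let ?G' = "\<lambda>x v. (2 * real j * (real (j - 1) * (2 * (x \<bullet> v)) * (x \<bullet> x) ^ (j - 1 - 1)) * (a \<bullet> x) ^ m
        + 2 * real j * (x \<bullet> x) ^ (j - 1) * (real m * (a \<bullet> v) * (a \<bullet> x) ^ (m - 1))) *\<^sub>R x
      + (2 * real j * (x \<bullet> x) ^ (j - 1) * (a \<bullet> x) ^ m) *\<^sub>R v
      + (real m * (real j * (2 * (x \<bullet> v)) * (x \<bullet> x) ^ (j - 1)) * (a \<bullet> x) ^ (m - 1)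
        + real m * (x \<bullet> x) ^ j * (real (m - 1) * (a \<bullet> v) * (a \<bullet> x) ^ (m - 1 - 1))) *\<^sub>R a"
  have dq: "((\<lambda>x. x \<bullet> x) has_derivative (\<lambda>v. 2 * (x \<bullet> v))) (at x)" for x :: 'a
    by (auto intro!: derivative_eq_intros simp: inner_commute)
  have ds: "((\<lambda>x. a \<bullet> x) has_derivative (\<lambda>v. a \<bullet> v)) (at x)" for x
    by (auto intro!: derivative_eq_intros)
  show "((\<lambda>x. (x \<bullet> x) ^ j * (a \<bullet> x) ^ m) has_derivative (\<lambda>v. v \<bullet> ?G x)) (at x)" for x
    by (rule has_derivative_eq_rhs, (rule derivative_intros dq ds)+)
       (auto simp: fun_eq_iff inner_add_right inner_commute algebra_simps)
  show "(?G has_derivative ?G' x) (at x)" for x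
    by (rule has_derivative_eq_rhs, (rule derivative_intros dq ds)+)
       (auto simp: fun_eq_iff algebra_simps)
  show "continuous_on UNIV (\<lambda>x. ?G' x v)" for v
    by (intro continuous_intros)
  fix x
  have sx: "(\<Sum>i\<in>Basis. (x \<bullet> i) * (x \<bullet> i)) = q x" "(\<Sum>i\<in>Basis. (a \<bullet> i) * (x \<bullet> i)) = s x"
    "(\<Sum>i\<in>Basis. (x \<bullet> i) * (a \<bullet> i)) = s x" "(\<Sum>i\<in>Basis. (a \<bullet> i) * (a \<bullet> i)) = a \<bullet> a"
    "(\<Sum>i\<in>(Basis::'a set). i \<bullet> i) = real DIM('a)"
    by (simp_all add: q_def s_def euclidean_inner[of x x] euclidean_inner[of a x] euclidean_inner[of a a] mult.commute)
  have "(\<Sum>i\<in>Basis. ?G' x i \<bullet> i) =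
      (2 * real j * (real (j - 1) * 2 * q x ^ (j - 1 - 1)) * s x ^ m) * (\<Sum>i\<in>Basis. (x \<bullet> i) * (x \<bullet> i))
      + (2 * real j * q x ^ (j - 1) * (real m * s x ^ (m - 1))) * (\<Sum>i\<in>Basis. (a \<bullet> i) * (x \<bullet> i))
      + (2 * real j * q x ^ (j - 1) * s x ^ m) * (\<Sum>i\<in>(Basis::'a set). i \<bullet> i)
      + (real m * (real j * 2 * q x ^ (j - 1)) * s x ^ (m - 1)) * (\<Sum>i\<in>Basis. (x \<bullet> i) * (a \<bullet> i))
      + (real m * q x ^ j * (real (m - 1) * s x ^ (m - 1 - 1))) * (\<Sum>i\<in>Basis. (a \<bullet> i) * (a \<bullet> i))"
    unfolding q_def s_def sum_distrib_left sum.distrib[symmetric]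
    by (rule sum.cong[OF refl]) (simp add: inner_add_left algebra_simps)
  also have "\<dots> = 4 * real j * (real (j - 1) * q x ^ (j - 1 - 1) * q x) * s x ^ m
      + 4 * real j * q x ^ (j - 1) * (real m * s x ^ (m - 1) * s x)
      + 2 * real j * real DIM('a) * q x ^ (j - 1) * s x ^ m
      + (real m * real (m - 1)) * (a \<bullet> a) * q x ^ j * s x ^ (m - 2)"
    unfolding sx by (simp add: algebra_simps numeral_2_eq_2)
  also have "real (j - 1) * q x ^ (j - 1 - 1) * q x = real (j - 1) * q x ^ (j - 1)"
    by (cases "j - 1") auto
  also have "real m * s x ^ (m - 1) * s x = real m * s x ^ m"
    by (cases m) auto
  also have "real m * real (m - 1) = real m * (real m - 1)" by (cases m) auto
  also have "4 * real j * (real (j - 1) * q x ^ (j - 1)) * s x ^ m = 4 * real j * (real j - 1) * q x ^ (j - 1) * s x ^ m"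
    by (cases j) auto
  finally show "2 * real j * (2 * real j + 2 * real m + real DIM('a) - 2) * (x \<bullet> x) ^ (j - 1) * (a \<bullet> x) ^ m +
       real m * (real m - 1) * (a \<bullet> a) * (x \<bullet> x) ^ j * (a \<bullet> x) ^ (m - 2) = (\<Sum>i\<in>Basis. ?G' x i \<bullet> i)"
    unfolding q_def s_def by (simp add: algebra_simps)
qed

lemma laplacian_coefficient_pos:
  "2 * real (Suc j) * (2 * real (Suc j) + 2 * real m + real DIM('a::euclidean_space) - 2) > 0"
proof -
  have "0 < 2 * real j + 2 * real m + real DIM('a)" by (intro add_nonneg_pos) simp_all
  moreover have "2 * real (Suc j) + 2 * real m + real DIM('a) - 2 = 2 * real j + 2 * real m + real DIM('a)"
    by simp
  ultimately have "2 * real (Suc j) + 2 * real m + real DIM('a) - 2 > 0" by simp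
  then show ?thesis by (intro mult_pos_pos) auto
qed

text \<open>
  To solve \<open>\<Delta> F = q ^ j * s ^ m\<close>, start from \<open>q ^ (j + 1) * s ^ m\<close>, whose Laplacian is a nonzero
  multiple of the right hand side plus a multiple of \<open>q ^ (j + 1) * s ^ (m - 2)\<close>; the latter is removed by
  induction on \<open>m\<close>. On the unit sphere \<open>q = 1\<close>, so that \<open>F\<close> is a polynomial in \<open>s\<close> of degree at most
  \<open>m\<close> there, and its boundary values inherit solvability from the powers of \<open>s\<close>.
\<close>

lemma radial_power_equation:
  fixes a :: "'a::euclidean_space"
  assumes "\<And>i. i \<le> m \<Longrightarrow> dirichlet_solvable (\<lambda>x. (a \<bullet> x) ^ i)"
  shows "\<exists>F. has_laplacian F (\<lambda>x. (x \<bullet> x) ^ j * (a \<bullet> x) ^ m) \<and> dirichlet_solvable F"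
  using assms
proof (induction m arbitrary: j rule: less_induct)
  case (less m)
  define c where "c = 2 * real (Suc j) * (2 * real (Suc j) + 2 * real m + real DIM('a) - 2)"
  define b where "b = real m * (real m - 1) * (a \<bullet> a)"
  have c: "c > 0" unfolding c_def by (rule laplacian_coefficient_pos)
  have L: "has_laplacian (\<lambda>x. (x \<bullet> x) ^ Suc j * (a \<bullet> x) ^ m)
      (\<lambda>x. c * (x \<bullet> x) ^ j * (a \<bullet> x) ^ m + b * (x \<bullet> x) ^ Suc j * (a \<bullet> x) ^ (m - 2))"
    using has_laplacian_radial_times_linear_power[of "Suc j" a m] by (simp only: c_def b_def diff_Suc_1)
  have D: "dirichlet_solvable (\<lambda>x. (x \<bullet> x) ^ Suc j * (a \<bullet> x) ^ m)"
    by (rule dirichlet_solvable_cong[OF less.prems[OF order_refl]]) (simp add: dot_square_norm)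
  obtain H where H: "has_laplacian H (\<lambda>x. (x \<bullet> x) ^ Suc j * (a \<bullet> x) ^ (m - 2))" "dirichlet_solvable H" if "b \<noteq> 0"
  proof (cases "m < 2")
    case True
    then have "b = 0" unfolding b_def by (cases m) auto
    then show ?thesis using that by blast
  next
    case False
    then have "\<exists>F. has_laplacian F (\<lambda>x. (x \<bullet> x) ^ Suc j * (a \<bullet> x) ^ (m - 2)) \<and> dirichlet_solvable F"
      by (intro less.IH less.prems) auto
    then show ?thesis using that by blast
  qed
  show ?case
  proof (cases "b = 0")
    case True
    have "has_laplacian (\<lambda>x. (1 / c) * ((x \<bullet> x) ^ Suc j * (a \<bullet> x) ^ m) + 0 * ((x \<bullet> x) ^ Suc j * (a \<bullet> x) ^ m)) (\<lambda>x. (x \<bullet> x) ^ j * (a \<bullet> x) ^ m)"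
      using has_laplacian_linear[OF L L, of "1 / c" 0] c True by simp
    then show ?thesis using dirichlet_solvable_linear[OF D D, of "1 / c" 0] by blast
  next
    case False
    have "has_laplacian (\<lambda>x. (1 / c) * ((x \<bullet> x) ^ Suc j * (a \<bullet> x) ^ m) + (- b / c) * H x) (\<lambda>x. (x \<bullet> x) ^ j * (a \<bullet> x) ^ m)"
      using has_laplacian_linear[OF L H(1)[OF False], of "1 / c" "- b / c"] c by (simp add: field_simps)
    then show ?thesis using dirichlet_solvable_linear[OF D H(2)[OF False], of "1 / c" "- b / c"] by blast
  qed
qed

text \<open>
  Subtracting from \<open>s ^ k\<close> a solution \<open>F\<close> of the Poisson equation with the same Laplacian leaves a
  harmonic function, and the boundary values of \<open>F\<close> are covered by the induction hypothesis, since
  they have degree at most \<open>k - 2\<close> in \<open>s\<close>.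
\<close>

lemma dirichlet_solvable_linear_power:
  fixes a :: "'a::euclidean_space"
  shows "dirichlet_solvable (\<lambda>x. (a \<bullet> x) ^ k)"
proof (induction k rule: less_induct)
  case (less k)
  have L: "has_laplacian (\<lambda>x. (a \<bullet> x) ^ k) (\<lambda>x. real k * (real k - 1) * (a \<bullet> a) * (a \<bullet> x) ^ (k - 2))"
    using has_laplacian_radial_times_linear_power[of 0 a k] by simp
  show ?case
  proof (cases "k < 2")
    case True
    then have "(\<lambda>x. real k * (real k - 1) * (a \<bullet> a) * (a \<bullet> x) ^ (k - 2)) = (\<lambda>_. 0)"
      by (cases k) auto
    then show ?thesis using L by (intro dirichlet_solvable_harmonic) (simp only:)
  next
    case False
    define b where "b = real k * (real k - 1) * (a \<bullet> a)"
    have "\<exists>F. has_laplacian F (\<lambda>x. (x \<bullet> x) ^ 0 * (a \<bullet> x) ^ (k - 2)) \<and> dirichlet_solvable F"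
      by (intro radial_power_equation less) (use False in auto)
    then obtain F where F: "has_laplacian F (\<lambda>x. (a \<bullet> x) ^ (k - 2))" "dirichlet_solvable F" by auto
    have "has_laplacian (\<lambda>x. 1 * (a \<bullet> x) ^ k + (- b) * F x) (\<lambda>x. 0)"
      using has_laplacian_linear[OF L F(1), of 1 "- b"] by (simp add: b_def)
    then have "dirichlet_solvable (\<lambda>x. 1 * (a \<bullet> x) ^ k + (- b) * F x)" by (rule dirichlet_solvable_harmonic)
    from dirichlet_solvable_linear[OF this F(2), of 1 b] show ?thesis by simp
  qed
qed

lemma dirichlet_solvable_exp:
  fixes a :: "'a::euclidean_space"
  shows "dirichlet_solvable (\<lambda>x. exp (a \<bullet> x))"
proof (rule dirichlet_solvable_uniform_limit)
  show "dirichlet_solvable (\<lambda>x. \<Sum>k<n. (a \<bullet> x) ^ k /\<^sub>R fact k)" for n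
  proof (induction n)
    case 0
    show ?case using dirichlet_solvable_linear[OF dirichlet_solvable_linear_power dirichlet_solvable_linear_power, of 0 a 0 0 a 0] by simp
  next
    case (Suc n)
    show ?case
      using dirichlet_solvable_linear[OF Suc dirichlet_solvable_linear_power[of a n], of 1 "inverse (fact n)"] by simp
  qed
  have "uniform_limit (sphere 0 1) (\<lambda>n x. \<Sum>k<n. (a \<bullet> x) ^ k /\<^sub>R fact k) (\<lambda>x. \<Sum>k. (a \<bullet> x) ^ k /\<^sub>R fact k) sequentially"
  proof (rule Weierstrass_m_test)
    show "summable (\<lambda>k. norm a ^ k /\<^sub>R fact k)" by (rule summable_exp_generic)
    fix k and x :: 'a assume "x \<in> sphere 0 1"
    then have "\<bar>a \<bullet> x\<bar> \<le> norm a" using Cauchy_Schwarz_ineq2[of a x] by simp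
    then show "norm ((a \<bullet> x) ^ k /\<^sub>R fact k) \<le> norm a ^ k /\<^sub>R fact k"
      by (auto simp: abs_mult power_abs intro!: mult_left_mono power_mono)
  qed
  then show "uniform_limit (sphere 0 1) (\<lambda>n x. \<Sum>k<n. (a \<bullet> x) ^ k /\<^sub>R fact k) (\<lambda>x. exp (a \<bullet> x)) sequentially"
    by (simp add: exp_def)
qed

inductive exponential_sum :: "('a::euclidean_space \<Rightarrow> real) \<Rightarrow> bool" where
  exp: "exponential_sum (\<lambda>x. c * exp (a \<bullet> x))"
| add: "exponential_sum f \<Longrightarrow> exponential_sum g \<Longrightarrow> exponential_sum (\<lambda>x. f x + g x)"

lemma exponential_sum_mult:
  assumes "exponential_sum f" "exponential_sum g"
  shows "exponential_sum (\<lambda>x. f x * g x)"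
  using assms(1)
proof induction
  case (exp c a)
  show ?case using assms(2)
  proof induction
    case (exp d b)
    have "(\<lambda>x. c * exp (a \<bullet> x) * (d * exp (b \<bullet> x))) = (\<lambda>x. (c * d) * exp ((a + b) \<bullet> x))"
      by (simp add: fun_eq_iff exp_add inner_add_left)
    then show ?case by (metis exponential_sum.exp)
  next
    case (add f g)
    then show ?case using exponential_sum.add by (simp add: distrib_left)
  qed
next
  case (add f g)
  then show ?case using exponential_sum.add by (simp add: distrib_right)
qed

lemma dirichlet_solvable_exponential_sum: "exponential_sum f \<Longrightarrow> dirichlet_solvable f"
proof (induction rule: exponential_sum.induct)
  case (exp c a)
  show ?case using dirichlet_solvable_linear[OF dirichlet_solvable_exp dirichlet_solvable_exp, of c a 0 a] by simp
next
  case (add f g)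
  show ?case using dirichlet_solvable_linear[OF add.IH, of 1 1] by simp
qed

lemma dirichlet_solvable_continuous:
  fixes \<phi> :: "'a::euclidean_space \<Rightarrow> real"
  assumes "continuous_on (sphere 0 1) \<phi>"
  shows "dirichlet_solvable \<phi>"
proof -
  interpret function_ring_on "Collect exponential_sum :: ('a \<Rightarrow> real) set" "sphere 0 1"
  proof
    show "compact (sphere (0::'a) 1)" by (rule compact_sphere)
    show "continuous_on (sphere 0 1) f" if "f \<in> Collect exponential_sum" for f :: "'a \<Rightarrow> real"
    proof -
      have "exponential_sum f" using that by simp
      then show ?thesis by induction (auto intro!: continuous_intros)
    qed
    show "(\<lambda>_. c) \<in> Collect exponential_sum" for c
      using exponential_sum.exp[of c 0] by simp
    show "\<exists>f\<in>Collect exponential_sum. f x \<noteq> f y" if "x \<noteq> y" for x y :: 'a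
    proof
      show "(\<lambda>z. 1 * exp ((x - y) \<bullet> z)) \<in> Collect exponential_sum" using exponential_sum.exp by blast
      have "(x - y) \<bullet> x \<noteq> (x - y) \<bullet> y" using that by (metis inner_diff_right inner_eq_zero_iff right_minus_eq)
      then show "1 * exp ((x - y) \<bullet> x) \<noteq> 1 * exp ((x - y) \<bullet> y)" by simp
    qed
  qed (auto intro: exponential_sum.add exponential_sum_mult)
  obtain F where F: "\<And>n. exponential_sum (F n)" "uniform_limit (sphere 0 1) F \<phi> sequentially"
    using Stone_Weierstrass[OF assms] by (auto simp: Pi_iff)
  show ?thesis
    by (rule dirichlet_solvable_uniform_limit[OF dirichlet_solvable_exponential_sum[OF F(1)] F(2)])
qed

theorem dirichlet_problem_ball:
  fixes \<phi> :: "'a::euclidean_space \<Rightarrow> real"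
  assumes R: "0 < R" and \<phi>: "continuous_on (sphere a R) \<phi>"
  obtains h where "mean_value_on (cball a R) h" "\<And>x. x \<in> sphere a R \<Longrightarrow> h x = \<phi> x"
proof -
  have "continuous_on (sphere 0 1) (\<lambda>z. \<phi> (a + R *\<^sub>R z))"
    by (rule continuous_on_compose2[OF \<phi>]) (use R in \<open>auto intro!: continuous_intros simp: dist_norm\<close>)
  then have "dirichlet_solvable (\<lambda>z. \<phi> (a + R *\<^sub>R z))" by (rule dirichlet_solvable_continuous)
  then obtain g where g: "mean_value_on (cball 0 1) g" "\<And>z. z \<in> sphere 0 1 \<Longrightarrow> g z = \<phi> (a + R *\<^sub>R z)"
    unfolding dirichlet_solvable_def by blast
  define T where "T x = (1 / R) *\<^sub>R (x - a)" for x
  have T: "T x \<in> cball 0 1 \<longleftrightarrow> x \<in> cball a R" "T x \<in> sphere 0 1 \<longleftrightarrow> x \<in> sphere a R" "a + R *\<^sub>R T x = x" for x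
  proof -
    have "norm (T x) = dist a x / R" using R by (simp add: T_def dist_norm norm_minus_commute)
    then show "T x \<in> cball 0 1 \<longleftrightarrow> x \<in> cball a R" "T x \<in> sphere 0 1 \<longleftrightarrow> x \<in> sphere a R"
      using R by (auto simp: divide_le_eq_1 divide_eq_1_iff)
    show "a + R *\<^sub>R T x = x" using R by (simp add: T_def)
  qed
  show ?thesis
  proof (rule that[of "\<lambda>x. g (T x)"])
    show "g (T x) = \<phi> x" if "x \<in> sphere a R" for x using g(2)[of "T x"] T that by simp
    show "mean_value_on (cball a R) (\<lambda>x. g (T x))"
      unfolding mean_value_on_def
    proof (intro conjI allI impI)
      have "continuous_on (cball 0 1) g" using g(1) by (simp add: mean_value_on_def)
      then show "continuous_on (cball a R) (\<lambda>x. g (T x))"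
        by (rule continuous_on_compose2) (use T(1) in \<open>auto simp: T_def intro!: continuous_intros\<close>)
      fix x r assume r: "0 < r" "cball x r \<subseteq> cball a R"
      have "cball (T x) (r / R) \<subseteq> cball 0 1"
      proof
        fix y assume "y \<in> cball (T x) (r / R)"
        moreover have "dist x (a + R *\<^sub>R y) = R * dist (T x) y"
        proof -
          have "x - (a + R *\<^sub>R y) = R *\<^sub>R (T x - y)" using T(3)[of x] by (simp add: algebra_simps)
          then show ?thesis using R by (simp add: dist_norm)
        qed
        ultimately have "a + R *\<^sub>R y \<in> cball x r" using R by (simp add: field_simps)
        then have "a + R *\<^sub>R y \<in> cball a R" using r(2) by blast
        then show "y \<in> cball 0 1" using R by (simp add: dist_norm)
      qed
      moreover have "T (x + r *\<^sub>R z) = T x + (r / R) *\<^sub>R z" for z by (simp add: T_def algebra_simps)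
      ultimately show "(LINT z:sphere 0 1|sphere_measure. g (T (x + r *\<^sub>R z))) = g (T x)"
        using g(1) r(1) R by (simp add: mean_value_on_def)
    qed
  qed
qed

section \<open>Locality of subharmonicity\<close>

text \<open>
  The sup-convolutions \<open>\<phi> n x = (SUP y. max (u y) (-n) - n * dist x y)\<close> are Lipschitz, decrease in \<open>n\<close>
  and lie above \<open>u\<close>. For large \<open>n\<close> only points \<open>y\<close> near \<open>x\<close> compete, and there \<open>u\<close> is at most
  slightly larger than \<open>u x\<close>. The cut-off at \<open>-n\<close> keeps the functions real-valued where
  \<open>u = -\<infinity>\<close>.
\<close>

lemma usc_decreasing_continuous_approximation:
  fixes S :: "'a::metric_space set"
  assumes "S \<noteq> {}" and u: "usc_on S u" and bd: "\<And>x. x \<in> S \<Longrightarrow> u x \<le> ereal M"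
  obtains \<phi> :: "nat \<Rightarrow> 'a \<Rightarrow> real" where "\<And>n. continuous_on UNIV (\<phi> n)" "\<And>n x. \<phi> (Suc n) x \<le> \<phi> n x"
    "\<And>n x. x \<in> S \<Longrightarrow> u x \<le> ereal (\<phi> n x)" "\<And>x. x \<in> S \<Longrightarrow> (INF n. ereal (\<phi> n x)) = u x"
    "\<And>n x. \<phi> n x \<le> \<bar>M\<bar>"
proof -
  define b where "b n y = real_of_ereal (max (u y) (ereal (- real n)))" for n y
  have b: "ereal (b n y) = max (u y) (ereal (- real n))" if "y \<in> S" for n y
    using bd[OF that] by (cases "u y") (auto simp: b_def max_def)
  have b_le: "b n y \<le> \<bar>M\<bar>" if "y \<in> S" for n y
  proof -
    have "ereal (b n y) \<le> ereal \<bar>M\<bar>"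
      unfolding b[OF that] using order_trans[OF bd[OF that], of "ereal \<bar>M\<bar>"] by simp
    then show ?thesis by simp
  qed
  have b_dec: "b (Suc n) y \<le> b n y" if "y \<in> S" for n y
  proof -
    have "ereal (b (Suc n) y) \<le> ereal (b n y)"
      unfolding b[OF that] by (rule max.mono) auto
    then show ?thesis by simp
  qed
  define \<phi> where "\<phi> n x = (SUP y\<in>S. b n y - real n * dist x y)" for n x
  have le_M: "b n y - real n * dist x y \<le> \<bar>M\<bar>" if "y \<in> S" for n x y
  proof -
    have "0 \<le> real n * dist x y" by simp
    then show ?thesis using b_le[OF that, of n] by linarith
  qed
  have bdd: "bdd_above ((\<lambda>y. b n y - real n * dist x y) ` S)" for n x
    by (rule bdd_aboveI2) (rule le_M)
  have lip: "\<phi> n x \<le> \<phi> n x' + real n * dist x x'" for n x x'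
    unfolding \<phi>_def
  proof (rule cSUP_least[OF \<open>S \<noteq> {}\<close>])
    fix y assume y: "y \<in> S"
    have "real n * dist x' y \<le> real n * (dist x y + dist x x')"
      by (rule mult_left_mono) (metis add.commute dist_commute dist_triangle, simp)
    moreover have "b n y - real n * dist x' y \<le> (SUP y\<in>S. b n y - real n * dist x' y)"
      by (rule cSUP_upper[OF y bdd])
    ultimately show "b n y - real n * dist x y \<le> (SUP y\<in>S. b n y - real n * dist x' y) + real n * dist x x'"
      by (simp add: algebra_simps)
  qed
  show ?thesis
  proof (rule that[of \<phi>])
    show "\<phi> n x \<le> \<bar>M\<bar>" for n x unfolding \<phi>_def by (rule cSUP_least[OF \<open>S \<noteq> {}\<close> le_M])
    show "continuous_on UNIV (\<phi> n)" for n
      unfolding continuous_on_iff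
    proof (intro ballI allI impI)
      fix x and e :: real assume "0 < e"
      have "dist (\<phi> n x') (\<phi> n x) < e" if "dist x' x < e / (real n + 1)" for x'
      proof -
        have "real n * dist x' x \<le> (real n + 1) * dist x' x" by (simp add: algebra_simps)
        also have "\<dots> < e" using that by (simp add: field_simps)
        finally show ?thesis using lip[of n x x'] lip[of n x' x] by (simp add: dist_real_def dist_commute abs_less_iff)
      qed
      then show "\<exists>d>0. \<forall>x'\<in>UNIV. dist x' x < d \<longrightarrow> dist (\<phi> n x') (\<phi> n x) < e"
        using \<open>0 < e\<close> by (intro exI[of _ "e / (real n + 1)"]) auto
    qed
    show "\<phi> (Suc n) x \<le> \<phi> n x" for n x
      unfolding \<phi>_def
    proof (rule cSUP_mono[OF \<open>S \<noteq> {}\<close> bdd])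
      fix y assume "y \<in> S"
      moreover have "real n * dist x y \<le> real (Suc n) * dist x y" by (rule mult_right_mono) auto
      ultimately show "\<exists>z\<in>S. b (Suc n) y - real (Suc n) * dist x y \<le> b n z - real n * dist x z"
        using b_dec[of y n] by (intro bexI[of _ y]) auto
    qed
    show ge: "u x \<le> ereal (\<phi> n x)" if x: "x \<in> S" for n x
    proof -
      have "b n x \<le> \<phi> n x" unfolding \<phi>_def using cSUP_upper[OF x bdd, of n x] by simp
      then have "ereal (b n x) \<le> ereal (\<phi> n x)" by simp
      then show ?thesis unfolding b[OF x] by simp
    qed
    show "(INF n. ereal (\<phi> n x)) = u x" if x: "x \<in> S" for x
    proof (rule antisym)
      show "u x \<le> (INF n. ereal (\<phi> n x))" by (rule INF_greatest) (rule ge[OF x])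
      show "(INF n. ereal (\<phi> n x)) \<le> u x"
      proof (rule ccontr)
        assume "\<not> (INF n. ereal (\<phi> n x)) \<le> u x"
        then obtain c where c: "u x < ereal c" "ereal c < (INF n. ereal (\<phi> n x))"
          using ereal_dense2 by (meson not_le)
        obtain d where d: "d > 0" "\<And>y. y \<in> S \<Longrightarrow> dist y x < d \<Longrightarrow> u y < ereal c"
          using usc_onD[OF u x c(1)] by blast
        obtain n where n: "real n \<ge> max (- c) ((\<bar>M\<bar> - c) / d)" using real_arch_simple by blast
        have "\<phi> n x \<le> c"
          unfolding \<phi>_def
        proof (rule cSUP_least[OF \<open>S \<noteq> {}\<close>])
          fix y assume y: "y \<in> S"
          show "b n y - real n * dist x y \<le> c"
          proof (cases "dist y x < d")
            case True
            have "ereal (b n y) \<le> ereal c"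
              unfolding b[OF y] using d(2)[OF y True] n by (auto intro: less_imp_le)
            then have "b n y \<le> c" by simp
            moreover have "0 \<le> real n * dist x y" by simp
            ultimately show ?thesis by linarith
          next
            case False
            have "\<bar>M\<bar> - c \<le> real n * d" using n d(1) by (simp add: field_simps)
            also have "\<dots> \<le> real n * dist x y" using False by (intro mult_left_mono) (auto simp: dist_commute)
            finally show ?thesis using b_le[OF y, of n] by linarith
          qed
        qed
        moreover have "ereal c < ereal (\<phi> n x)" using c(2) by (rule less_le_trans) (rule INF_lower, simp)
        ultimately show False by simp
      qed
    qed
  qed
qed

lemma sphere_deficit_cong:
  assumes "0 < r" "\<And>y. y \<in> sphere x r \<Longrightarrow> u y = v y"
  shows "sphere_deficit M u x r = sphere_deficit M v x r"
  unfolding sphere_deficit_def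
  by (rule nn_integral_cong) (use assms in \<open>auto simp: indicator_def dist_norm\<close>)

lemma sphere_deficit_INF:
  fixes v :: "nat \<Rightarrow> 'a::euclidean_space \<Rightarrow> ereal"
  assumes r: "0 < r" and v: "\<And>n. usc_on (sphere x r) (v n)"
    and dec: "\<And>n y. y \<in> sphere x r \<Longrightarrow> v (Suc n) y \<le> v n y"
  shows "sphere_deficit M (\<lambda>y. INF n. v n y) x r = (SUP n. sphere_deficit M (v n) x r)"
proof -
  define f where "f n z = e2ennreal (ereal M - v n (x + r *\<^sub>R z)) * indicator (sphere 0 1) z" for n z
  have in_sphere: "x + r *\<^sub>R z \<in> sphere x r" if "z \<in> sphere 0 1" for z
    using that r by (simp add: dist_norm)
  have step: "ereal M - v n (x + r *\<^sub>R z) \<le> ereal M - v (Suc n) (x + r *\<^sub>R z)" if "z \<in> sphere 0 1" for n z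
    using dec[OF in_sphere[OF that], of n] by (intro ereal_minus_mono) auto
  have "incseq f"
    by (rule incseq_SucI) (use step in \<open>auto simp: le_fun_def f_def indicator_def intro!: e2ennreal_mono\<close>)
  moreover have "f n \<in> borel_measurable sphere_measure" for n
    unfolding f_def using measurable_on_sphere[OF v order_refl r, of "\<lambda>t. e2ennreal (ereal M - t)"] by simp
  ultimately have "(SUP n. integral\<^sup>N sphere_measure (f n)) = (\<integral>\<^sup>+z. (SUP n. f n z) \<partial>sphere_measure)"
    by (rule nn_integral_monotone_convergence_SUP[symmetric])
  also have "\<dots> = sphere_deficit M (\<lambda>y. INF n. v n y) x r"
    unfolding sphere_deficit_def
  proof (rule nn_integral_cong)
    fix z :: 'a
    show "(SUP n. f n z) = e2ennreal (ereal M - (INF n. v n (x + r *\<^sub>R z))) * indicator (sphere 0 1) z"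
    proof (cases "z \<in> sphere 0 1")
      case True
      have "incseq (\<lambda>n. ereal M - v n (x + r *\<^sub>R z))" by (rule incseq_SucI) (rule step[OF True])
      then have "e2ennreal (SUP n. ereal M - v n (x + r *\<^sub>R z)) = (SUP n. e2ennreal (ereal M - v n (x + r *\<^sub>R z)))"
        by (intro sup_continuousD[OF sup_continuous_e2ennreal[OF sup_continuous_id]])
           (auto simp: mono_iff_le_Suc incseq_def)
      moreover have "(SUP n. ereal M - v n (x + r *\<^sub>R z)) = ereal M - (INF n. v n (x + r *\<^sub>R z))"
        by (rule SUP_ereal_minus_right) auto
      ultimately show ?thesis using True by (simp add: f_def)
    qed (simp add: f_def)
  qed
  finally show ?thesis unfolding sphere_deficit_def f_def by (rule sym)
qed

text \<open>
  Compare \<open>u\<close> with the harmonic functions whose boundary values are continuous functions decreasing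
  to \<open>u\<close>. By the maximum principle \<open>u\<close> lies below each of them, in particular at the centre, where
  the value is the mean of the boundary values; then pass to the limit.
\<close>

lemma submean_from_local:
  fixes u :: "'a::euclidean_space \<Rightarrow> ereal"
  assumes R: "0 < R" and u: "usc_on (cball a R) u" "\<And>x. x \<in> cball a R \<Longrightarrow> u x < \<infinity>"
    and sub: "\<And>x. x \<in> ball a R \<Longrightarrow> \<exists>r>0. cball x r \<subseteq> cball a R \<and> u x \<le> spherical_mean u x r"
  shows "u a \<le> spherical_mean u a R"
proof -
  have us: "usc_on (sphere a R) u" using usc_on_subset[OF u(1) sphere_cball] .
  obtain M where M: "\<And>x. x \<in> cball a R \<Longrightarrow> u x \<le> ereal M"
    using usc_on_compact_bounded[OF compact_cball u] by blast
  have Ms: "\<And>x. x \<in> sphere a R \<Longrightarrow> u x \<le> ereal M" using M sphere_cball by blast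
  have ne: "sphere a R \<noteq> {}" using R by simp
  obtain \<phi> where \<phi>: "\<And>n. continuous_on UNIV (\<phi> n)" "\<And>n x. \<phi> (Suc n) x \<le> \<phi> n x"
    "\<And>n x. x \<in> sphere a R \<Longrightarrow> u x \<le> ereal (\<phi> n x)" "\<And>x. x \<in> sphere a R \<Longrightarrow> (INF n. ereal (\<phi> n x)) = u x"
    and \<phi>M: "\<And>n x. \<phi> n x \<le> \<bar>M\<bar>"
    by (rule usc_decreasing_continuous_approximation[OF ne us Ms]) blast+
  have c\<phi>: "continuous_on (sphere a R) (\<phi> n)" for n using \<phi>(1) by (rule continuous_on_subset) simp
  have uM: "u x \<le> ereal \<bar>M\<bar>" if "x \<in> cball a R" for x using M[OF that] by (rule order_trans) simp
  have le: "sphere_deficit \<bar>M\<bar> (\<lambda>x. ereal (\<phi> n x)) a R \<le> e2ennreal (ereal \<bar>M\<bar> - u a)" for n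
  proof -
    obtain h where h: "mean_value_on (cball a R) h" "\<And>x. x \<in> sphere a R \<Longrightarrow> h x = \<phi> n x"
      using dirichlet_problem_ball[OF R c\<phi>] by blast
    have "u a \<le> ereal (h a)"
      by (rule submean_le_mean_value[OF u sub h(1)]) (use h(2) \<phi>(3) R in auto)
    also have "h a = (sphere_integral h a R)"
      using h(1) R by (simp add: mean_value_on_def)
    also have "\<dots> = (sphere_integral (\<phi> n) a R)"
      by (rule set_lebesgue_integral_cong) (use h(2) R in \<open>auto simp: dist_norm\<close>)
    finally have "ereal \<bar>M\<bar> - ereal (sphere_integral (\<phi> n) a R) \<le> ereal \<bar>M\<bar> - u a"
      by (intro ereal_minus_mono) auto
    then have "e2ennreal (ereal (\<bar>M\<bar> - (sphere_integral (\<phi> n) a R))) \<le> e2ennreal (ereal \<bar>M\<bar> - u a)"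
      by (intro e2ennreal_mono) simp
    then show ?thesis
      using sphere_deficit_continuous(1)[OF c\<phi> R \<phi>M] by simp
  qed
  have "sphere_deficit \<bar>M\<bar> u a R = sphere_deficit \<bar>M\<bar> (\<lambda>x. INF n. ereal (\<phi> n x)) a R"
    by (rule sphere_deficit_cong[OF R]) (simp add: \<phi>(4))
  also have "\<dots> = (SUP n. sphere_deficit \<bar>M\<bar> (\<lambda>x. ereal (\<phi> n x)) a R)"
    by (rule sphere_deficit_INF[OF R usc_on_continuous[OF c\<phi>]]) (use \<phi>(2) in simp)
  also have "\<dots> \<le> e2ennreal (ereal \<bar>M\<bar> - u a)" by (rule SUP_least) (rule le)
  finally show ?thesis using submean_iff_deficit[OF u(1) order_refl R uM] by simp
qed

lemma subharmonic_onI_local: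
  fixes u :: "'a::euclidean_space \<Rightarrow> ereal"
  assumes u: "usc_on \<Omega> u" "\<And>x. x \<in> \<Omega> \<Longrightarrow> u x < \<infinity>"
    and local: "\<And>x. x \<in> \<Omega> \<Longrightarrow> \<exists>\<rho>>0. \<forall>r. 0 < r \<longrightarrow> r < \<rho> \<longrightarrow> u x \<le> spherical_mean u x r"
  shows "subharmonic_on \<Omega> u"
  unfolding subharmonic_on_def
proof (intro conjI allI impI ballI)
  fix a R assume R: "0 < R" "cball a R \<subseteq> \<Omega>"
  show "u a \<le> spherical_mean u a R"
  proof (rule submean_from_local[OF R(1) usc_on_subset[OF u(1) R(2)]])
    fix x assume x: "x \<in> ball a R"
    then obtain e where e: "e > 0" "ball x e \<subseteq> ball a R" by (meson open_ball open_contains_ball)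
    have "x \<in> \<Omega>" using x R ball_subset_cball by blast
    then obtain \<rho> where \<rho>: "\<rho> > 0" "\<And>r. 0 < r \<Longrightarrow> r < \<rho> \<Longrightarrow> u x \<le> spherical_mean u x r" using local by blast
    define r where "r = min e \<rho> / 2"
    have r: "0 < r" "r < e" "r < \<rho>" using e \<rho> by (auto simp: r_def)
    have "cball x r \<subseteq> ball x e" using r(2) by auto
    then have "cball x r \<subseteq> cball a R" using e(2) ball_subset_cball[of a R] by blast
    then show "\<exists>r>0. cball x r \<subseteq> cball a R \<and> u x \<le> spherical_mean u x r" using r \<rho>(2) by blast
  qed (use u(2) R in auto)
qed (use u in auto)

lemma spherical_mean_cong:
  fixes u :: "'a::euclidean_space \<Rightarrow> ereal"
  assumes "0 < r" "\<And>y. y \<in> sphere x r \<Longrightarrow> u y = v y"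
  shows "spherical_mean u x r = spherical_mean v x r"
  by (rule antisym; rule spherical_mean_mono) (use assms in auto)

text \<open>
  At points outside the ball, and on its boundary, the sub-mean value property is inherited from
  \<open>u\<close>, since the new function is nowhere smaller; at points of the ball it holds for small spheres.
  The boundary condition on \<open>g\<close> is what upper semicontinuity across the sphere requires. Locality of
  subharmonicity does the rest.
\<close>

lemma subharmonic_glue:
  fixes u g :: "'a::euclidean_space \<Rightarrow> ereal"
  assumes \<Omega>: "open \<Omega>" "ball a R \<subseteq> \<Omega>" and u: "subharmonic_on \<Omega> u"
    and g: "usc_on (ball a R) g" "\<And>x. x \<in> ball a R \<Longrightarrow> g x < \<infinity>"
      "\<And>x r. 0 < r \<Longrightarrow> cball x r \<subseteq> ball a R \<Longrightarrow> g x \<le> spherical_mean g x r"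
    and boundary: "\<And>y c. y \<in> sphere a R \<Longrightarrow> u y < c \<Longrightarrow> \<exists>d>0. \<forall>x\<in>ball a R. dist x y < d \<longrightarrow> g x < c"
  shows "subharmonic_on \<Omega> (\<lambda>x. if x \<in> ball a R then max (u x) (g x) else u x)" (is "subharmonic_on \<Omega> ?Q")
proof (rule subharmonic_onI_local)
  have uu: "usc_on \<Omega> u" "\<And>x. x \<in> \<Omega> \<Longrightarrow> u x < \<infinity>"
    "\<And>x r. 0 < r \<Longrightarrow> cball x r \<subseteq> \<Omega> \<Longrightarrow> u x \<le> spherical_mean u x r"
    using u unfolding subharmonic_on_def by auto
  show "?Q x < \<infinity>" if "x \<in> \<Omega>" for x using uu(2)[OF that] g(2)[of x] by (auto simp: max_def)
  show "usc_on \<Omega> ?Q"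
  proof (rule usc_onI)
    fix x c assume x: "x \<in> \<Omega>" "?Q x < c"
    have "u x < c" using x(2) by (auto split: if_splits)
    then obtain d1 where d1: "d1 > 0" "\<And>y. y \<in> \<Omega> \<Longrightarrow> dist y x < d1 \<Longrightarrow> u y < c" using usc_onD[OF uu(1) x(1)] by blast
    have "\<exists>d>0. \<forall>y\<in>ball a R. dist y x < d \<longrightarrow> g y < c"
    proof -
      consider "x \<in> ball a R" | "x \<in> sphere a R" | "x \<notin> cball a R" by force
      then show ?thesis
      proof cases
        case 1
        then have "g x < c" using x(2) by simp
        then show ?thesis using usc_onD[OF g(1) 1] by metis
      next
        case 2
        then show ?thesis using boundary[OF 2 \<open>u x < c\<close>] by blast
      next
        case 3
        then have "y \<notin> ball a R" if "dist y x < dist a x - R" for y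
          using that dist_triangle[of a x y] by auto
        then show ?thesis using 3 by (intro exI[of _ "dist a x - R"]) auto
      qed
    qed
    then obtain d2 where "d2 > 0" "\<And>y. y \<in> ball a R \<Longrightarrow> dist y x < d2 \<Longrightarrow> g y < c" by blast
    then show "\<exists>d>0. \<forall>y\<in>\<Omega>. dist y x < d \<longrightarrow> ?Q y < c"
      using d1 by (intro exI[of _ "min d1 d2"]) auto
  qed
  fix x assume x: "x \<in> \<Omega>"
  obtain e where e: "e > 0" "cball x e \<subseteq> \<Omega>" using \<Omega>(1) x open_contains_cball by blast
  have sub: "u x \<le> spherical_mean u x r" if "0 < r" "r < e" for r
    using that e(2) by (intro uu(3)) (auto simp: subset_iff)
  show "\<exists>\<rho>>0. \<forall>r. 0 < r \<longrightarrow> r < \<rho> \<longrightarrow> ?Q x \<le> spherical_mean ?Q x r"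
  proof (cases "x \<in> ball a R")
    case False
    have "?Q x \<le> spherical_mean ?Q x r" if r: "0 < r" "r < e" for r
    proof -
      have "?Q x = u x" using False by simp
      also note sub[OF r]
      also have "spherical_mean u x r \<le> spherical_mean ?Q x r" by (rule spherical_mean_mono[OF r(1)]) auto
      finally show ?thesis .
    qed
    then show ?thesis using e(1) by blast
  next
    case True
    then obtain d where d: "d > 0" "cball x d \<subseteq> ball a R" using open_ball open_contains_cball by blast
    have "?Q x \<le> spherical_mean ?Q x r" if r: "0 < r" "r < min d e" for r
    proof -
      have c: "cball x r \<subseteq> ball a R" using d(2) r by (auto simp: subset_iff)
      have "?Q x = max (u x) (g x)" using True by simp
      also have "\<dots> \<le> spherical_mean (\<lambda>y. max (u y) (g y)) x r"
        using r c by (intro submean_max sub g(3)) auto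
      also have "\<dots> = spherical_mean ?Q x r"
        by (rule spherical_mean_cong[OF r(1)]) (use c sphere_cball in auto)
      finally show ?thesis .
    qed
    then show ?thesis using d(1) e(1) by (intro exI[of _ "min d e"]) auto
  qed
qed

section \<open>Raising a subharmonic minorant at a point\<close>

text \<open>
  The means of continuous functions decreasing to \<open>W\<close> converge to the mean of \<open>W\<close>, by monotone
  convergence of the deficits.
\<close>

lemma continuous_majorant_mean:
  fixes W :: "'a::euclidean_space \<Rightarrow> ereal"
  assumes R: "0 < R" and W: "usc_on (sphere a R) W" "\<And>x. x \<in> sphere a R \<Longrightarrow> W x \<le> ereal M"
    and mean: "spherical_mean W a R = ereal A" and e: "0 < e"
  obtains \<phi> :: "'a \<Rightarrow> real" where "continuous_on UNIV \<phi>" "\<And>x. x \<in> sphere a R \<Longrightarrow> W x \<le> ereal (\<phi> x)"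
    "\<And>x. \<phi> x \<le> \<bar>M\<bar>" "(sphere_integral \<phi> a R) \<le> A + e"
proof -
  let ?I = "\<lambda>f. sphere_integral f a R"
  have ne: "sphere a R \<noteq> {}" using R by simp
  obtain \<phi> where \<phi>: "\<And>n. continuous_on UNIV (\<phi> n)" "\<And>n x. \<phi> (Suc n) x \<le> \<phi> n x"
    "\<And>n x. x \<in> sphere a R \<Longrightarrow> W x \<le> ereal (\<phi> n x)" "\<And>x. x \<in> sphere a R \<Longrightarrow> (INF n. ereal (\<phi> n x)) = W x"
    "\<And>n x. \<phi> n x \<le> \<bar>M\<bar>"
    by (rule usc_decreasing_continuous_approximation[OF ne W]) blast+
  have c\<phi>: "continuous_on (sphere a R) (\<phi> n)" for n using \<phi>(1) by (rule continuous_on_subset) simp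
  have "\<exists>n. ?I (\<phi> n) \<le> A + e"
  proof (rule ccontr)
    assume "\<nexists>n. ?I (\<phi> n) \<le> A + e"
    then have I: "A + e < ?I (\<phi> n)" for n by (simp add: not_le)
    have IM: "?I (\<phi> n) \<le> \<bar>M\<bar>" for n by (rule sphere_deficit_continuous(2)[OF c\<phi> R \<phi>(5)])
    have "sphere_deficit \<bar>M\<bar> W a R = sphere_deficit \<bar>M\<bar> (\<lambda>x. INF n. ereal (\<phi> n x)) a R"
      by (rule sphere_deficit_cong[OF R]) (simp add: \<phi>(4))
    also have "\<dots> = (SUP n. sphere_deficit \<bar>M\<bar> (\<lambda>x. ereal (\<phi> n x)) a R)"
      by (rule sphere_deficit_INF[OF R usc_on_continuous[OF c\<phi>]]) (use \<phi>(2) in simp)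
    also have "\<dots> \<le> ennreal (\<bar>M\<bar> - (A + e))"
    proof (rule SUP_least)
      fix n
      have "\<bar>M\<bar> - ?I (\<phi> n) \<le> \<bar>M\<bar> - (A + e)" using I[of n] by linarith
      moreover have "sphere_deficit \<bar>M\<bar> (\<lambda>x. ereal (\<phi> n x)) a R = ennreal (\<bar>M\<bar> - ?I (\<phi> n))"
        by (rule sphere_deficit_continuous(1)[OF c\<phi> R \<phi>(5)])
      ultimately show "sphere_deficit \<bar>M\<bar> (\<lambda>x. ereal (\<phi> n x)) a R \<le> ennreal (\<bar>M\<bar> - (A + e))"
        by (simp only: ennreal_leI)
    qed
    finally have "enn2ereal (sphere_deficit \<bar>M\<bar> W a R) \<le> enn2ereal (ennreal (\<bar>M\<bar> - (A + e)))"
      by (simp add: less_eq_ennreal.rep_eq)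
    also have "\<dots> = ereal (\<bar>M\<bar> - (A + e))" using I[of 0] IM[of 0] by (simp add: enn2ereal_ennreal)
    finally have D: "enn2ereal (sphere_deficit \<bar>M\<bar> W a R) \<le> ereal (\<bar>M\<bar> - (A + e))" .
    have "W y \<le> ereal \<bar>M\<bar>" if "y \<in> sphere a R" for y
      using W(2)[OF that] by (rule order_trans) simp
    then have "spherical_mean W a R = ereal \<bar>M\<bar> - enn2ereal (sphere_deficit \<bar>M\<bar> W a R)"
      by (rule spherical_mean_eq_deficit[OF W(1) order_refl R])
    then show False using D mean e by (cases "enn2ereal (sphere_deficit \<bar>M\<bar> W a R)") auto
  qed
  then obtain n where "?I (\<phi> n) \<le> A + e" by blast
  then show ?thesis using \<phi> by (intro that[of "\<phi> n"]) auto
qed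

text \<open>
  The harmonic function with the upper semicontinuous boundary values \<open>u\<close>, as the infimum \<open>k\<close> of the
  solutions for continuous boundary values decreasing to \<open>u\<close>. Monotone convergence preserves the
  sub-mean value property, and near a boundary point \<open>k\<close> is controlled by any one of these solutions.
  A harmonic majorant \<open>H\<close> with boundary values \<open>\<phi> \<ge> u\<close> stays above \<open>k\<close>.
\<close>

lemma upper_dirichlet_solution:
  fixes u :: "'a::euclidean_space \<Rightarrow> ereal"
  assumes R: "0 < R" and u: "usc_on (sphere a R) u"
    and \<phi>: "continuous_on UNIV \<phi>" "\<And>x. x \<in> sphere a R \<Longrightarrow> u x \<le> ereal (\<phi> x)"
      "\<And>x. x \<in> sphere a R \<Longrightarrow> \<phi> x \<le> M"
    and H: "mean_value_on (cball a R) H" "\<And>x. x \<in> sphere a R \<Longrightarrow> H x = \<phi> x"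
  obtains k where "usc_on (cball a R) k" "\<And>x. x \<in> cball a R \<Longrightarrow> k x \<le> ereal (H x)"
    "\<And>x r. 0 < r \<Longrightarrow> cball x r \<subseteq> cball a R \<Longrightarrow> k x \<le> spherical_mean k x r"
    "spherical_mean u a R \<le> k a"
    "\<And>y c. y \<in> sphere a R \<Longrightarrow> u y < c \<Longrightarrow> \<exists>d>0. \<forall>x\<in>cball a R. dist x y < d \<longrightarrow> k x < c"
proof -
  have ne: "sphere a R \<noteq> {}" using R by simp
  have uM: "u x \<le> ereal M" if "x \<in> sphere a R" for x
    using \<phi>(2)[OF that] \<phi>(3)[OF that] by (meson ereal_less_eq(3) order_trans)
  obtain \<psi>s where \<psi>s: "\<And>n. continuous_on UNIV (\<psi>s n)" "\<And>n x. \<psi>s (Suc n) x \<le> \<psi>s n x"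
    "\<And>n x. x \<in> sphere a R \<Longrightarrow> u x \<le> ereal (\<psi>s n x)" "\<And>x. x \<in> sphere a R \<Longrightarrow> (INF n. ereal (\<psi>s n x)) = u x"
    by (rule usc_decreasing_continuous_approximation[OF ne u uM]) blast+
  \<comment> \<open>The minimum with \<open>\<phi>\<close> keeps the solutions below \<open>H\<close> without changing the limit \<open>u\<close>.\<close>
  define \<psi> where "\<psi> n x = min (\<phi> x) (\<psi>s n x)" for n x
  have c\<psi>: "continuous_on (sphere a R) (\<psi> n)" for n
    unfolding \<psi>_def using continuous_on_min[OF \<phi>(1) \<psi>s(1)] by (rule continuous_on_subset) simp
  have \<psi>_dec: "\<psi> (Suc n) x \<le> \<psi> n x" for n x unfolding \<psi>_def using \<psi>s(2)[of n x] by (rule min.mono[OF order_refl])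
  have u\<psi>: "u x \<le> ereal (\<psi> n x)" if x: "x \<in> sphere a R" for n x
    using \<phi>(2)[OF x] \<psi>s(3)[OF x, of n] by (simp add: \<psi>_def min_def)
  have "\<exists>h. mean_value_on (cball a R) h \<and> (\<forall>x\<in>sphere a R. h x = \<psi> n x)" for n
    by (rule dirichlet_problem_ball[OF R c\<psi>[of n]]) auto
  then obtain K where K: "\<And>n. mean_value_on (cball a R) (K n)" "\<And>n x. x \<in> sphere a R \<Longrightarrow> K n x = \<psi> n x" by metis
  have cmp: "h x \<le> g x" if "mean_value_on (cball a R) h" "mean_value_on (cball a R) g"
    "\<And>x. x \<in> sphere a R \<Longrightarrow> h x \<le> g x" "x \<in> cball a R" for h g x
    using mean_value_on_le[OF mean_value_on_linear[OF that(1,2), of 1 "-1"] _ that(4), of 0] that(3) by simp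
  have KH: "K n x \<le> H x" if "x \<in> cball a R" for n x
    by (rule cmp[OF K(1) H(1) _ that]) (simp add: K(2) H(2) \<psi>_def)
  have K_dec: "K (Suc n) x \<le> K n x" if "x \<in> cball a R" for n x
    by (rule cmp[OF K(1) K(1) _ that]) (simp add: K(2) \<psi>_dec)
  have HM: "H x \<le> M" if "x \<in> cball a R" for x
    by (rule mean_value_on_le[OF H(1) _ that]) (simp add: H(2) \<phi>(3))
  define k where "k x = (INF n. ereal (K n x))" for x
  have k_le: "k x \<le> ereal (K n x)" for n x unfolding k_def by (rule INF_lower) simp
  have cK: "continuous_on (cball a R) (K n)" for n using K(1) by (simp add: mean_value_on_def)
  have kH: "k x \<le> ereal (H x)" if "x \<in> cball a R" for x
    using k_le[of x 0] KH[OF that, of 0] by (meson ereal_less_eq(3) order_trans)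
  have kM: "k x \<le> ereal M" if "x \<in> cball a R" for x
    using kH[OF that] HM[OF that] by (meson ereal_less_eq(3) order_trans)
  show ?thesis
  proof (rule that[of k])
    show usc_k: "usc_on (cball a R) k"
      unfolding k_def by (rule usc_on_INF) (rule usc_on_continuous[OF cK])
    show "k x \<le> ereal (H x)" if "x \<in> cball a R" for x using kH[OF that] .
    show "k x \<le> spherical_mean k x r" if r: "0 < r" "cball x r \<subseteq> cball a R" for x r
    proof -
      have s: "sphere x r \<subseteq> cball a R" using sphere_cball r(2) by (rule order_trans)
      have "sphere_deficit M k x r = (SUP n. sphere_deficit M (\<lambda>y. ereal (K n y)) x r)"
        unfolding k_def
        by (rule sphere_deficit_INF[OF r(1) usc_on_subset[OF usc_on_continuous[OF cK] s]])
           (use K_dec s in auto)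
      also have "\<dots> \<le> e2ennreal (ereal M - k x)"
      proof (rule SUP_least)
        fix n
        have "sphere_deficit M (\<lambda>y. ereal (K n y)) x r = ennreal (M - K n x)"
        proof -
          have "(sphere_integral (K n) x r) = K n x"
            using K(1)[of n] r by (simp add: mean_value_on_def)
          moreover have "K n y \<le> M" if "y \<in> sphere x r" for y
            using KH[of y n] HM[of y] s that by (meson order_trans subsetD)
          ultimately show ?thesis
            using sphere_deficit_continuous(1)[OF continuous_on_subset[OF cK s] r(1), of n M] by simp
        qed
        also have "\<dots> = e2ennreal (ereal M - ereal (K n x))" by simp
        also have "\<dots> \<le> e2ennreal (ereal M - k x)"
          using k_le[of x n] by (intro e2ennreal_mono ereal_minus_mono) auto
        finally show "sphere_deficit M (\<lambda>y. ereal (K n y)) x r \<le> e2ennreal (ereal M - k x)" .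
      qed
      finally have "sphere_deficit M k x r \<le> e2ennreal (ereal M - k x)" .
      moreover have "k y \<le> ereal M" if "y \<in> cball x r" for y using kM subsetD[OF r(2) that] by blast
      ultimately show ?thesis using submean_iff_deficit[OF usc_k r(2,1)] by blast
    qed
    show "spherical_mean u a R \<le> k a"
      unfolding k_def
    proof (rule INF_greatest)
      fix n
      have "spherical_mean u a R \<le> spherical_mean (\<lambda>x. ereal (\<psi> n x)) a R"
        by (rule spherical_mean_mono[OF R u\<psi>])
      also have "\<dots> = spherical_mean (\<lambda>x. ereal (K n x)) a R"
        by (rule spherical_mean_cong[OF R]) (simp add: K(2))
      also have "\<dots> = ereal (K n a)" by (rule mean_value_on_spherical_mean[OF K(1) R order_refl])
      finally show "spherical_mean u a R \<le> ereal (K n a)" .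
    qed
    fix y c assume y: "y \<in> sphere a R" and c: "u y < c"
    have "(INF n. ereal (\<psi>s n y)) < c" using c \<psi>s(4)[OF y] by simp
    then obtain n where n: "ereal (\<psi>s n y) < c" by (auto simp: INF_less_iff)
    have "ereal (K n y) < c" using n by (rule le_less_trans[rotated]) (simp add: K(2)[OF y] \<psi>_def)
    then obtain d where d: "d > 0" "\<And>x. x \<in> cball a R \<Longrightarrow> dist x y < d \<Longrightarrow> ereal (K n x) < c"
      using usc_onD[OF usc_on_continuous[OF cK[of n]], of y c] y by auto
    have "k x < c" if "x \<in> cball a R" "dist x y < d" for x
      using k_le[of x n] d(2)[OF that] by (rule le_less_trans)
    then show "\<exists>d>0. \<forall>x\<in>cball a R. dist x y < d \<longrightarrow> k x < c" using d(1) by blast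
  qed
qed

text \<open>
  The heart of the argument. Let \<open>H\<close> be harmonic in the ball with boundary values slightly above
  \<open>W\<close>, and let \<open>k\<close> be the solution with boundary values \<open>u\<close>. The function \<open>g = W - H + k\<close> is
  subharmonic in the ball. From \<open>k \<le> H\<close> it follows that \<open>g \<le> W\<close>, and from \<open>W \<le> H\<close> that \<open>g \<le> k\<close>, so
  that \<open>g\<close> has boundary values at most \<open>u\<close> and may be glued to \<open>u\<close>. At the centre, \<open>H\<close> and \<open>k\<close>
  are essentially the means \<open>A\<close> and \<open>B\<close> of \<open>W\<close> and \<open>u\<close>, so \<open>g\<close> is smaller than \<open>W\<close> there only by about
  \<open>A - B\<close>. (If \<open>H\<close> and \<open>k\<close> are the Poisson integrals of \<open>W\<close> and \<open>u\<close>, then \<open>g\<close> is the Poisson integral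
  of \<open>u\<close> minus the Green potential of \<open>W\<close>.)
\<close>

lemma subharmonic_intermediate:
  fixes u W :: "'a::euclidean_space \<Rightarrow> ereal"
  assumes \<Omega>: "open \<Omega>" "cball a R \<subseteq> \<Omega>" and R: "0 < R"
    and u: "subharmonic_on \<Omega> u" and W: "subharmonic_on \<Omega> W" and uW: "\<And>x. x \<in> \<Omega> \<Longrightarrow> u x \<le> W x"
    and mW: "spherical_mean W a R = ereal A" and mu: "spherical_mean u a R = ereal B" and e: "0 < e"
  obtains Q where "subharmonic_on \<Omega> Q" "\<And>x. x \<in> \<Omega> \<Longrightarrow> u x \<le> Q x" "\<And>x. x \<in> \<Omega> \<Longrightarrow> Q x \<le> W x"
    "\<And>x. x \<notin> ball a R \<Longrightarrow> Q x = u x" "W a \<le> Q a + ereal (A - B + e)"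
proof -
  have W': "usc_on \<Omega> W" "\<And>x. x \<in> \<Omega> \<Longrightarrow> W x < \<infinity>"
    "\<And>x r. 0 < r \<Longrightarrow> cball x r \<subseteq> \<Omega> \<Longrightarrow> W x \<le> spherical_mean W x r"
    using W unfolding subharmonic_on_def by auto
  have u': "usc_on \<Omega> u" using u unfolding subharmonic_on_def by auto
  have cW: "usc_on (cball a R) W" "\<And>x. x \<in> cball a R \<Longrightarrow> W x < \<infinity>"
    using usc_on_subset[OF W'(1) \<Omega>(2)] W'(2) \<Omega>(2) by auto
  have s\<Omega>: "sphere a R \<subseteq> \<Omega>" using sphere_cball \<Omega>(2) by (rule order_trans)
  have a: "a \<in> cball a R" using R by simp
  obtain M where M: "\<And>x. x \<in> cball a R \<Longrightarrow> W x \<le> ereal M"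
    using usc_on_compact_bounded[OF compact_cball cW] by blast
  have MW: "\<And>x. x \<in> sphere a R \<Longrightarrow> W x \<le> ereal M" using M sphere_cball by blast
  have Wsub: "\<exists>r>0. cball x r \<subseteq> cball a R \<and> W x \<le> spherical_mean W x r" if x: "x \<in> ball a R" for x
  proof -
    obtain r where "r > 0" "cball x r \<subseteq> ball a R" using x open_ball open_contains_cball by blast
    then have r: "r > 0" "cball x r \<subseteq> cball a R" using ball_subset_cball[of a R] by blast+
    then have "cball x r \<subseteq> \<Omega>" using \<Omega>(2) by blast
    then show ?thesis using W'(3)[OF r(1)] r by blast
  qed
  obtain \<phi> where \<phi>: "continuous_on UNIV \<phi>" "\<And>x. x \<in> sphere a R \<Longrightarrow> W x \<le> ereal (\<phi> x)"
    "\<And>x. \<phi> x \<le> \<bar>M\<bar>" "(sphere_integral \<phi> a R) \<le> A + e"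
    using continuous_majorant_mean[OF R usc_on_subset[OF W'(1) s\<Omega>] MW mW e] by blast
  have c\<phi>: "continuous_on (sphere a R) \<phi>" using \<phi>(1) by (rule continuous_on_subset) simp
  obtain H where H: "mean_value_on (cball a R) H" "\<And>x. x \<in> sphere a R \<Longrightarrow> H x = \<phi> x"
    using dirichlet_problem_ball[OF R c\<phi>] by blast
  have WH: "W x \<le> ereal (H x)" if "x \<in> cball a R" for x
    by (rule submean_le_mean_value[OF cW Wsub H(1) _ that]) (simp_all add: H(2) \<phi>(2))
  have u\<phi>: "u x \<le> ereal (\<phi> x)" if "x \<in> sphere a R" for x
    using uW[of x] \<phi>(2)[OF that] that s\<Omega> order_trans by blast
  obtain k where k: "usc_on (cball a R) k" "\<And>x. x \<in> cball a R \<Longrightarrow> k x \<le> ereal (H x)"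
    "\<And>x r. 0 < r \<Longrightarrow> cball x r \<subseteq> cball a R \<Longrightarrow> k x \<le> spherical_mean k x r"
    "spherical_mean u a R \<le> k a"
    "\<And>y c. y \<in> sphere a R \<Longrightarrow> u y < c \<Longrightarrow> \<exists>d>0. \<forall>x\<in>cball a R. dist x y < d \<longrightarrow> k x < c"
    using upper_dirichlet_solution[OF R usc_on_subset[OF u' s\<Omega>] \<phi>(1) u\<phi> \<phi>(3) H] by blast
  define g where "g x = W x + (ereal (- H x) + k x)" for x
  have H': "mean_value_on (cball a R) (\<lambda>x. - H x)" using H(1) by (rule mean_value_on_uminus)
  have usc_H: "usc_on (cball a R) (\<lambda>x. ereal (- H x))"
    using H' by (intro usc_on_continuous) (simp add: mean_value_on_def)
  have k_fin: "k x < \<infinity>" if "x \<in> cball a R" for x using k(2)[OF that] by auto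
  have Hk_fin: "ereal (- H x) + k x < \<infinity>" if "x \<in> cball a R" for x using k_fin[OF that] by (cases "k x") auto
  have usc_Hk: "usc_on (cball a R) (\<lambda>x. ereal (- H x) + k x)"
    by (rule usc_on_add[OF usc_H k(1)]) (use k_fin in auto)
  have usc_g: "usc_on (cball a R) g"
    unfolding g_def by (rule usc_on_add[OF cW(1) usc_Hk cW(2) Hk_fin])
  have g_fin: "g x < \<infinity>" if "x \<in> cball a R" for x
    using cW(2)[OF that] Hk_fin[OF that] unfolding g_def by (cases "W x"; cases "ereal (- H x) + k x") auto
  have g_sub: "g x \<le> spherical_mean g x r" if r: "0 < r" "cball x r \<subseteq> cball a R" for x r
  proof -
    have "ereal (- H x) + k x \<le> spherical_mean (\<lambda>x. ereal (- H x) + k x) x r"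
      by (rule submean_add[OF usc_on_subset[OF usc_H r(2)] _ _ usc_on_subset[OF k(1) r(2)] _ k(3)[OF r] r(1)])
         (use k_fin[OF subsetD[OF r(2)]] mean_value_on_spherical_mean[OF H' r] in auto)
    then show ?thesis unfolding g_def
      by (intro submean_add[OF usc_on_subset[OF cW(1) r(2)] _ _ usc_on_subset[OF usc_Hk r(2)] _ _ r(1)]
            cW(2)[OF subsetD[OF r(2)]] Hk_fin[OF subsetD[OF r(2)]] W'(3)[OF r(1) order_trans[OF r(2) \<Omega>(2)]])
  qed
  have g_le_k: "g x \<le> k x" if "x \<in> cball a R" for x
    using WH[OF that] k_fin[OF that] unfolding g_def by (cases "W x"; cases "k x") auto
  have g_le_W: "g x \<le> W x" if "x \<in> cball a R" for x
    using k(2)[OF that] cW(2)[OF that] unfolding g_def by (cases "W x"; cases "k x") auto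
  let ?Q = "\<lambda>x. if x \<in> ball a R then max (u x) (g x) else u x"
  have "subharmonic_on \<Omega> ?Q"
  proof (rule subharmonic_glue[OF \<Omega>(1) _ u])
    show "ball a R \<subseteq> \<Omega>" using ball_subset_cball \<Omega>(2) by (rule order_trans)
    show "usc_on (ball a R) g" by (rule usc_on_subset[OF usc_g ball_subset_cball])
    show "g x < \<infinity>" if "x \<in> ball a R" for x using g_fin that ball_subset_cball by blast
    show "g x \<le> spherical_mean g x r" if "0 < r" "cball x r \<subseteq> ball a R" for x r
      using that(2) ball_subset_cball by (intro g_sub[OF that(1)]) (rule order_trans)
    fix y c assume y: "y \<in> sphere a R" "u y < c"
    obtain d where d: "d > 0" "\<And>x. x \<in> cball a R \<Longrightarrow> dist x y < d \<Longrightarrow> k x < c" using k(5)[OF y] by blast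
    have "g x < c" if "x \<in> ball a R" "dist x y < d" for x
    proof -
      have x: "x \<in> cball a R" using that(1) by auto
      show ?thesis using g_le_k[OF x] d(2)[OF x that(2)] by (rule le_less_trans)
    qed
    then show "\<exists>d>0. \<forall>x\<in>ball a R. dist x y < d \<longrightarrow> g x < c" using d(1) by blast
  qed
  moreover have "W a \<le> ?Q a + ereal (A - B + e)"
  proof -
    have "H a = (sphere_integral H a R)"
      using H(1) R by (simp add: mean_value_on_def)
    also have "\<dots> = (sphere_integral \<phi> a R)"
      by (rule set_lebesgue_integral_cong) (use H(2) R in \<open>auto simp: dist_norm\<close>)
    finally have Ha: "H a \<le> A + e" using \<phi>(4) by simp
    have kB: "ereal B \<le> k a" using k(4) mu by simp
    have "W a \<le> g a + ereal (A - B + e)"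
      using kB Ha cW(2)[OF a] k_fin[OF a] unfolding g_def by (cases "W a"; cases "k a") auto
    also have "\<dots> \<le> ?Q a + ereal (A - B + e)" using R by (intro add_right_mono) simp
    finally show ?thesis .
  qed
  moreover have "?Q x \<le> W x" if "x \<in> \<Omega>" for x
    using uW[OF that] g_le_W[of x] by auto
  ultimately show ?thesis by (intro that[of ?Q]) auto
qed

section \<open>Ball averages of an upper envelope\<close>

text \<open>
  The pointwise version of \<^const>\<open>sphere_deficit\<close>, cut off to \<open>\<Omega>\<close> in order to be Borel measurable on the
  whole space.
\<close>

definition deficit_on :: "'a set \<Rightarrow> real \<Rightarrow> ('a \<Rightarrow> ereal) \<Rightarrow> 'a \<Rightarrow> ennreal" where
  "deficit_on \<Omega> M u x = e2ennreal (ereal M - u x) * indicator \<Omega> x"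

lemma measurable_deficit_on:
  fixes u :: "'a::metric_space \<Rightarrow> ereal"
  assumes "open \<Omega>" "usc_on \<Omega> u"
  shows "deficit_on \<Omega> M u \<in> borel_measurable borel"
proof -
  have "(\<lambda>x. e2ennreal (ereal M - u x)) \<in> borel_measurable (restrict_space borel \<Omega>)"
    using usc_on_measurable[OF assms(2)] by measurable
  then show ?thesis unfolding deficit_on_def[abs_def]
    using assms(1) by (subst (asm) borel_measurable_restrict_space_iff_ennreal) auto
qed

lemma deficit_on_antimono: "u x \<le> v x \<Longrightarrow> deficit_on \<Omega> M v x \<le> deficit_on \<Omega> M u x"
  unfolding deficit_on_def by (intro mult_right_mono e2ennreal_mono ereal_minus_mono) auto

lemma nn_integral_deficit_on_sphere:
  fixes u :: "'a::euclidean_space \<Rightarrow> ereal"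
  assumes "0 < r" "sphere x r \<subseteq> \<Omega>"
  shows "(\<integral>\<^sup>+z. deficit_on \<Omega> M u (x + r *\<^sub>R z) \<partial>sphere_measure) = sphere_deficit M u x r"
  unfolding sphere_deficit_def
proof (rule nn_integral_cong_AE, use AE_sphere_measure in eventually_elim)
  fix z :: 'a assume z: "z \<in> sphere 0 1"
  then have "x + r *\<^sub>R z \<in> sphere x r" using assms(1) by (simp add: dist_norm)
  then show "deficit_on \<Omega> M u (x + r *\<^sub>R z) = e2ennreal (ereal M - u (x + r *\<^sub>R z)) * indicator (sphere 0 1) z"
    using assms(2) z by (auto simp: deficit_on_def)
qed

text \<open>
  Integrate the sub-mean value property over the radii, in polar coordinates.
\<close>

lemma subharmonic_ball_deficit:
  fixes u :: "'a::euclidean_space \<Rightarrow> ereal"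
  assumes \<Omega>: "open \<Omega>" and u: "subharmonic_on \<Omega> u" and r: "0 < r" "cball x r \<subseteq> \<Omega>"
    and M: "\<And>y. y \<in> cball x r \<Longrightarrow> u y \<le> ereal M"
  shows "(\<integral>\<^sup>+y\<in>ball x r. deficit_on \<Omega> M u y \<partial>lborel)
      \<le> emeasure lborel (ball x r) * e2ennreal (ereal M - u x)"
proof -
  interpret R: finite_measure "radius_measure TYPE('a)" by (rule finite_measure_radius_measure)
  have u': "usc_on \<Omega> u" "\<And>x r. 0 < r \<Longrightarrow> cball x r \<subseteq> \<Omega> \<Longrightarrow> u x \<le> spherical_mean u x r"
    using u unfolding subharmonic_on_def by auto
  have [measurable]: "deficit_on \<Omega> M u \<in> borel_measurable borel" by (rule measurable_deficit_on[OF \<Omega> u'(1)])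
  have "(\<integral>\<^sup>+ y. deficit_on \<Omega> M u (x + r *\<^sub>R y) \<partial>ball_uniform)
     = (\<integral>\<^sup>+ s. \<integral>\<^sup>+ z. deficit_on \<Omega> M u (x + r *\<^sub>R (s *\<^sub>R z)) \<partial>sphere_measure \<partial>radius_measure TYPE('a))"
    by (rule nn_integral_polar) measurable
  also have "\<dots> \<le> (\<integral>\<^sup>+ s. e2ennreal (ereal M - u x) \<partial>radius_measure TYPE('a))"
  proof (rule nn_integral_mono_AE, use AE_radius_measure in eventually_elim)
    fix s :: real assume s: "0 < s \<and> s < 1"
    have rs: "0 < r * s" "cball x (r * s) \<subseteq> cball x r"
      using s r(1) by (auto intro!: subset_cball simp: mult_left_le)
    have s\<Omega>: "cball x (r * s) \<subseteq> \<Omega>" using rs(2) r(2) by (rule order_trans)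
    have "(\<integral>\<^sup>+ z. deficit_on \<Omega> M u (x + r *\<^sub>R (s *\<^sub>R z)) \<partial>sphere_measure) = sphere_deficit M u x (r * s)"
      using nn_integral_deficit_on_sphere[OF rs(1) order_trans[OF sphere_cball s\<Omega>], of M u] by simp
    also have "\<dots> \<le> e2ennreal (ereal M - u x)"
      using submean_iff_deficit[OF u'(1) s\<Omega> rs(1)] M rs(2) u'(2)[OF rs(1) s\<Omega>] by blast
    finally show "(\<integral>\<^sup>+ z. deficit_on \<Omega> M u (x + r *\<^sub>R (s *\<^sub>R z)) \<partial>sphere_measure) \<le> e2ennreal (ereal M - u x)" .
  qed
  also have "\<dots> = e2ennreal (ereal M - u x)" by (simp add: emeasure_radius_measure_UNIV)
  finally show ?thesis
    by (subst nn_integral_ball_uniform[OF r(1)]) (auto intro: mult_left_mono)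
qed

text \<open>
  Integrate the hypothesis over \<open>ball a \<rho>\<close> and exchange the order of integration. Since
  \<open>x \<in> ball y r\<close> is symmetric in \<open>x\<close> and \<open>y\<close>, a point \<open>y\<close> of the smaller ball is counted with the full
  measure of \<open>ball y r\<close>.
\<close>

lemma ball_average_symmetric_le:
  fixes v w :: "'a::euclidean_space \<Rightarrow> ennreal"
  assumes [measurable]: "v \<in> borel_measurable borel" "w \<in> borel_measurable borel" and r: "0 < r"
    and avg: "\<And>x. x \<in> ball a \<rho> \<Longrightarrow>
      (\<integral>\<^sup>+y\<in>ball x r. v y \<partial>lborel) \<le> emeasure lborel (ball x r) * w x"
  shows "(\<integral>\<^sup>+y\<in>ball a (\<rho> - r). v y \<partial>lborel) \<le> (\<integral>\<^sup>+x\<in>ball a \<rho>. w x \<partial>lborel)"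
proof -
  define c where "c = emeasure lborel (ball (0::'a) r)"
  have c: "emeasure lborel (ball x r) = c" for x :: 'a using r by (simp add: c_def emeasure_ball)
  have c0: "c \<noteq> 0" "c \<noteq> \<infinity>"
    using emeasure_lborel_ball_pos[OF r, of "0::'a"] emeasure_lborel_ball_finite[of "0::'a" r] by (auto simp: c_def)
  have ind: "indicator (ball x r) y = (indicator {..<r} (dist x y) :: ennreal)" for x y :: 'a by (auto simp: indicator_def)
  have indU: "indicator (ball a s) y = (indicator {..<s} (dist a y) :: ennreal)" for y :: 'a and s by (auto simp: indicator_def)
  have "c * (\<integral>\<^sup>+y\<in>ball a (\<rho> - r). v y \<partial>lborel) = (\<integral>\<^sup>+y. v y * indicator (ball a (\<rho> - r)) y * c \<partial>lborel)"
    unfolding indU by (subst nn_integral_multc) (auto simp: mult.commute)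
  also have "\<dots> \<le> (\<integral>\<^sup>+y. \<integral>\<^sup>+x. indicator {..<\<rho>} (dist a x) * (v y * indicator {..<r} (dist x y)) \<partial>lborel \<partial>lborel)"
  proof (rule nn_integral_mono)
    fix y :: 'a
    have "v y * indicator (ball a (\<rho> - r)) y * c = (\<integral>\<^sup>+x\<in>ball y r. (v y * indicator (ball a (\<rho> - r)) y) \<partial>lborel)"
      by (simp add: nn_integral_cmult_indicator c)
    also have "\<dots> \<le> (\<integral>\<^sup>+x. indicator {..<\<rho>} (dist a x) * (v y * indicator {..<r} (dist x y)) \<partial>lborel)"
    proof (rule nn_integral_mono)
      fix x
      show "(v y * indicator (ball a (\<rho> - r)) y) * indicator (ball y r) x \<le> indicator {..<\<rho>} (dist a x) * (v y * indicator {..<r} (dist x y))"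
        using dist_triangle[of a x y] by (auto simp: indicator_def dist_commute)
    qed
    finally show "v y * indicator (ball a (\<rho> - r)) y * c \<le> (\<integral>\<^sup>+x. indicator {..<\<rho>} (dist a x) * (v y * indicator {..<r} (dist x y)) \<partial>lborel)" .
  qed
  also have "\<dots> = (\<integral>\<^sup>+x. \<integral>\<^sup>+y. indicator {..<\<rho>} (dist a x) * (v y * indicator {..<r} (dist x y)) \<partial>lborel \<partial>lborel)"
    by (rule lborel_pair.Fubini') measurable
  also have "\<dots> \<le> (\<integral>\<^sup>+x. c * (w x * indicator (ball a \<rho>) x) \<partial>lborel)"
  proof (rule nn_integral_mono)
    fix x :: 'a
    have "(\<integral>\<^sup>+y. indicator {..<\<rho>} (dist a x) * (v y * indicator {..<r} (dist x y)) \<partial>lborel)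
        = indicator (ball a \<rho>) x * (\<integral>\<^sup>+y\<in>ball x r. v y \<partial>lborel)"
      unfolding ind indU by (rule nn_integral_cmult) measurable
    also have "\<dots> \<le> c * (w x * indicator (ball a \<rho>) x)"
      using avg[of x] by (auto simp: indicator_def c)
    finally show "(\<integral>\<^sup>+y. indicator {..<\<rho>} (dist a x) * (v y * indicator {..<r} (dist x y)) \<partial>lborel) \<le> c * (w x * indicator (ball a \<rho>) x)" .
  qed
  also have "\<dots> = c * (\<integral>\<^sup>+x\<in>ball a \<rho>. w x \<partial>lborel)"
    unfolding indU by (rule nn_integral_cmult) measurable
  finally show ?thesis using c0 by (simp add: ennreal_mult_le_mult_iff)
qed

lemma ball_average_limit_le:
  fixes v w :: "'a::euclidean_space \<Rightarrow> ennreal"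
  assumes [measurable]: "v \<in> borel_measurable borel" "w \<in> borel_measurable borel" and \<rho>: "0 < \<rho>"
    and avg: "\<And>x r. x \<in> ball a \<rho> \<Longrightarrow> 0 < r \<Longrightarrow> r < \<rho> \<Longrightarrow>
      (\<integral>\<^sup>+y\<in>ball x r. v y \<partial>lborel) \<le> emeasure lborel (ball x r) * w x"
  shows "(\<integral>\<^sup>+y\<in>ball a \<rho>. v y \<partial>lborel) \<le> (\<integral>\<^sup>+x\<in>ball a \<rho>. w x \<partial>lborel)"
proof -
  \<comment> \<open>The offset \<open>2\<close> ensures \<open>\<rho> / real (n + 2) < \<rho>\<close> for all \<open>n\<close>.\<close>
  define B where "B n = ball a (\<rho> - \<rho> / real (n + 2))" for n
  have inc: "incseq B"
    unfolding B_def using \<rho> by (intro incseq_SucI subset_ball diff_left_mono divide_left_mono) auto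
  have UB: "(\<Union>n. B n) = ball a \<rho>"
  proof
    show "(\<Union>n. B n) \<subseteq> ball a \<rho>" unfolding B_def using \<rho> by (intro UN_least subset_ball) simp
    show "ball a \<rho> \<subseteq> (\<Union>n. B n)"
    proof
      fix x assume x: "x \<in> ball a \<rho>"
      obtain n where n: "\<rho> / (\<rho> - dist a x) < real n" using reals_Archimedean2 by blast
      have "\<rho> < real n * (\<rho> - dist a x)" using n x by (simp add: field_simps)
      also have "\<dots> \<le> real (n + 2) * (\<rho> - dist a x)" using x by (intro mult_right_mono) auto
      finally have "\<rho> / real (n + 2) < \<rho> - dist a x" by (simp add: field_simps)
      then have "x \<in> B n" by (simp add: B_def)
      then show "x \<in> (\<Union>n. B n)" by blast
    qed
  qed
  let ?N = "density lborel v"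
  have em: "emeasure ?N A = (\<integral>\<^sup>+y. v y * indicator A y \<partial>lborel)" if "A \<in> sets borel" for A
    using that by (subst emeasure_density) auto
  have "(\<integral>\<^sup>+y\<in>ball a \<rho>. v y \<partial>lborel) = emeasure ?N (\<Union>n. B n)" by (simp add: em UB)
  also have "\<dots> = (SUP n. emeasure ?N (B n))"
    by (rule SUP_emeasure_incseq[OF _ inc, symmetric]) (auto simp: B_def)
  also have "\<dots> \<le> (\<integral>\<^sup>+x\<in>ball a \<rho>. w x \<partial>lborel)"
  proof (rule SUP_least)
    fix n
    have r: "0 < \<rho> / real (n + 2)" "\<rho> / real (n + 2) < \<rho>" using \<rho> by (auto simp: field_simps add_pos_nonneg)
    have "emeasure ?N (B n) = (\<integral>\<^sup>+y. v y * indicator (ball a (\<rho> - \<rho> / real (n + 2))) y \<partial>lborel)"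
      by (subst em) (auto simp: B_def)
    also have "\<dots> \<le> (\<integral>\<^sup>+x\<in>ball a \<rho>. w x \<partial>lborel)"
      by (rule ball_average_symmetric_le[OF _ _ r(1)]) (use avg r in auto)
    finally show "emeasure ?N (B n) \<le> (\<integral>\<^sup>+x\<in>ball a \<rho>. w x \<partial>lborel)" .
  qed
  finally show ?thesis .
qed

lemma usc_regularization_ge:
  fixes V :: "'a::metric_space \<Rightarrow> ereal"
  assumes "x \<in> \<Omega>"
  shows "V x \<le> usc_regularization \<Omega> V x"
proof (rule ccontr)
  assume "\<not> V x \<le> usc_regularization \<Omega> V x"
  then have "\<forall>\<^sub>F y in inf (nhds x) (principal \<Omega>). V y < V x"
    unfolding usc_regularization_def by (intro Limsup_lessD) (simp add: not_le)
  then have "x \<in> \<Omega> \<longrightarrow> V x < V x"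
    unfolding eventually_inf_principal by (rule eventually_nhds_x_imp_x)
  then show False using assms by simp
qed

lemma usc_regularization_le:
  fixes f :: "'a::metric_space \<Rightarrow> ereal"
  assumes f: "usc_on \<Omega> f" "\<And>y. y \<in> \<Omega> \<Longrightarrow> V y \<le> f y" and x: "x \<in> \<Omega>"
  shows "usc_regularization \<Omega> V x \<le> f x"
  unfolding usc_regularization_def Limsup_le_iff
proof (intro allI impI)
  fix c assume "c > f x"
  then have "\<forall>\<^sub>F y in inf (nhds x) (principal \<Omega>). f y < c" using f(1) x by (auto simp: usc_on_iff)
  then show "\<forall>\<^sub>F y in inf (nhds x) (principal \<Omega>). V y < c"
    unfolding eventually_inf_principal using f(2) by (auto elim!: eventually_mono intro: le_less_trans)
qed

lemma usc_regularization_approx: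
  fixes V :: "'a::metric_space \<Rightarrow> ereal"
  assumes "t < usc_regularization \<Omega> V x" "0 < d"
  obtains y where "y \<in> \<Omega>" "dist y x < d" "t < V y"
proof -
  have "\<not> (\<forall>y. dist y x < d \<longrightarrow> y \<in> \<Omega> \<longrightarrow> V y \<le> t)"
  proof
    assume "\<forall>y. dist y x < d \<longrightarrow> y \<in> \<Omega> \<longrightarrow> V y \<le> t"
    then have "\<forall>\<^sub>F y in inf (nhds x) (principal \<Omega>). V y \<le> t"
      unfolding eventually_inf_principal eventually_nhds_metric using assms(2) by blast
    then have "usc_regularization \<Omega> V x \<le> t"
      unfolding usc_regularization_def by (rule Limsup_bounded)
    then show False using assms(1) by simp
  qed
  then show ?thesis using that by (meson not_le)
qed

lemma subharmonic_on_max: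
  fixes u v :: "'a::euclidean_space \<Rightarrow> ereal"
  assumes "subharmonic_on \<Omega> u" "subharmonic_on \<Omega> v"
  shows "subharmonic_on \<Omega> (\<lambda>x. max (u x) (v x))"
  unfolding subharmonic_on_def
proof (intro conjI allI ballI impI)
  show "usc_on \<Omega> (\<lambda>x. max (u x) (v x))"
    using assms by (intro usc_on_max) (simp_all add: subharmonic_on_def)
  show "max (u x) (v x) < \<infinity>" if "x \<in> \<Omega>" for x
    using assms that by (auto simp: subharmonic_on_def max_def)
  show "max (u x) (v x) \<le> spherical_mean (\<lambda>x. max (u x) (v x)) x r" if "0 < r" "cball x r \<subseteq> \<Omega>" for x r
    using assms that by (intro submean_max) (simp_all add: subharmonic_on_def)
qed

text \<open>
  A form of Choquet's lemma. The part of the hypograph of the envelope over \<open>U\<close> is a subset of a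
  separable metric space, so it has a countable dense subset \<open>T\<close>. For each point of \<open>T\<close> choose a member
  of the family whose graph passes above it, and take successive maxima.
\<close>

lemma choquet_sequence:
  fixes F :: "('a::euclidean_space \<Rightarrow> ereal) set"
  assumes max: "\<And>u v. u \<in> F \<Longrightarrow> v \<in> F \<Longrightarrow> (\<lambda>x. max (u x) (v x)) \<in> F"
    and ne: "y0 \<in> U" "-\<infinity> < upper_envelope F y0"
  obtains u T where "\<And>n. u n \<in> F" "\<And>n x. u n x \<le> u (Suc n) x"
    "{(x, t). x \<in> U \<and> ereal t < upper_envelope F x} \<subseteq> closure T"
    "\<And>x t. (x, t) \<in> T \<Longrightarrow> \<exists>n. ereal t < u n x" "\<exists>x\<in>U. -\<infinity> < u (0::nat) x"
proof -
  define S where "S = {(x, t). x \<in> U \<and> ereal t < upper_envelope F x}"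
  obtain T where T: "countable T" "T \<subseteq> S" "S \<subseteq> closure T" using separable by blast
  obtain t0 where "ereal t0 < upper_envelope F y0" using ne(2) ereal_dense2 by blast
  then have "(y0, t0) \<in> S" using ne(1) by (simp add: S_def)
  then have T_ne: "T \<noteq> {}" using T(3) by auto
  have "\<exists>u\<in>F. ereal (snd p) < u (fst p)" if "p \<in> T" for p
  proof -
    have "ereal (snd p) < upper_envelope F (fst p)" using that T(2) by (auto simp: S_def)
    then show ?thesis by (auto simp: upper_envelope_def less_SUP_iff)
  qed
  then obtain w where w: "\<And>p. p \<in> T \<Longrightarrow> w p \<in> F \<and> ereal (snd p) < w p (fst p)" by metis
  define e where "e = from_nat_into T"
  have e: "e n \<in> T" for n unfolding e_def using T_ne by (rule from_nat_into)
  define u where "u = rec_nat (w (e 0)) (\<lambda>n v x. max (v x) (w (e (Suc n)) x))"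
  have u0: "u 0 = w (e 0)" and uS: "u (Suc n) = (\<lambda>x. max (u n x) (w (e (Suc n)) x))" for n
    by (simp_all add: u_def)
  have uF: "u n \<in> F" for n
    by (induction n) (use w e max in \<open>auto simp: u0 uS\<close>)
  have ge: "w (e n) x \<le> u n x" for n x by (cases n) (auto simp: u0 uS)
  show ?thesis
  proof (rule that[of u T, OF uF])
    show "u n x \<le> u (Suc n) x" for n x by (simp add: uS)
    show "{(x, t). x \<in> U \<and> ereal t < upper_envelope F x} \<subseteq> closure T" using T(3) by (simp add: S_def)
    show "\<exists>n. ereal t < u n x" if xt: "(x, t) \<in> T" for x t
    proof -
      obtain n where n: "e n = (x, t)" unfolding e_def using from_nat_into_surj[OF T(1) xt] by blast
      have "ereal t < w (e n) x" using w[OF e[of n]] n by simp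
      then show ?thesis using ge[of n x] less_le_trans by blast
    qed
    have "fst (e 0) \<in> U" using e[of 0] T(2) by (auto simp: S_def)
    moreover have "-\<infinity> < u 0 (fst (e 0))"
      unfolding u0 using w[OF e[of 0]] by (auto intro: less_trans[rotated])
    ultimately show "\<exists>x\<in>U. -\<infinity> < u 0 x" by blast
  qed
qed

lemma deficit_on_SUP:
  assumes inc: "\<And>n. u n x \<le> u (Suc n) x"
  shows "deficit_on \<Omega> M (\<lambda>y. SUP n. u n y) x = (INF n. deficit_on \<Omega> M (u n) x)"
proof (cases "x \<in> \<Omega>")
  case True
  have dec: "decseq (\<lambda>n. ereal M - u n x)" by (rule decseq_SucI) (use inc in \<open>auto intro: ereal_minus_mono\<close>)
  have "(\<lambda>n. ereal M - u n x) \<longlonglongrightarrow> (INF n. ereal M - u n x)" by (rule LIMSEQ_INF[OF dec])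
  then have "(\<lambda>n. e2ennreal (ereal M - u n x)) \<longlonglongrightarrow> e2ennreal (INF n. ereal M - u n x)"
    by (rule continuous_on_tendsto_compose[OF continuous_on_e2ennreal[of UNIV]]) auto
  moreover have "decseq (\<lambda>n. e2ennreal (ereal M - u n x))"
    using dec by (auto simp: decseq_def intro: e2ennreal_mono)
  then have "(\<lambda>n. e2ennreal (ereal M - u n x)) \<longlonglongrightarrow> (INF n. e2ennreal (ereal M - u n x))" by (rule LIMSEQ_INF)
  ultimately have "e2ennreal (INF n. ereal M - u n x) = (INF n. e2ennreal (ereal M - u n x))"
    by (rule LIMSEQ_unique)
  moreover have "(INF n. ereal M - u n x) = ereal M - (SUP n. u n x)" by (rule INF_ereal_minus_right) auto
  ultimately show ?thesis using True by (simp add: deficit_on_def)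
qed (simp add: deficit_on_def)

text \<open>
  If \<open>(x, m)\<close> is a limit of points \<open>(X k, t k)\<close> below the graph of \<open>SUP n. u n\<close>, then the ball averages
  of \<open>M - (SUP n. u n)\<close> around \<open>X k\<close> are at most \<open>M - t k\<close>. Fatou's lemma carries this over to \<open>x\<close>:
  these averages are lower semicontinuous in the centre.
\<close>

lemma average_of_sup_le:
  fixes u :: "nat \<Rightarrow> 'a::euclidean_space \<Rightarrow> ereal"
  assumes \<Omega>: "open \<Omega>" and u: "\<And>n. subharmonic_on \<Omega> (u n)" and inc: "\<And>n x. u n x \<le> u (Suc n) x"
    and rs: "0 < r" "r < s" "cball x s \<subseteq> \<Omega>" and M: "\<And>n y. y \<in> cball x s \<Longrightarrow> u n y \<le> ereal M"
    and T: "\<And>y t. (y, t) \<in> T \<Longrightarrow> \<exists>n. ereal t < u n y" and cl: "(x, m) \<in> closure T"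
  shows "(\<integral>\<^sup>+y\<in>ball x r. deficit_on \<Omega> M (\<lambda>y. SUP n. u n y) y \<partial>lborel)
      \<le> emeasure lborel (ball x r) * ennreal (M - m)"
proof -
  define v where "v = deficit_on \<Omega> M (\<lambda>y. SUP n. u n y)"
  have v_eq: "v = (\<lambda>x. INF n. deficit_on \<Omega> M (u n) x)" unfolding v_def by (rule ext) (rule deficit_on_SUP[of u, OF inc])
  have mu[measurable]: "deficit_on \<Omega> M (u n) \<in> borel_measurable borel" for n
    using u[of n] \<Omega> by (intro measurable_deficit_on) (auto simp: subharmonic_on_def)
  have [measurable]: "v \<in> borel_measurable borel" unfolding v_eq by measurable
  define c where "c = emeasure lborel (ball (0::'a) r)"
  have c: "emeasure lborel (ball y r) = c" for y :: 'a using rs(1) by (simp add: c_def emeasure_ball)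
  have c_fin: "c < top" using emeasure_lborel_ball_finite[of "0::'a" r] by (simp add: c_def)
  obtain p where p: "\<And>k. p k \<in> T" "p \<longlonglongrightarrow> (x, m)" using cl unfolding closure_sequential by blast
  define X t where "X k = fst (p k)" and "t k = snd (p k)" for k
  have lim: "X \<longlonglongrightarrow> x" "t \<longlonglongrightarrow> m" using tendsto_fst[OF p(2)] tendsto_snd[OF p(2)] by (auto simp: X_def[abs_def] t_def[abs_def])
  have Xt: "\<exists>n. ereal (t k) < u n (X k)" for k using T[of "X k" "t k"] p(1)[of k] by (simp add: X_def t_def)
  have ind: "indicator (ball z r) y = (indicator {..<r} (dist z y) :: ennreal)" for z y :: 'a by (auto simp: indicator_def)
  have ev: "\<forall>\<^sub>F k in sequentially. dist (X k) x < s - r"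
    using lim(1) rs(2) by (intro tendstoD) auto
  have "(\<integral>\<^sup>+y\<in>ball x r. v y \<partial>lborel) \<le> (\<integral>\<^sup>+y. liminf (\<lambda>k. v y * indicator (ball (X k) r) y) \<partial>lborel)"
  proof (rule nn_integral_mono)
    fix y
    show "v y * indicator (ball x r) y \<le> liminf (\<lambda>k. v y * indicator (ball (X k) r) y)"
    proof (cases "y \<in> ball x r")
      case True
      have "(\<lambda>k. dist (X k) y) \<longlonglongrightarrow> dist x y" by (intro tendsto_intros lim)
      then have "\<forall>\<^sub>F k in sequentially. dist (X k) y < r" using True by (intro order_tendstoD) auto
      then show ?thesis using True by (intro Liminf_bounded) (auto elim!: eventually_mono)
    qed simp
  qed
  also have "\<dots> \<le> liminf (\<lambda>k. \<integral>\<^sup>+y. v y * indicator (ball (X k) r) y \<partial>lborel)"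
    by (rule nn_integral_liminf) (simp add: ind)
  also have "\<dots> \<le> liminf (\<lambda>k. c * ennreal (M - t k))"
  proof (rule Liminf_mono, use ev in eventually_elim)
    fix k assume k: "dist (X k) x < s - r"
    have sub: "cball (X k) r \<subseteq> cball x s"
    proof
      fix y assume "y \<in> cball (X k) r"
      then show "y \<in> cball x s" using k dist_triangle[of x y "X k"] by (simp add: dist_commute)
    qed
    obtain n where n: "ereal (t k) < u n (X k)" using Xt by blast
    have "(\<integral>\<^sup>+y. v y * indicator (ball (X k) r) y \<partial>lborel) \<le> (\<integral>\<^sup>+y. deficit_on \<Omega> M (u n) y * indicator (ball (X k) r) y \<partial>lborel)"
      unfolding v_def by (intro nn_integral_mono mult_right_mono deficit_on_antimono SUP_upper) auto
    also have "\<dots> \<le> emeasure lborel (ball (X k) r) * e2ennreal (ereal M - u n (X k))"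
      by (rule subharmonic_ball_deficit[OF \<Omega> u rs(1) order_trans[OF sub rs(3)]]) (use M sub in blast)
    also have "\<dots> \<le> c * e2ennreal (ereal M - ereal (t k))"
      unfolding c using n by (intro mult_left_mono e2ennreal_mono ereal_minus_mono) auto
    finally show "(\<integral>\<^sup>+y. v y * indicator (ball (X k) r) y \<partial>lborel) \<le> c * ennreal (M - t k)" by simp
  qed
  also have "\<dots> = c * ennreal (M - m)"
    by (intro lim_imp_Liminf ennreal_tendsto_cmult c_fin tendsto_ennrealI tendsto_intros lim) simp
  finally show ?thesis by (simp add: v_def c)
qed

lemma nn_integral_eq_AE:
  fixes f g :: "'a \<Rightarrow> ennreal"
  assumes "f \<in> borel_measurable M" "g \<in> borel_measurable M"
    and le: "\<And>x. g x \<le> f x" and int: "integral\<^sup>N M f \<le> integral\<^sup>N M g" and fin: "integral\<^sup>N M g \<noteq> \<infinity>"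
  shows "AE x in M. f x = g x"
proof -
  have "(\<integral>\<^sup>+x. f x - g x \<partial>M) = integral\<^sup>N M f - integral\<^sup>N M g"
    using assms by (intro nn_integral_diff) auto
  also have "\<dots> = 0" using int fin by (simp add: diff_eq_0_iff_ennreal less_top[symmetric] top_unique) (metis top_unique)
  finally have "AE x in M. f x - g x = 0" using assms(1,2) by (subst (asm) nn_integral_0_iff_AE) auto
  then show ?thesis by eventually_elim (use le in \<open>auto simp: diff_eq_0_iff_ennreal intro: antisym\<close>)
qed

text \<open>
  The regularization takes only values that are approached by the function itself at nearby points.
\<close>

lemma regularization_in_closure_hypograph:
  fixes V :: "'a::metric_space \<Rightarrow> ereal"
  assumes U: "open U" "x \<in> U" and m: "usc_regularization \<Omega> V x = ereal m"
  shows "(x, m) \<in> closure {(y, t). y \<in> U \<and> ereal t < V y}"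
  unfolding closure_approachable
proof (intro allI impI)
  fix e :: real assume e: "0 < e"
  obtain d where d: "0 < d" "ball x d \<subseteq> U" using U open_contains_ball by blast
  have "ereal (m - e / 2) < usc_regularization \<Omega> V x" using m e by simp
  moreover have "0 < min (e / 2) d" using e d by simp
  ultimately obtain y where y: "dist y x < min (e / 2) d" "ereal (m - e / 2) < V y"
    using usc_regularization_approx by blast
  have "y \<in> U" using y(1) d(2) by (auto simp: dist_commute)
  moreover have "dist (y, m - e / 2) (x, m) < e"
  proof -
    have "dist (y, m - e / 2) (x, m) \<le> dist y x + dist (m - e / 2) m"
      unfolding dist_Pair_Pair by (rule sqrt_sum_squares_le_sum) auto
    also have "dist (m - e / 2) m = e / 2" using e by (simp add: dist_real_def)
    finally show ?thesis using y(1) by simp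
  qed
  ultimately show "\<exists>p\<in>{(y, t). y \<in> U \<and> ereal t < V y}. dist p (x, m) < e" using y(2) by blast
qed

text \<open>
  By \<open>average_of_sup_le\<close>, the ball averages of the supremum dominate \<open>W\<close>. As the radius tends to zero,
  the integral of the supremum is found to be at least that of \<open>W\<close>, although the supremum may lie
  strictly below \<open>W\<close> at some points.
\<close>

lemma sup_deficit_integral_le:
  fixes u :: "nat \<Rightarrow> 'a::euclidean_space \<Rightarrow> ereal"
  assumes \<Omega>: "open \<Omega>" "cball a (2 * \<rho>) \<subseteq> \<Omega>" and \<rho>: "0 < \<rho>"
    and u: "\<And>n. subharmonic_on \<Omega> (u n)" "\<And>n x. u n x \<le> u (Suc n) x"
      "\<And>n y. y \<in> cball a (2 * \<rho>) \<Longrightarrow> u n y \<le> ereal M"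
    and W: "usc_on \<Omega> W" "\<And>x. x \<in> \<Omega> \<Longrightarrow> W x < \<infinity>"
    and T: "\<And>y t. (y, t) \<in> T \<Longrightarrow> \<exists>n. ereal t < u n y"
      "\<And>x m. x \<in> ball a \<rho> \<Longrightarrow> W x = ereal m \<Longrightarrow> (x, m) \<in> closure T"
  shows "(\<integral>\<^sup>+y\<in>ball a \<rho>. deficit_on \<Omega> M (\<lambda>y. SUP n. u n y) y \<partial>lborel)
    \<le> (\<integral>\<^sup>+y\<in>ball a \<rho>. deficit_on \<Omega> M W y \<partial>lborel)"
proof (rule ball_average_limit_le[OF _ measurable_deficit_on[OF \<Omega>(1) W(1)] \<rho>])
  have [measurable]: "deficit_on \<Omega> M (u n) \<in> borel_measurable borel" for n
    using u(1)[of n] \<Omega>(1) by (intro measurable_deficit_on) (auto simp: subharmonic_on_def)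
  have "deficit_on \<Omega> M (\<lambda>y. SUP n. u n y) = (\<lambda>x. INF n. deficit_on \<Omega> M (u n) x)"
    by (rule ext) (rule deficit_on_SUP[of u, OF u(2)])
  then show "deficit_on \<Omega> M (\<lambda>y. SUP n. u n y) \<in> borel_measurable borel" by simp
  fix x r assume x: "x \<in> ball a \<rho>" and r: "0 < r" "r < \<rho>"
  have sub: "cball x \<rho> \<subseteq> cball a (2 * \<rho>)"
  proof
    fix y assume "y \<in> cball x \<rho>"
    then show "y \<in> cball a (2 * \<rho>)" using x dist_triangle[of a y x] by simp
  qed
  have x\<Omega>: "x \<in> \<Omega>" using \<Omega>(2) sub \<rho> by (intro subsetD[OF \<Omega>(2)] subsetD[OF sub]) simp
  show "(\<integral>\<^sup>+y\<in>ball x r. deficit_on \<Omega> M (\<lambda>y. SUP n. u n y) y \<partial>lborel)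
      \<le> emeasure lborel (ball x r) * deficit_on \<Omega> M W x"
  proof (cases "W x")
    case (real m)
    have "(\<integral>\<^sup>+y\<in>ball x r. deficit_on \<Omega> M (\<lambda>y. SUP n. u n y) y \<partial>lborel)
        \<le> emeasure lborel (ball x r) * ennreal (M - m)"
      by (rule average_of_sup_le[OF \<Omega>(1) u(1,2) r order_trans[OF sub \<Omega>(2)] u(3) T(1) T(2)[OF x real]])
         (use sub in auto)
    then show ?thesis using real x\<Omega> by (simp add: deficit_on_def ereal_minus)
  next
    case MInf
    then have "deficit_on \<Omega> M W x = top" using x\<Omega> by (simp add: deficit_on_def e2ennreal_infty)
    then show ?thesis using emeasure_lborel_ball_pos[OF r(1), of x] by (simp add: ennreal_mult_top)
  qed (use W(2)[OF x\<Omega>] in simp)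
qed

text \<open>
  Equality of the integrals over a ball gives, in polar coordinates, equality of the means over
  almost every sphere. The finite integral of the first function makes monotone convergence
  of the decreasing sequence of deficits available on almost every sphere.
\<close>

lemma sphere_with_converging_deficits:
  fixes u :: "nat \<Rightarrow> 'a::euclidean_space \<Rightarrow> ereal"
  assumes \<Omega>: "open \<Omega>" "ball a \<rho> \<subseteq> \<Omega>" and \<rho>: "0 < \<rho>"
    and u: "\<And>n. usc_on \<Omega> (u n)" "\<And>n x. u n x \<le> u (Suc n) x" and W: "usc_on \<Omega> W"
    and uW: "\<And>n x. x \<in> \<Omega> \<Longrightarrow> u n x \<le> W x"
    and le: "(\<integral>\<^sup>+y\<in>ball a \<rho>. deficit_on \<Omega> M (\<lambda>y. SUP n. u n y) y \<partial>lborel)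
      \<le> (\<integral>\<^sup>+y\<in>ball a \<rho>. deficit_on \<Omega> M W y \<partial>lborel)"
    and fin: "(\<integral>\<^sup>+y\<in>ball a \<rho>. deficit_on \<Omega> M (u 0) y \<partial>lborel) < top"
  obtains R where "0 < R" "R < \<rho>" "(INF n. sphere_deficit M (u n) a R) = sphere_deficit M W a R"
    "sphere_deficit M W a R < top"
proof -
  define v where "v = deficit_on \<Omega> M (\<lambda>y. SUP n. u n y)"
  define w where "w = deficit_on \<Omega> M W"
  define q where "q n = deficit_on \<Omega> M (u n)" for n
  have v_eq: "v x = (INF n. q n x)" for x
    unfolding v_def q_def by (rule deficit_on_SUP[of u, OF u(2)])
  have mq[measurable]: "q n \<in> borel_measurable borel" for n
    unfolding q_def by (rule measurable_deficit_on[OF \<Omega>(1) u(1)])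
  have mv[measurable]: "v \<in> borel_measurable borel" unfolding v_eq[abs_def] by measurable
  have mw[measurable]: "w \<in> borel_measurable borel" unfolding w_def by (rule measurable_deficit_on[OF \<Omega>(1) W])
  have wq: "w x \<le> q n x" for x n
    by (cases "x \<in> \<Omega>") (auto simp: w_def q_def deficit_on_def intro!: e2ennreal_mono ereal_minus_mono uW)
  have wv: "w x \<le> v x" for x unfolding v_eq by (rule INF_greatest) (rule wq)
  have c_pos: "emeasure lborel (ball a \<rho>) \<noteq> 0" and c_fin: "emeasure lborel (ball a \<rho>) < top"
    using emeasure_lborel_ball_pos[OF \<rho>, of a] emeasure_lborel_ball_finite[of a \<rho>] by auto
  interpret S: finite_measure "sphere_measure :: 'a measure" by (rule finite_measure_sphere_measure)
  let ?\<nu> = "radius_measure TYPE('a)"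
  define I where "I g s = (\<integral>\<^sup>+z. g (a + \<rho> *\<^sub>R (s *\<^sub>R z)) \<partial>sphere_measure)" for g :: "'a \<Rightarrow> ennreal" and s
  have polar: "(\<integral>\<^sup>+y\<in>ball a \<rho>. g y \<partial>lborel) = emeasure lborel (ball a \<rho>) * (\<integral>\<^sup>+s. I g s \<partial>?\<nu>)"
    if g[measurable]: "g \<in> borel_measurable borel" for g
  proof -
    have "(\<integral>\<^sup>+y. g (a + \<rho> *\<^sub>R y) \<partial>ball_uniform) = (\<integral>\<^sup>+s. I g s \<partial>?\<nu>)"
      unfolding I_def by (rule nn_integral_polar) measurable
    then show ?thesis using nn_integral_ball_uniform[OF \<rho> g, of a] by simp
  qed
  have mI: "I g \<in> borel_measurable ?\<nu>" if g[measurable]: "g \<in> borel_measurable borel" for g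
    unfolding I_def by measurable
  have Iq_fin: "(\<integral>\<^sup>+s. I (q 0) s \<partial>?\<nu>) < top"
    using fin c_pos unfolding q_def[symmetric] polar[OF mq] by (auto simp: ennreal_mult_less_top)
  have "(\<integral>\<^sup>+s. I w s \<partial>?\<nu>) \<le> (\<integral>\<^sup>+s. I (q 0) s \<partial>?\<nu>)"
    unfolding I_def by (intro nn_integral_mono wq)
  then have Iw_fin: "(\<integral>\<^sup>+s. I w s \<partial>?\<nu>) \<noteq> \<infinity>" using Iq_fin by (auto simp: top_unique)
  have "(\<integral>\<^sup>+s. I v s \<partial>?\<nu>) \<le> (\<integral>\<^sup>+s. I w s \<partial>?\<nu>)"
    using le c_pos c_fin unfolding v_def[symmetric] w_def[symmetric] polar[OF mv] polar[OF mw]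
    by (simp add: ennreal_mult_le_mult_iff)
  then have "AE s in ?\<nu>. I v s = I w s"
    by (intro nn_integral_eq_AE mI mv mw Iw_fin) (auto simp: I_def intro!: nn_integral_mono wv)
  moreover have "AE s in ?\<nu>. I (q 0) s \<noteq> \<infinity>"
    by (rule nn_integral_PInf_AE[OF mI[OF mq]]) (use Iq_fin in simp)
  ultimately have AE: "AE s in ?\<nu>. I v s = I w s \<and> I (q 0) s \<noteq> \<infinity> \<and> 0 < s \<and> s < 1"
    using AE_radius_measure by eventually_elim auto
  have "\<exists>s. I v s = I w s \<and> I (q 0) s \<noteq> \<infinity> \<and> 0 < s \<and> s < 1"
  proof (rule ccontr)
    assume no: "\<not> ?thesis"
    have "AE s in ?\<nu>. False" using AE by eventually_elim (use no in blast)
    then show False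
      using emeasure_radius_measure_UNIV[where 'a='a] by (simp add: AE_iff_null null_sets_def)
  qed
  then obtain s where s: "I v s = I w s" "I (q 0) s \<noteq> \<infinity>" "0 < s" "s < 1" by blast
  define R where "R = \<rho> * s"
  have R: "0 < R" "R < \<rho>" using s \<rho> by (simp_all add: R_def)
  have "sphere a R \<subseteq> ball a \<rho>" using R by auto
  then have sR: "sphere a R \<subseteq> \<Omega>" using \<Omega>(2) by (rule order_trans)
  have I_def': "I g s = (\<integral>\<^sup>+z. g (a + R *\<^sub>R z) \<partial>sphere_measure)" for g by (simp add: I_def R_def)
  have Iw: "I w s = sphere_deficit M W a R"
    unfolding I_def' w_def by (rule nn_integral_deficit_on_sphere[OF R(1) sR])
  have Iq: "I (q n) s = sphere_deficit M (u n) a R" for n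
    unfolding I_def' q_def by (rule nn_integral_deficit_on_sphere[OF R(1) sR])
  have q_dec: "q (Suc n) x \<le> q n x" for n x unfolding q_def by (rule deficit_on_antimono) (rule u(2))
  have "I v s = (INF n. I (q n) s)"
    unfolding I_def' v_eq
  proof (rule nn_integral_monotone_convergence_INF_AE)
    show "(\<integral>\<^sup>+z. q 0 (a + R *\<^sub>R z) \<partial>sphere_measure) < \<infinity>" using s(2) unfolding I_def' by (simp add: less_top)
  qed (use q_dec in auto)
  then have "(INF n. sphere_deficit M (u n) a R) = sphere_deficit M W a R" using s(1) Iw Iq by simp
  moreover have "I w s \<le> I (q 0) s" unfolding I_def by (intro nn_integral_mono wq)
  then have "sphere_deficit M W a R < top" using s(2) unfolding Iw by (auto simp: less_top top_unique)
  ultimately show ?thesis using R by (intro that)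
qed

section \<open>The envelope and its regularization\<close>

text \<open>
  The two families of the theorem share the property used here: a bounded above subharmonic minorant
  of \<open>f\<close> that lies above a member is itself a member. The constructed function \<open>Q\<close> is one, because
  it is at most \<open>W \<le> f\<close>, agrees with a member outside a ball, and \<open>W\<close> is bounded on that ball.
\<close>

lemma envelope_eq_regularization:
  fixes F :: "('a::euclidean_space \<Rightarrow> ereal) set"
  assumes \<Omega>: "open \<Omega>" and f: "usc_on \<Omega> f"
    and F: "F \<subseteq> minorants_bdd_above \<Omega> f"
    and closed: "\<And>u Q. u \<in> F \<Longrightarrow> Q \<in> minorants_bdd_above \<Omega> f \<Longrightarrow> (\<And>x. x \<in> \<Omega> \<Longrightarrow> u x \<le> Q x) \<Longrightarrow> Q \<in> F"
    and W: "subharmonic_on \<Omega> (usc_regularization \<Omega> (upper_envelope F))"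
    and x0: "x0 \<in> \<Omega>"
  shows "upper_envelope F x0 = usc_regularization \<Omega> (upper_envelope F) x0"
proof -
  define V where "V = upper_envelope F"
  define W where "W = usc_regularization \<Omega> V"
  have W_sub: "subharmonic_on \<Omega> W" using W by (simp add: W_def V_def)
  have W': "usc_on \<Omega> W" "\<And>x. x \<in> \<Omega> \<Longrightarrow> W x < \<infinity>"
    using W_sub unfolding subharmonic_on_def by auto
  have F_sub: "subharmonic_on \<Omega> u" and F_f: "\<And>x. x \<in> \<Omega> \<Longrightarrow> u x \<le> f x" and F_bd: "(SUP x\<in>\<Omega>. u x) < \<infinity>"
    if "u \<in> F" for u using F that by (auto simp: minorants_bdd_above_def)
  have uV: "u x \<le> V x" if "u \<in> F" for u x unfolding V_def upper_envelope_def using that by (intro SUP_upper)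
  have V_f: "V x \<le> f x" if "x \<in> \<Omega>" for x unfolding V_def upper_envelope_def using F_f that by (intro SUP_least) auto
  have VW: "V x \<le> W x" if "x \<in> \<Omega>" for x unfolding W_def by (rule usc_regularization_ge[OF that])
  have W_f: "W x \<le> f x" if "x \<in> \<Omega>" for x unfolding W_def by (rule usc_regularization_le[OF f V_f that])
  have max_F: "(\<lambda>x. max (u x) (v x)) \<in> F" if uv: "u \<in> F" "v \<in> F" for u v
  proof (rule closed[OF uv(1)])
    have "(SUP x\<in>\<Omega>. max (u x) (v x)) \<le> max (SUP x\<in>\<Omega>. u x) (SUP x\<in>\<Omega>. v x)"
      by (intro SUP_least max.mono SUP_upper)
    then have "(SUP x\<in>\<Omega>. max (u x) (v x)) < \<infinity>"
      using F_bd[OF uv(1)] F_bd[OF uv(2)] by (auto simp: max_def split: if_splits)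
    then show "(\<lambda>x. max (u x) (v x)) \<in> minorants_bdd_above \<Omega> f"
      using F_f uv subharmonic_on_max[OF F_sub[OF uv(1)] F_sub[OF uv(2)]] by (auto simp: minorants_bdd_above_def)
  qed simp
  have "W x0 \<le> V x0"
  proof (cases "W x0")
    case (real m)
    obtain d where d: "d > 0" "cball x0 d \<subseteq> \<Omega>" using \<Omega> x0 open_contains_cball by blast
    \<comment> \<open>Balls of radius \<open>2 * \<rho>\<close> around points of \<open>ball x0 \<rho>\<close> contain \<open>ball x0 \<rho>\<close> and stay inside \<open>\<Omega>\<close>.\<close>
    define \<rho> where "\<rho> = d / 3"
    have \<rho>: "0 < \<rho>" "cball x0 (3 * \<rho>) \<subseteq> \<Omega>" using d by (auto simp: \<rho>_def)
    have \<rho>2: "cball x0 (2 * \<rho>) \<subseteq> cball x0 (3 * \<rho>)" using \<rho>(1) by (intro subset_cball) simp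
    obtain M where M: "\<And>x. x \<in> cball x0 (3 * \<rho>) \<Longrightarrow> W x \<le> ereal M"
      using usc_on_compact_bounded[OF compact_cball usc_on_subset[OF W'(1) \<rho>(2)]] W'(2) \<rho>(2) by blast
    define U where "U = ball x0 \<rho>"
    have U\<Omega>: "U \<subseteq> \<Omega>" using \<rho> by (auto simp: U_def subset_iff)
    obtain y0 where y0: "y0 \<in> U" "-\<infinity> < V y0"
    proof -
      have "-\<infinity> < usc_regularization \<Omega> V x0" using real by (simp add: W_def)
      then obtain y where "y \<in> \<Omega>" "dist y x0 < \<rho>" "-\<infinity> < V y" using usc_regularization_approx \<rho>(1) by blast
      then show ?thesis using that by (auto simp: U_def dist_commute)
    qed
    obtain u T where u: "\<And>n. u n \<in> F" "\<And>n x. u n x \<le> u (Suc n) x"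
      and T: "{(x, t). x \<in> U \<and> ereal t < V x} \<subseteq> closure T"
        "\<And>x t. (x, t) \<in> T \<Longrightarrow> \<exists>n. ereal t < u n x"
      and u0: "\<exists>x\<in>U. -\<infinity> < u (0::nat) x"
      using choquet_sequence[OF max_F y0(1) y0(2)[unfolded V_def]] unfolding V_def by blast
    have uW: "u n x \<le> W x" if "x \<in> \<Omega>" for n x using uV[OF u(1)] VW[OF that] by (rule order_trans)
    have uM: "u n x \<le> ereal M" if "x \<in> cball x0 (3 * \<rho>)" for n x
      using uW[of x n] M[OF that] \<rho>(2) that by (meson order_trans subsetD)
    have u_sub: "subharmonic_on \<Omega> (u n)" for n using F_sub[OF u(1)] .
    have usc_u: "usc_on \<Omega> (u n)" for n using u_sub[of n] by (simp add: subharmonic_on_def)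
    have cl: "(x, t) \<in> closure T" if "x \<in> ball x0 \<rho>" "W x = ereal t" for x t
    proof -
      have "(x, t) \<in> closure {(x, t). x \<in> U \<and> ereal t < V x}"
        using that by (intro regularization_in_closure_hypograph) (auto simp: U_def W_def)
      then show ?thesis using closure_minimal[OF T(1) closed_closure] by blast
    qed
    have int_le: "(\<integral>\<^sup>+y\<in>ball x0 \<rho>. deficit_on \<Omega> M (\<lambda>y. SUP n. u n y) y \<partial>lborel)
        \<le> (\<integral>\<^sup>+y\<in>ball x0 \<rho>. deficit_on \<Omega> M W y \<partial>lborel)"
      by (rule sup_deficit_integral_le[OF \<Omega> order_trans[OF \<rho>2 \<rho>(2)] \<rho>(1) u_sub u(2) uM W' T(2) cl])
         (use \<rho>2 in auto)
    \<comment> \<open>A subharmonic function that is finite at one point of \<open>ball x0 \<rho>\<close> is integrable on this ball.\<close>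
    have fin: "(\<integral>\<^sup>+y\<in>ball x0 \<rho>. deficit_on \<Omega> M (u 0) y \<partial>lborel) < top"
    proof -
      obtain y1 where y1: "y1 \<in> U" "-\<infinity> < u 0 y1" using u0 by blast
      have "y1 \<in> \<Omega>" using y1 U\<Omega> by blast
      then obtain b where b: "u 0 y1 = ereal b" using uW[of y1 0] W'(2)[of y1] y1(2) by (cases "u 0 y1") auto
      have sub: "cball y1 (2 * \<rho>) \<subseteq> cball x0 (3 * \<rho>)"
      proof
        fix y assume "y \<in> cball y1 (2 * \<rho>)"
        then show "y \<in> cball x0 (3 * \<rho>)" using y1(1) dist_triangle[of x0 y y1] by (simp add: U_def)
      qed
      have "ball x0 \<rho> \<subseteq> ball y1 (2 * \<rho>)"
      proof
        fix y assume "y \<in> ball x0 \<rho>"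
        then show "y \<in> ball y1 (2 * \<rho>)" using y1(1) dist_triangle[of y1 y x0] by (simp add: U_def dist_commute)
      qed
      then have "(\<integral>\<^sup>+y\<in>ball x0 \<rho>. deficit_on \<Omega> M (u 0) y \<partial>lborel)
          \<le> (\<integral>\<^sup>+y\<in>ball y1 (2 * \<rho>). deficit_on \<Omega> M (u 0) y \<partial>lborel)"
        by (intro nn_integral_mono) (auto simp: indicator_def)
      also have "\<dots> \<le> emeasure lborel (ball y1 (2 * \<rho>)) * e2ennreal (ereal M - u 0 y1)"
        by (rule subharmonic_ball_deficit[OF \<Omega> u_sub _ order_trans[OF sub \<rho>(2)]])
           (use \<rho>(1) uM sub in auto)
      also have "\<dots> < top"
        using emeasure_lborel_ball_finite[of y1 "2 * \<rho>"] b by (simp add: ereal_minus ennreal_mult_less_top)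
      finally show ?thesis .
    qed
    obtain R where R: "0 < R" "R < \<rho>" "(INF n. sphere_deficit M (u n) x0 R) = sphere_deficit M W x0 R"
        "sphere_deficit M W x0 R < top"
      by (rule sphere_with_converging_deficits[OF \<Omega> U\<Omega>[unfolded U_def] \<rho>(1) usc_u u(2) W'(1) uW int_le fin]) blast+
    have "cball x0 R \<subseteq> cball x0 (3 * \<rho>)" using R(2) \<rho>(1) by (intro subset_cball) simp
    then have RM: "cball x0 R \<subseteq> cball x0 (3 * \<rho>)" "cball x0 R \<subseteq> \<Omega>" using \<rho>(2) by auto
    have sR: "sphere x0 R \<subseteq> \<Omega>" "sphere x0 R \<subseteq> cball x0 (3 * \<rho>)"
      using order_trans[OF sphere_cball RM(1)] order_trans[OF sphere_cball RM(2)] by auto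
    obtain D where D: "sphere_deficit M W x0 R = ennreal D" "0 \<le> D"
      using R(4) by (cases "sphere_deficit M W x0 R") auto
    have mW: "spherical_mean W x0 R = ereal (M - D)"
      using spherical_mean_eq_deficit[OF W'(1) sR(1) R(1) M[OF subsetD[OF sR(2)]]] D by (simp add: enn2ereal_ennreal)
    show ?thesis
    proof (rule ereal_le_epsilon2)
      fix e :: real assume "0 < e"
      then have e2: "0 < e / 2" by simp
      have "(INF n. sphere_deficit M (u n) x0 R) < ennreal (D + e / 2)"
        unfolding R(3) D(1) using D(2) e2 by (intro ennreal_lessI) auto
      then obtain n where n: "sphere_deficit M (u n) x0 R < ennreal (D + e / 2)" by (auto simp: INF_less_iff)
      then obtain D' where D': "sphere_deficit M (u n) x0 R = ennreal D'" "0 \<le> D'"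
        by (cases "sphere_deficit M (u n) x0 R") auto
      have DD': "D' < D + e / 2" using n D D' by (simp add: ennreal_less_iff)
      have mu: "spherical_mean (u n) x0 R = ereal (M - D')"
        using spherical_mean_eq_deficit[OF usc_u sR(1) R(1) uM[OF subsetD[OF sR(2)]]] D' by (simp add: enn2ereal_ennreal)
      obtain Q where Q: "subharmonic_on \<Omega> Q" "\<And>x. x \<in> \<Omega> \<Longrightarrow> u n x \<le> Q x" "\<And>x. x \<in> \<Omega> \<Longrightarrow> Q x \<le> W x"
        "\<And>x. x \<notin> ball x0 R \<Longrightarrow> Q x = u n x" "W x0 \<le> Q x0 + ereal (M - D - (M - D') + e / 2)"
        by (rule subharmonic_intermediate[OF \<Omega> RM(2) R(1) u_sub W_sub uW mW mu e2]) blast+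
      have "Q \<in> F"
      proof (rule closed[OF u(1)])
        have "(SUP x\<in>\<Omega>. Q x) \<le> max (SUP x\<in>\<Omega>. u n x) (ereal M)"
        proof (rule SUP_least)
          fix x assume x: "x \<in> \<Omega>"
          show "Q x \<le> max (SUP x\<in>\<Omega>. u n x) (ereal M)"
          proof (cases "x \<in> ball x0 R")
            case True
            then have "W x \<le> ereal M" using M RM(1) by (metis ball_subset_cball subsetD)
            then show ?thesis using Q(3)[OF x] by (auto intro: max.coboundedI2 order_trans)
          next
            case False
            then show ?thesis using Q(4) x by (auto intro!: max.coboundedI1 SUP_upper)
          qed
        qed
        also have "\<dots> < \<infinity>" using F_bd[OF u(1)] by (auto simp: max_def)
        finally show "Q \<in> minorants_bdd_above \<Omega> f"
          using Q(1,3) W_f by (auto simp: minorants_bdd_above_def intro: order_trans)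
      qed (rule Q(2))
      then have "Q x0 \<le> V x0" by (rule uV)
      have "W x0 \<le> Q x0 + ereal (M - D - (M - D') + e / 2)" by (rule Q(5))
      also have "\<dots> \<le> V x0 + ereal e" using \<open>Q x0 \<le> V x0\<close> DD' by (intro add_mono) auto
      finally show "W x0 \<le> V x0 + ereal e" .
    qed
  qed (use W'(2)[OF x0] in auto)
  then show ?thesis using VW[OF x0] unfolding W_def V_def by (rule antisym[rotated])
qed

theorem theorem1p1:
  fixes \<Omega> :: "'a::euclidean_space set" and f :: "'a \<Rightarrow> ereal"
  assumes "DIM('a) \<ge> 2"
    and "open \<Omega>" and "connected \<Omega>" and "\<Omega> \<noteq> {}"
    and "usc_on \<Omega> f"
  shows "(let V = upper_envelope (minorants_bdd_above \<Omega> f);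
              W = usc_regularization \<Omega> V
          in subharmonic_on \<Omega> W \<longrightarrow> (\<forall>x\<in>\<Omega>. V x = W x)) \<and>
         (let V = upper_envelope (minorants_bdd \<Omega> f);
              W = usc_regularization \<Omega> V
          in subharmonic_on \<Omega> W \<longrightarrow> (\<forall>x\<in>\<Omega>. V x = W x))"
proof -
  have bdd: "Q \<in> minorants_bdd \<Omega> f"
    if "u \<in> minorants_bdd \<Omega> f" "Q \<in> minorants_bdd_above \<Omega> f" "\<And>x. x \<in> \<Omega> \<Longrightarrow> u x \<le> Q x" for u Q
  proof -
    have "(INF x\<in>\<Omega>. u x) \<le> (INF x\<in>\<Omega>. Q x)" by (rule INF_mono) (use that(3) in blast)
    then show ?thesis using that(1,2) by (auto simp: minorants_bdd_def intro: less_le_trans)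
  qed
  have sub: "minorants_bdd \<Omega> f \<subseteq> minorants_bdd_above \<Omega> f" by (auto simp: minorants_bdd_def)
  show ?thesis
    unfolding Let_def
  proof (intro conjI impI ballI)
    show "upper_envelope (minorants_bdd_above \<Omega> f) x = usc_regularization \<Omega> (upper_envelope (minorants_bdd_above \<Omega> f)) x"
      if "subharmonic_on \<Omega> (usc_regularization \<Omega> (upper_envelope (minorants_bdd_above \<Omega> f)))" "x \<in> \<Omega>" for x
      by (rule envelope_eq_regularization[OF assms(2,5) order_refl _ that])
    show "upper_envelope (minorants_bdd \<Omega> f) x = usc_regularization \<Omega> (upper_envelope (minorants_bdd \<Omega> f)) x"
      if "subharmonic_on \<Omega> (usc_regularization \<Omega> (upper_envelope (minorants_bdd \<Omega> f)))" "x \<in> \<Omega>" for x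
      by (rule envelope_eq_regularization[OF assms(2,5) sub bdd that])
  qed
qed
end
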